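(* Let $\alpha>0$, let $\nu$ be an angular measure and let $Z\sim\mathcal{MS}(\alpha,\nu)$ with c.d.f. $F_Z$. (1) If $\alpha>1$ and $h\in\mathcal{C}^1(\mathbb{R}_+^d)\cap\mathrm{Lip}_1(\mathbb{R}_+^d)$, then $g_h$ satisfies $$\mathscr{L}g_h(x)=h(x)-\mathbb{E}[h(Z)]\qquad\text{for all }x\in\mathbb{R}_+^d .$$ (2) Furthermore, for every $z\in(0,\infty)^d$, the function $g_z$ satisfies $$\mathscr{L}g_z(x)=\mathbf 1_{[0,z]}(x)-F_Z(z)$$ for all $x\in\mathbb{R}_+^d$ such that $x^j\ne z^j$ for every $j\in\{1,\dots,d\}$.
   Context: Fix $d\ge 1$, $\mathbb{R}_+=[0,\infty)$. Operations on vectors (powers, logarithms, quotients, inequalities) are coordinate-wise; $x\oplus y$ is the coordinate-wise maximum; $\|x\|_1=\sum_j|x^j|$. Let $E_0=[0,\infty)^d\setminus\{0\}$, $[0,x]=\prod_j[0,x^j]$ and (for exponent measures) $[0,x]^c$ its complement in $E_0$. Fix a norm $\|\cdot\|$ on $\mathbb{R}^d$ such that $\mathbf{S}_+^{d-1}=\{x\in\mathbb{R}_+^d:\|x\|=1\}\subseteq[0,1]^d$. An angular measure is a finite Borel measure $\nu$ on $\mathbf{S}_+^{d-1}$ with $\int u^j\,\mathrm d\nu(u)=1$ for $j=1,\dots,d$. For $\alpha>0$ the exponent measure $\mu$ is the pushforward of $\alpha r^{-\alpha-1}\mathrm dr\otimes\nu(\mathrm du)$ on $(0,\infty)\times\mathbf{S}_+^{d-1}$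 by $(r,u)\mapsto r\,u^{1/\alpha}$. $\mathcal{MS}(\alpha,\nu)$ is the law of the max-stable random vector $Z$ on $(0,\infty)^d$ with $F_Z(z)=\mathbb{P}(Z\le z)=e^{-\mu([0,z]^c)}$, $z\in(0,\infty)^d$. $\mathrm{Lip}_1(\mathbb{R}_+^d)$ is the set of $h:\mathbb{R}_+^d\to\mathbb{R}$ with $|h(x)-h(y)|\le\|x-y\|_1$ for all $x,y$. The semi-group is $\mathbf{P}_t h(x)=\mathbb{E}\big[h\big(e^{-t/\alpha}x\oplus(1-e^{-t})^{1/\alpha}Z\big)\big]$, $t\ge0$. Its generator, the operator $\mathscr{L}$, is $$\mathscr{L}f(x)=-\frac1\alpha\langle x,\nabla f(x)\rangle+\int_{E_0}\big(f(x\oplus y)-f(x)\big)\,\mathrm d\mu(y).$$ For $h$ as in (1) or $h=\mathbf 1_{[0,z]}$, put $g_h(x)=-\int_0^\infty\big(\mathbf{P}_t h(x)-\mathbb{E}[h(Z)]\big)\mathrm dt$ (a convergent integral), and write $g_z$ for $g_h$ with $h=\mathbf 1_{[0,z]}$.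
   Formalization: Where the largest ratio x^j/z^j exceeds 1 and is attained by several coordinates, g_z has no gradient, so ⟨x,∇g_z(x)⟩ in (2) is read as the derivative of s ↦ g_z(sx) at s=1; elsewhere, and in (1), differentiability is proved and this is the usual term. *)

theory Defs
  imports "HOL-Probability.Probability"
begin

text \<open>
  Vectors are elements of \<open>real^'n\<close>. The order \<open>\<le>\<close>, the closed boxes \<open>{0..z}\<close> and \<open>sup\<close> are
  coordinate-wise on this type, so \<open>{0..}\<close> is the closed orthant and \<open>sup x y\<close> is the
  coordinate-wise maximum. The library's strict order on vectors is not coordinate-wise
  (it means \<open>x \<le> y\<close> and \<open>x \<noteq> y\<close>), hence the following set.
\<close>

definition pos_orthant :: "(real^'n) set" where
  "pos_orthant = {x. \<forall>j. 0 < x $ j}"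

definition punctured_orthant :: "(real^'n) set" where
  "punctured_orthant = {0..} - {0}"

definition is_norm :: "(real^'n \<Rightarrow> real) \<Rightarrow> bool" where
  "is_norm N \<longleftrightarrow>
     (\<forall>x. N x = 0 \<longleftrightarrow> x = 0) \<and>
     (\<forall>c x. N (c *\<^sub>R x) = \<bar>c\<bar> * N x) \<and>
     (\<forall>x y. N (x + y) \<le> N x + N y)"

definition pos_sphere :: "(real^'n \<Rightarrow> real) \<Rightarrow> (real^'n) set" where
  "pos_sphere N = {x. 0 \<le> x \<and> N x = 1}"

definition angular_measure :: "(real^'n \<Rightarrow> real) \<Rightarrow> (real^'n) measure \<Rightarrow> bool" where
  "angular_measure N \<nu> \<longleftrightarrow>
     finite_measure \<nu> \<and>
     sets \<nu> = sets (restrict_space borel (pos_sphere N)) \<and>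
     (\<forall>j. (\<integral>u. u $ j \<partial>\<nu>) = 1)"

definition exponent_measure :: "real \<Rightarrow> (real^'n) measure \<Rightarrow> (real^'n) measure" where
  "exponent_measure \<alpha> \<nu> =
     distr (density (restrict_space lborel {0<..}) (\<lambda>r. ennreal (\<alpha> * r powr (- \<alpha> - 1))) \<Otimes>\<^sub>M \<nu>)
       (restrict_space borel punctured_orthant)
       (\<lambda>(r, u). r *\<^sub>R (\<chi> j. (u $ j) powr (1 / \<alpha>)))"

definition cdf_vec :: "'a measure \<Rightarrow> ('a \<Rightarrow> real^'n) \<Rightarrow> real^'n \<Rightarrow> real" where
  "cdf_vec M Z z = measure M {\<omega> \<in> space M. Z \<omega> \<le> z}"

text \<open>\<open>Z\<close> is a random vector on the probability space \<open>M\<close> with law \<open>MS(\<alpha>, \<nu>)\<close>.\<close>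

definition max_stable :: "'a measure \<Rightarrow> ('a \<Rightarrow> real^'n) \<Rightarrow> real \<Rightarrow> (real^'n) measure \<Rightarrow> bool" where
  "max_stable M Z \<alpha> \<nu> \<longleftrightarrow>
     prob_space M \<and>
     Z \<in> measurable M (restrict_space borel pos_orthant) \<and>
     (\<forall>z \<in> pos_orthant.
        cdf_vec M Z z = exp (- measure (exponent_measure \<alpha> \<nu>) (punctured_orthant - {0..z})))"

definition lip1 :: "(real^'n \<Rightarrow> real) \<Rightarrow> bool" where
  "lip1 h \<longleftrightarrow> (\<forall>x\<ge>0. \<forall>y\<ge>0. \<bar>h x - h y\<bar> \<le> (\<Sum>j\<in>UNIV. \<bar>x $ j - y $ j\<bar>))"

text \<open>On the boundary of the orthant derivatives are taken relative to the orthant.\<close>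

definition C1_orthant :: "(real^'n \<Rightarrow> real) \<Rightarrow> bool" where
  "C1_orthant h \<longleftrightarrow>
     (\<exists>G. continuous_on {0..} G \<and>
          (\<forall>x\<ge>0. (h has_derivative (\<lambda>v. G x \<bullet> v)) (at x within {0..})))"

definition max_stable_semigroup ::
    "real \<Rightarrow> 'a measure \<Rightarrow> ('a \<Rightarrow> real^'n) \<Rightarrow> real \<Rightarrow> (real^'n \<Rightarrow> real) \<Rightarrow> real^'n \<Rightarrow> real" where
  "max_stable_semigroup \<alpha> M Z t h x =
     (\<integral>\<omega>. h (sup (exp (- t / \<alpha>) *\<^sub>R x) ((1 - exp (- t)) powr (1 / \<alpha>) *\<^sub>R Z \<omega>)) \<partial>M)"

definition stein_integrand ::
    "real \<Rightarrow> 'a measure \<Rightarrow> ('a \<Rightarrow> real^'n) \<Rightarrow> (real^'n \<Rightarrow> real) \<Rightarrow> real^'n \<Rightarrow> real \<Rightarrow> real" where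
  "stein_integrand \<alpha> M Z h x t = max_stable_semigroup \<alpha> M Z t h x - (\<integral>\<omega>. h (Z \<omega>) \<partial>M)"

definition stein_sol ::
    "real \<Rightarrow> 'a measure \<Rightarrow> ('a \<Rightarrow> real^'n) \<Rightarrow> (real^'n \<Rightarrow> real) \<Rightarrow> real^'n \<Rightarrow> real" where
  "stein_sol \<alpha> M Z h x = - (LBINT t:{0..}. stein_integrand \<alpha> M Z h x t)"

text \<open>
  The drift term \<open>\<langle>x, \<nabla>f(x)\<rangle>\<close> is read as the derivative of \<open>f\<close> at \<open>x\<close> in the direction \<open>x\<close>.
  Where \<open>f\<close> has a gradient (relative to the orthant) this is the inner product of \<open>x\<close> with
  it, see \<open>radial_deriv_eq\<close> below. The directional form is needed because the Stein solution
  for the indicator of \<open>{0..z}\<close> has no gradient at points where the largest of the ratios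
  \<open>x $ j / z $ j\<close> exceeds 1 and is attained twice: it is a function of that largest
  ratio, and has a kink there, but it is smooth along rays.
\<close>

definition radial_deriv :: "(real^'n \<Rightarrow> real) \<Rightarrow> real^'n \<Rightarrow> real" where
  "radial_deriv f x = deriv (\<lambda>s. f (s *\<^sub>R x)) 1"

definition generator ::
    "real \<Rightarrow> (real^'n) measure \<Rightarrow> (real^'n \<Rightarrow> real) \<Rightarrow> real^'n \<Rightarrow> real" where
  "generator \<alpha> \<nu> f x =
     - (1 / \<alpha>) * radial_deriv f x + (\<integral>y. (f (sup x y) - f x) \<partial>exponent_measure \<alpha> \<nu>)"

definition generator_defined ::
    "real \<Rightarrow> (real^'n) measure \<Rightarrow> (real^'n \<Rightarrow> real) \<Rightarrow> real^'n \<Rightarrow> bool" where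
  "generator_defined \<alpha> \<nu> f x \<longleftrightarrow>
     (\<lambda>s::real. f (s *\<^sub>R x)) differentiable (at 1) \<and>
     integrable (exponent_measure \<alpha> \<nu>) (\<lambda>y. f (sup x y) - f x)"

lemma radial_has_field_derivative:
  fixes x :: "real^'n"
  assumes "0 \<le> x" and f: "(f has_derivative (\<lambda>v. G \<bullet> v)) (at x within {0..})"
  shows "((\<lambda>s::real. f (s *\<^sub>R x)) has_field_derivative (x \<bullet> G)) (at 1)"
proof -
  have "(\<lambda>s::real. s *\<^sub>R x) ` {0<..} \<subseteq> {0..}"
    using \<open>0 \<le> x\<close> by (auto simp: less_eq_vec_def)
  then have "(f has_derivative (\<lambda>v. G \<bullet> v)) (at (1 *\<^sub>R x) within (\<lambda>s::real. s *\<^sub>R x) ` {0<..})"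
    using has_derivative_subset[OF f] by (simp only: scaleR_one)
  moreover have "((\<lambda>s::real. s *\<^sub>R x) has_derivative (\<lambda>s. s *\<^sub>R x)) (at 1 within {0<..})"
    by (rule has_derivative_scaleR_left) (rule has_derivative_ident)
  ultimately have "(f \<circ> (\<lambda>s::real. s *\<^sub>R x) has_derivative (\<lambda>v. G \<bullet> v) \<circ> (\<lambda>s. s *\<^sub>R x))
      (at 1 within {0<..})"
    by (intro diff_chain_within)
  moreover have "at (1::real) within {0<..} = at 1"
    by (rule at_within_open) auto
  moreover have "(\<lambda>v. G \<bullet> v) \<circ> (\<lambda>s::real. s *\<^sub>R x) = (*) (x \<bullet> G)"
    by (auto simp: fun_eq_iff inner_commute)
  ultimately show ?thesis
    by (simp add: has_field_derivative_def o_def)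
qed

lemma radial_deriv_eq:
  fixes x :: "real^'n"
  assumes "0 \<le> x" and "(f has_derivative (\<lambda>v. G \<bullet> v)) (at x within {0..})"
  shows "radial_deriv f x = x \<bullet> G"
  unfolding radial_deriv_def using radial_has_field_derivative[OF assms] by (rule DERIV_imp_deriv)

end

(* Write x_s = exp (-s/\<alpha>) x for the flow of the drift and A f (x) = \<integral> (f (x \<or> y) - f x) d\<mu>(y). On boxes
   {..z} the max-stable cdf gives
     P_u h (x) - P_{u-t} h (x_t) = \<integral>_0^t A (P_{u-s} h) (x_s) ds,
   which extends to Lipschitz h by a pi-lambda argument, truncation and the integrable majorant
   \<Sum>_j exp (-v/\<alpha>) y_j exp (-(exp v - 1) y_j^-\<alpha>) of |P_v h (x \<or> y) - P_v h (x)|. Integrated over u this is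
     g (x_t) - g (x) = \<integral>_0^t (h (x_s) - E h(Z) - A g (x_s)) ds,
   whose derivative in t is the Stein equation. Differentiability of g is dominated convergence: ties
   exp (-t/\<alpha>) x_j = (1 - exp (-t))^(1/\<alpha>) Z_j are negligible in (\<omega>, t). For a box, g depends on x only
   through the time T(x) at which the flow enters it, with dg/dT = exp (-(1 - exp (-T)) \<mu>([0,z]^c)),
   and \<mu>(T > t) = exp (-t) \<mu>([0,z]^c). *)

theory Submission
  imports Defs
begin

text \<open>The identity is kept in integrated form because neither P_v h nor g is known beforehand
  to be differentiable; at the end only continuity of s -> A g (x_s) is required, and a bound
  uniform in the starting point supplies it. The obstacle is that \<mu> has infinite mass near 0:
  even for bounded h the jump integral converges only because a small y seldom overtakes the
  rescaled Z. This is also the origin of the majorant. After time v a jump moves coordinate j by at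
  most exp (-v/\<alpha>) y_j, and moves it only if (1 - exp (-v))^(1/\<alpha>) Z_j <= exp
  (-v/\<alpha>) y_j, an event of probability at most exp (-(exp v - 1) y_j^-\<alpha>). Its total
  over v is at most y_j min(\<alpha>, y_j^\<alpha>), which is \<mu>-integrable for \<alpha> > 1. For
  boxes the identity is a balance of rates: as s grows, the Z-part still to come shrinks and the
  probability of ending in the box rises, at exactly the rate at which jumps throw the path out of
  it.\<close>

lemmas lintegral_diff = Bochner_Integration.integral_diff
lemmas lintegrable_diff = Bochner_Integration.integrable_diff
lemmas lintegrable_bound = Bochner_Integration.integrable_bound
lemmas lintegral_cong = Bochner_Integration.integral_cong
lemmas lintegrable_sum = Bochner_Integration.integrable_sum

section \<open>Coordinate-wise maximum and Borel measurability of vectors\<close>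

lemma measurable_vec_sup [measurable (raw)]:
  fixes f g :: "'a \<Rightarrow> real^'n"
  assumes [measurable]: "f \<in> borel_measurable M" "g \<in> borel_measurable M"
  shows "(\<lambda>x. sup (f x) (g x)) \<in> borel_measurable M"
proof -
  have "continuous_on UNIV (\<lambda>p::(real^'n) \<times> (real^'n). sup (fst p) (snd p))"
    unfolding continuous_on_def
    using tendsto_sup[OF tendsto_fst[OF tendsto_ident_at] tendsto_snd[OF tendsto_ident_at]] by blast
  from borel_measurable_continuous_onI[OF this]
  have [measurable]: "(\<lambda>p::(real^'n) \<times> (real^'n). sup (fst p) (snd p)) \<in> borel_measurable borel" .
  have "(\<lambda>x. (f x, g x)) \<in> borel_measurable M"
    by (simp add: borel_prod[symmetric])
  from measurable_compose[OF this, of "\<lambda>p. sup (fst p) (snd p)" borel] show ?thesis by simp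
qed

lemma eventually_pos_nhds_1: "\<forall>\<^sub>F s in nhds 1. 0 < (s::real)"
  using eventually_nhds_in_open[of "{0<..}" "1::real"] by auto

lemma vec_le_real: "\<exists>m. \<forall>i. (x :: real^'n) $ i \<le> real m"
proof -
  obtain m where m: "Max (range (($) x)) \<le> real m" using real_arch_simple by blast
  have "x $ i \<le> real m" for i by (rule order_trans[OF Max_ge m]) auto
  then show ?thesis by blast
qed

lemma sup_vec_nth [simp]: "sup x y $ j = max (x $ j) (y $ j)" for x y :: "real^'n"
  by (simp add: sup_vec_def sup_max)

lemma scaleR_sup_vec: "0 \<le> c \<Longrightarrow> c *\<^sub>R sup x y = sup (c *\<^sub>R x) (c *\<^sub>R y)" for x y :: "real^'n"
  by (simp add: vec_eq_iff max_mult_distrib_left)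

lemma borel_measurable_vec_nth [measurable (raw)]:
  fixes f :: "'a \<Rightarrow> real^'n"
  assumes "f \<in> borel_measurable M"
  shows "(\<lambda>x. f x $ j) \<in> borel_measurable M"
proof -
  have "(\<lambda>v::real^'n. v $ j) \<in> borel_measurable borel"
    by (intro borel_measurable_continuous_onI continuous_intros)
  from measurable_compose[OF assms this] show ?thesis .
qed

lemma borel_measurable_vec_lambda [measurable (raw)]:
  fixes f :: "'n::finite \<Rightarrow> 'a \<Rightarrow> real"
  assumes "\<And>j. f j \<in> borel_measurable M"
  shows "(\<lambda>x. \<chi> j. f j x) \<in> borel_measurable M"
  unfolding borel_measurable_euclidean_space[of "\<lambda>x. \<chi> j. f j x"]
  using assms by (auto simp: Basis_vec_def inner_axis)

lemma borel_measurable_vec_le [measurable (raw)]: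
  fixes f g :: "'a \<Rightarrow> real^'n"
  assumes [measurable]: "f \<in> borel_measurable M" "g \<in> borel_measurable M"
  shows "Measurable.pred M (\<lambda>x. f x \<le> g x)"
proof -
  show ?thesis unfolding less_eq_vec_def by measurable
qed

section \<open>The exponent measure\<close>

text \<open>The radial factor of \<open>exponent_measure\<close>, written exactly as it occurs there
  so that it can be folded.\<close>

definition ray_measure :: "real \<Rightarrow> real measure" where
  "ray_measure \<alpha> = density (restrict_space lborel {0<..}) (\<lambda>r. ennreal (\<alpha> * r powr (- \<alpha> - 1)))"

lemma sigma_finite_ray_measure: "sigma_finite_measure (ray_measure \<alpha>)"
proof -
  have "sigma_finite_measure (restrict_space lborel {0::real<..})"
    by (rule sigma_finite_measure_restrict_space) (auto intro: sigma_finite_lborel)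
  then show ?thesis unfolding ray_measure_def
    by (subst sigma_finite_measure.sigma_finite_iff_density_finite)
       (auto intro!: measurable_restrict_space1)
qed

lemma sets_ray_measure [measurable_cong]: "sets (ray_measure \<alpha>) = sets (restrict_space borel {0<..})"
  by (simp add: ray_measure_def sets_restrict_space)

lemma space_ray_measure: "space (ray_measure \<alpha>) = {0<..}"
  by (simp add: ray_measure_def space_restrict_space)

lemma nn_integral_ray_measure:
  assumes [measurable]: "f \<in> borel_measurable borel"
  shows "(\<integral>\<^sup>+r. f r \<partial>ray_measure \<alpha>) =
    (\<integral>\<^sup>+r. ennreal (\<alpha> * r powr (- \<alpha> - 1)) * f r * indicator {0<..} r \<partial>lborel)"
  unfolding ray_measure_def
  by (subst nn_integral_density)
     (auto intro!: measurable_restrict_space1 simp: nn_integral_restrict_space)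

text \<open>Homogeneity: the substitution r -> c r produces c from Lebesgue measure and
  c^(-\<alpha>-1) from the density, and c^\<alpha> cancels both.\<close>

lemma nn_integral_ray_measure_scale:
  assumes [measurable]: "f \<in> borel_measurable borel" and c: "c > 0" and \<alpha>: "\<alpha> > 0"
  shows "(\<integral>\<^sup>+r. f (r * c) \<partial>ray_measure \<alpha>) = ennreal (c powr \<alpha>) * (\<integral>\<^sup>+r. f r \<partial>ray_measure \<alpha>)"
proof -
  have eq: "ennreal (c powr \<alpha>) * (ennreal c * (ennreal (\<alpha> * (c * r) powr (- \<alpha> - 1)) * f (c * r) * indicator {0<..} (c * r)))
       = ennreal (\<alpha> * r powr (- \<alpha> - 1)) * f (r * c) * indicator {0<..} r" for r
  proof (cases "r > 0")
    case True
    have 1: "(c powr \<alpha>) * (c * (\<alpha> * (c * r) powr (- \<alpha> - 1))) = (c powr \<alpha> * (c powr 1 * c powr (- \<alpha> - 1))) * (\<alpha> * r powr (- \<alpha> - 1))"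
      by (simp only: powr_mult[of c r] powr_one[OF less_imp_le[OF c]] mult.assoc mult.left_commute mult.commute)
    have "c powr \<alpha> * (c powr 1 * c powr (- \<alpha> - 1)) = 1"
      unfolding powr_add[symmetric] using c by simp
    then have "(c powr \<alpha>) * (c * (\<alpha> * (c * r) powr (- \<alpha> - 1))) = \<alpha> * r powr (- \<alpha> - 1)"
      by (simp only: 1 mult_1)
    moreover have "ennreal (c powr \<alpha>) * (ennreal c * ennreal (\<alpha> * (c * r) powr (- \<alpha> - 1)))
        = ennreal ((c powr \<alpha>) * (c * (\<alpha> * (c * r) powr (- \<alpha> - 1))))"
      using c \<alpha> by (simp add: ennreal_mult)
    ultimately have key: "ennreal (c powr \<alpha>) * (ennreal c * ennreal (\<alpha> * (c * r) powr (- \<alpha> - 1)))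
        = ennreal (\<alpha> * r powr (- \<alpha> - 1))" by metis
    show ?thesis unfolding key[symmetric] using True c by (simp add: mult_ac)
  next
    case False
    then show ?thesis using c by (auto simp: indicator_def zero_less_mult_iff)
  qed
  have "ennreal (c powr \<alpha>) * (\<integral>\<^sup>+r. f r \<partial>ray_measure \<alpha>) = ennreal (c powr \<alpha>) * (ennreal \<bar>c\<bar> *
      (\<integral>\<^sup>+r. ennreal (\<alpha> * (0 + c * r) powr (- \<alpha> - 1)) * f (0 + c * r) * indicator {0<..} (0 + c * r) \<partial>lborel))"
    unfolding nn_integral_ray_measure[OF assms(1)]
    by (subst nn_integral_real_affine[where c=c and t=0]) (use c in auto)
  also have "\<dots> = (\<integral>\<^sup>+r. f (r * c) \<partial>ray_measure \<alpha>)"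
    using c eq by (subst nn_integral_ray_measure) (auto simp: nn_integral_cmult[symmetric])
  finally show ?thesis ..
qed

lemma nn_integral_ray_measure_tail:
  assumes a: "a > 0" and \<alpha>: "\<alpha> > 0"
  shows "(\<integral>\<^sup>+r. indicator {a<..} r \<partial>ray_measure \<alpha>) = ennreal (a powr (- \<alpha>))"
proof -
  have "(\<integral>\<^sup>+r. indicator {a<..} r \<partial>ray_measure \<alpha>) =
      (\<integral>\<^sup>+r. ennreal (\<alpha> * r powr (- \<alpha> - 1)) * indicator {a<..} r \<partial>lborel)"
    by (subst nn_integral_ray_measure) (use a in \<open>auto intro!: nn_integral_cong simp: indicator_def\<close>)
  \<comment> \<open>\<open>nn_integral_FTC_atLeast\<close> works on closed half-lines, so the null
    point a is added.\<close>
  also have "\<dots> = (\<integral>\<^sup>+r. ennreal (\<alpha> * r powr (- \<alpha> - 1)) * indicator {a..} r \<partial>lborel)"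
    by (rule nn_integral_cong_AE, rule AE_mp[OF AE_lborel_singleton[of a]]) (auto simp: indicator_def)
  also have "\<dots> = ennreal (0 - (- (a powr (- \<alpha>))))"
  proof (rule nn_integral_FTC_atLeast)
    show "DERIV (\<lambda>r. - (r powr (- \<alpha>))) x :> \<alpha> * x powr (- \<alpha> - 1)" if "a \<le> x" for x
      using that a by (auto intro!: derivative_eq_intros)
    show "((\<lambda>r. - (r powr (- \<alpha>))) \<longlongrightarrow> 0) at_top"
      using tendsto_minus[OF tendsto_neg_powr[of "- \<alpha>", OF _ filterlim_ident]] \<alpha> by simp
  qed (use \<alpha> in auto)
  finally show ?thesis by simp
qed

locale max_stable_law =
  fixes N :: "real^'n \<Rightarrow> real" and \<nu> :: "(real^'n) measure" and \<alpha> :: real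
    and M :: "'a measure" and Z :: "'a \<Rightarrow> real^'n"
  assumes N: "is_norm N" and \<alpha>: "\<alpha> > 0"
    and ang: "angular_measure N \<nu>" and ms: "max_stable M Z \<alpha> \<nu>"
begin

abbreviation \<mu> :: "(real^'n) measure" where "\<mu> \<equiv> exponent_measure \<alpha> \<nu>"

sublocale prob_space M using ms by (simp add: max_stable_def)

lemma finite_\<nu>: "finite_measure \<nu>" using ang by (simp add: angular_measure_def)

lemma sets_\<nu> [measurable_cong]: "sets \<nu> = sets (restrict_space borel (pos_sphere N))"
  using ang by (simp add: angular_measure_def)

lemma space_\<nu>: "space \<nu> = pos_sphere N"
  using sets_eq_imp_space_eq[OF sets_\<nu>] by (simp add: space_restrict_space)

lemma sets_\<mu> [measurable_cong]: "sets \<mu> = sets (restrict_space borel punctured_orthant)"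
  by (simp add: exponent_measure_def)

lemma space_\<mu>: "space \<mu> = punctured_orthant"
  using sets_eq_imp_space_eq[OF sets_\<mu>] by (simp add: space_restrict_space)

lemma measurable_\<mu>: "f \<in> borel_measurable borel \<Longrightarrow> f \<in> borel_measurable \<mu>"
  by (simp add: measurable_restrict_space1 cong: measurable_cong_sets[OF sets_\<mu> refl])

lemma measurable_\<nu>: "f \<in> borel_measurable borel \<Longrightarrow> f \<in> borel_measurable \<nu>"
  by (simp add: measurable_restrict_space1 cong: measurable_cong_sets[OF sets_\<nu> refl])

abbreviation polar :: "real \<times> (real^'n) \<Rightarrow> real^'n" where
  "polar \<equiv> \<lambda>(r, u). r *\<^sub>R (\<chi> j. (u $ j) powr (1 / \<alpha>))"

text \<open>What needs an argument is that the image avoids 0: N u = 1 forces a nonzero coordinate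
  of u, and neither the power 1/\<alpha> nor the factor r > 0 makes it vanish.\<close>

lemma polar_map_measurable:
  "polar
     \<in> measurable (ray_measure \<alpha> \<Otimes>\<^sub>M \<nu>) (restrict_space borel punctured_orthant)"
proof (rule measurable_restrict_space2)
  have snd: "snd \<in> borel_measurable (ray_measure \<alpha> \<Otimes>\<^sub>M \<nu>)"
    by (rule measurable_compose[OF measurable_snd]) (auto intro: measurable_\<nu>)
  have fst: "fst \<in> borel_measurable (ray_measure \<alpha> \<Otimes>\<^sub>M \<nu>)"
    by (rule measurable_compose[OF measurable_fst])
      (simp add: measurable_restrict_space1 cong: measurable_cong_sets[OF sets_ray_measure refl])
  show "polar \<in> borel_measurable (ray_measure \<alpha> \<Otimes>\<^sub>M \<nu>)"
    unfolding case_prod_unfold using fst snd by measurable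
  have "polar (r, u) \<in> punctured_orthant" if "r > 0" "u \<in> pos_sphere N" for r and u :: "real^'n"
  proof -
    from that(2) have "0 \<le> u" "N u = 1" by (auto simp: pos_sphere_def)
    moreover have "N 0 = 0" using N unfolding is_norm_def by blast
    ultimately have "u \<noteq> 0" by auto
    then obtain j where "u $ j \<noteq> 0" by (auto simp: vec_eq_iff)
    then have "(polar (r, u)) $ j \<noteq> 0" using that by simp
    then have "polar (r, u) \<noteq> 0" by (metis zero_index)
    then show ?thesis using that by (auto simp: punctured_orthant_def less_eq_vec_def)
  qed
  then show "polar
      \<in> space (ray_measure \<alpha> \<Otimes>\<^sub>M \<nu>) \<rightarrow> punctured_orthant"
    by (auto simp: space_pair_measure space_ray_measure space_\<nu>)
qed

lemma nn_integral_\<mu>: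
  assumes [measurable]: "f \<in> borel_measurable borel"
  shows "(\<integral>\<^sup>+y. f y \<partial>\<mu>) =
    (\<integral>\<^sup>+u. (\<integral>\<^sup>+r. f (polar (r, u)) \<partial>ray_measure \<alpha>) \<partial>\<nu>)"
proof -
  interpret R: sigma_finite_measure "ray_measure \<alpha>" by (rule sigma_finite_ray_measure)
  interpret \<nu>: finite_measure \<nu> by (rule finite_\<nu>)
  interpret P: pair_sigma_finite "ray_measure \<alpha>" \<nu> ..
  have "(\<integral>\<^sup>+y. f y \<partial>\<mu>) = (\<integral>\<^sup>+p. f (polar p) \<partial>(ray_measure \<alpha> \<Otimes>\<^sub>M \<nu>))"
    unfolding exponent_measure_def ray_measure_def[symmetric]
    by (rule nn_integral_distr[OF polar_map_measurable]) (simp add: measurable_restrict_space1)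
  also have "\<dots> = (\<integral>\<^sup>+u. (\<integral>\<^sup>+r. f (polar (r, u)) \<partial>ray_measure \<alpha>) \<partial>\<nu>)"
    by (subst P.nn_integral_snd[symmetric])
       (auto intro!: measurable_compose[OF polar_map_measurable] measurable_restrict_space1)
  finally show ?thesis .
qed

text \<open>For fixed u the coordinate y_j is r u_j^(1/\<alpha>), so homogeneity yields the factor
  u_j, which the moment condition integrates to 1. Hence all marginals of \<mu> away from 0 coincide
  with the radial measure. The condition \<open>f 0 = 0\<close> handles the points with u_j = 0,
  whose whole ray is sent to 0 in this coordinate.\<close>

lemma nn_integral_\<mu>_marginal:
  assumes [measurable]: "f \<in> borel_measurable borel" and "f 0 = 0"
  shows "(\<integral>\<^sup>+y. f (y $ j) \<partial>\<mu>) = (\<integral>\<^sup>+r. f r \<partial>ray_measure \<alpha>)"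
proof -
  \<comment> \<open>A non-integrable function has Bochner integral 0, so the value 1 already yields
    integrability.\<close>
  have int: "integrable \<nu> (\<lambda>u. u $ j)" and int1: "(\<integral>u. u $ j \<partial>\<nu>) = 1"
    using ang not_integrable_integral_eq[of \<nu> "\<lambda>u. u $ j"] by (auto simp: angular_measure_def)
  have nn: "0 \<le> u $ j" if "u \<in> space \<nu>" for u
    using that by (auto simp: space_\<nu> pos_sphere_def less_eq_vec_def)
  have "(\<integral>\<^sup>+r. f (r * u $ j powr (1 / \<alpha>)) \<partial>ray_measure \<alpha>) = ennreal (u $ j) * (\<integral>\<^sup>+r. f r \<partial>ray_measure \<alpha>)"
    if "u \<in> space \<nu>" for u
  proof (cases "u $ j = 0")
    case False
    then have "u $ j > 0" using nn[OF that] by simp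
    then show ?thesis
      using \<alpha> by (subst nn_integral_ray_measure_scale) (auto simp: powr_powr)
  qed (simp add: assms)
  then have "(\<integral>\<^sup>+y. f (y $ j) \<partial>\<mu>) = (\<integral>\<^sup>+u. ennreal (u $ j) * (\<integral>\<^sup>+r. f r \<partial>ray_measure \<alpha>) \<partial>\<nu>)"
    by (subst nn_integral_\<mu>) (auto intro!: nn_integral_cong)
  also have "\<dots> = (\<integral>\<^sup>+u. ennreal (u $ j) \<partial>\<nu>) * (\<integral>\<^sup>+r. f r \<partial>ray_measure \<alpha>)"
    by (rule nn_integral_multc) (auto intro!: measurable_compose[OF _ measurable_ennreal] measurable_\<nu>)
  also have "(\<integral>\<^sup>+u. ennreal (u $ j) \<partial>\<nu>) = 1"
    using int int1 nn by (subst nn_integral_eq_integral) auto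
  finally show ?thesis by simp
qed

lemma nn_integral_\<mu>_scale:
  assumes [measurable]: "f \<in> borel_measurable borel" and c: "c > 0"
  shows "(\<integral>\<^sup>+y. f (c *\<^sub>R y) \<partial>\<mu>) = ennreal (c powr \<alpha>) * (\<integral>\<^sup>+y. f y \<partial>\<mu>)"
proof -
  interpret R: sigma_finite_measure "ray_measure \<alpha>" by (rule sigma_finite_ray_measure)
  have *: "(\<lambda>u. \<integral>\<^sup>+r. f (polar (r, u)) \<partial>ray_measure \<alpha>) \<in> borel_measurable \<nu>"
  proof (rule R.borel_measurable_nn_integral)
    have "(\<lambda>p. f (polar p)) \<in> borel_measurable (ray_measure \<alpha> \<Otimes>\<^sub>M \<nu>)"
      by (auto intro!: measurable_compose[OF polar_map_measurable] measurable_restrict_space1)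
    from measurable_compose[OF measurable_pair_swap' this]
    show "(\<lambda>(u, r). f (polar (r, u))) \<in> borel_measurable (\<nu> \<Otimes>\<^sub>M ray_measure \<alpha>)"
      by (simp add: case_prod_unfold)
  qed
  have "(\<integral>\<^sup>+y. f (c *\<^sub>R y) \<partial>\<mu>) = (\<integral>\<^sup>+u. (\<integral>\<^sup>+r. f ((r * c) *\<^sub>R (\<chi> j. (u $ j) powr (1 / \<alpha>))) \<partial>ray_measure \<alpha>) \<partial>\<nu>)"
    by (subst nn_integral_\<mu>) (auto simp: mult.commute)
  also have "\<dots> = (\<integral>\<^sup>+u. ennreal (c powr \<alpha>) * (\<integral>\<^sup>+r. f (polar (r, u)) \<partial>ray_measure \<alpha>) \<partial>\<nu>)"
    using c \<alpha> by (intro nn_integral_cong, subst nn_integral_ray_measure_scale) auto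
  also have "\<dots> = ennreal (c powr \<alpha>) * (\<integral>\<^sup>+y. f y \<partial>\<mu>)"
    by (subst nn_integral_cmult[OF *]) (simp add: nn_integral_\<mu>)
  finally show ?thesis .
qed

section \<open>The mass of \<mu> outside a box\<close>

definition \<Lambda> :: "real^'n \<Rightarrow> real" where
  "\<Lambda> z = measure \<mu> (punctured_orthant - {0..z})"

lemma emeasure_\<mu>_not_le:
  "(\<integral>\<^sup>+y. indicator {y. \<not> y \<le> z} y \<partial>\<mu>) = emeasure \<mu> (punctured_orthant - {0..z})"
proof -
  have A: "punctured_orthant - {0..z} = punctured_orthant \<inter> {y. \<not> y \<le> z}"
    by (auto simp: punctured_orthant_def)
  have "{y::real^'n. \<not> y \<le> z} \<in> sets borel" by measurable
  then have "punctured_orthant - {0..z} \<in> sets \<mu>" unfolding A by (auto simp: sets_\<mu> sets_restrict_space)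
  then have "emeasure \<mu> (punctured_orthant - {0..z}) = (\<integral>\<^sup>+y. indicator (punctured_orthant - {0..z}) y \<partial>\<mu>)" by simp
  also have "\<dots> = (\<integral>\<^sup>+y. indicator {y. \<not> y \<le> z} y \<partial>\<mu>)"
    unfolding A by (rule nn_integral_cong) (auto simp: space_\<mu> indicator_def)
  finally show ?thesis ..
qed

text \<open>A point outside the box exceeds some side: a union bound with the marginal tails
  z_j^-\<alpha>.\<close>

lemma nn_integral_\<mu>_not_le_bound:
  assumes z: "z \<in> pos_orthant"
  shows "(\<integral>\<^sup>+y. indicator {y. \<not> y \<le> z} y \<partial>\<mu>) \<le> (\<Sum>j\<in>UNIV. ennreal ((z $ j) powr (- \<alpha>)))"
proof -
  have "(\<integral>\<^sup>+y. indicator {y. \<not> y \<le> z} y \<partial>\<mu>) \<le> (\<integral>\<^sup>+y. (\<Sum>j\<in>UNIV. indicator {z $ j<..} (y $ j)) \<partial>\<mu>)"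
  proof (rule nn_integral_mono)
    fix y :: "real^'n"
    show "indicator {y. \<not> y \<le> z} y \<le> (\<Sum>j\<in>UNIV. indicator {z $ j<..} (y $ j) :: ennreal)"
    proof (cases "y \<le> z")
      case False
      then obtain j where "\<not> y $ j \<le> z $ j" by (auto simp: less_eq_vec_def)
      then have "indicator {y. \<not> y \<le> z} y \<le> (indicator {z $ j<..} (y $ j) :: ennreal)"
        by (auto simp: indicator_def)
      also have "\<dots> \<le> (\<Sum>j\<in>UNIV. indicator {z $ j<..} (y $ j))"
        by (rule member_le_sum) auto
      finally show ?thesis .
    qed auto
  qed
  also have "\<dots> = (\<Sum>j\<in>UNIV. (\<integral>\<^sup>+y. indicator {z $ j<..} (y $ j) \<partial>\<mu>))"
    by (rule nn_integral_sum) (auto intro!: measurable_\<mu>)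
  also have "\<dots> = (\<Sum>j\<in>UNIV. ennreal ((z $ j) powr (- \<alpha>)))"
  proof (rule sum.cong)
    fix j
    have "z $ j > 0" using z by (auto simp: pos_orthant_def)
    then show "(\<integral>\<^sup>+y. indicator {z $ j<..} (y $ j) \<partial>\<mu>) = ennreal ((z $ j) powr (- \<alpha>))"
      using \<alpha> by (subst nn_integral_\<mu>_marginal) (auto simp: nn_integral_ray_measure_tail)
  qed simp
  finally show ?thesis .
qed

text \<open>\<open>measure\<close> returns 0 on sets of infinite mass, so the real number \<Lambda>
  z represents the mass only thanks to the finiteness given by the union bound.\<close>

lemma nn_integral_\<mu>_not_le_eq:
  assumes z: "z \<in> pos_orthant"
  shows "(\<integral>\<^sup>+y. indicator {y. \<not> y \<le> z} y \<partial>\<mu>) = ennreal (\<Lambda> z)"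
proof -
  have "(\<Sum>j\<in>UNIV. ennreal ((z $ j) powr (- \<alpha>))) < \<infinity>" by simp
  with nn_integral_\<mu>_not_le_bound[OF z] have "(\<integral>\<^sup>+y. indicator {y. \<not> y \<le> z} y \<partial>\<mu>) < \<infinity>"
    by (rule le_less_trans)
  then show ?thesis
    unfolding \<Lambda>_def emeasure_\<mu>_not_le by (subst emeasure_eq_ennreal_measure) auto
qed

lemma \<Lambda>_nonneg: "\<Lambda> z \<ge> 0" by (simp add: \<Lambda>_def)

lemma \<Lambda>_le: "z \<in> pos_orthant \<Longrightarrow> \<Lambda> z \<le> (\<Sum>j\<in>UNIV. (z $ j) powr (- \<alpha>))"
  using nn_integral_\<mu>_not_le_bound[of z] nn_integral_\<mu>_not_le_eq[of z]
  by (simp add: sum_nonneg)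

text \<open>Exceeding side j alone already has mass z_j^-\<alpha>. This bound later controls the
  lower tail of a single coordinate of \<open>Z\<close>.\<close>

lemma \<Lambda>_ge:
  assumes z: "z \<in> pos_orthant"
  shows "(z $ j) powr (- \<alpha>) \<le> \<Lambda> z"
proof -
  have "z $ j > 0" using z by (auto simp: pos_orthant_def)
  then have "ennreal ((z $ j) powr (- \<alpha>)) = (\<integral>\<^sup>+y. indicator {z $ j<..} (y $ j) \<partial>\<mu>)"
    using \<alpha> by (subst nn_integral_\<mu>_marginal) (auto simp: nn_integral_ray_measure_tail)
  also have "\<dots> \<le> (\<integral>\<^sup>+y. indicator {y. \<not> y \<le> z} y \<partial>\<mu>)"
    by (rule nn_integral_mono) (auto simp: indicator_def less_eq_vec_def not_le)
  also have "\<dots> = ennreal (\<Lambda> z)" by (rule nn_integral_\<mu>_not_le_eq[OF z])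
  finally show ?thesis by (simp add: \<Lambda>_nonneg)
qed

lemma nn_integral_\<mu>_scale_not_le:
  assumes z: "z \<in> pos_orthant" and c: "c > 0"
  shows "(\<integral>\<^sup>+y. indicator {y. \<not> c *\<^sub>R y \<le> z} y \<partial>\<mu>) = ennreal (c powr \<alpha> * \<Lambda> z)"
proof -
  have "(\<integral>\<^sup>+y. indicator {y. \<not> c *\<^sub>R y \<le> z} y \<partial>\<mu>) = (\<integral>\<^sup>+y. indicator {y. \<not> y \<le> z} (c *\<^sub>R y) \<partial>\<mu>)"
    by (auto intro!: nn_integral_cong simp: indicator_def)
  also have "\<dots> = ennreal (c powr \<alpha>) * ennreal (\<Lambda> z)"
    unfolding nn_integral_\<mu>_not_le_eq[OF z, symmetric]
    using c by (intro nn_integral_\<mu>_scale) measurable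
  finally show ?thesis by (simp add: ennreal_mult \<Lambda>_nonneg)
qed

lemma \<Lambda>_scale:
  assumes z: "z \<in> pos_orthant" and c: "c > 0"
  shows "\<Lambda> (c *\<^sub>R z) = c powr (- \<alpha>) * \<Lambda> z"
proof -
  have cz: "c *\<^sub>R z \<in> pos_orthant" using z c by (auto simp: pos_orthant_def)
  have "ennreal (\<Lambda> (c *\<^sub>R z)) = (\<integral>\<^sup>+y. indicator {y. \<not> (1 / c) *\<^sub>R y \<le> z} y \<partial>\<mu>)"
    unfolding nn_integral_\<mu>_not_le_eq[OF cz, symmetric]
    using c by (auto intro!: nn_integral_cong simp: indicator_def less_eq_vec_def field_simps)
  also have "\<dots> = ennreal ((1 / c) powr \<alpha> * \<Lambda> z)"
    using c by (intro nn_integral_\<mu>_scale_not_le z) auto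
  finally show ?thesis using c by (simp add: \<Lambda>_nonneg powr_minus powr_divide field_simps)
qed

lemma sigma_finite_\<mu>: "sigma_finite_measure \<mu>"
proof
  \<comment> \<open>Cubes shrinking to the origin: every point of \<open>punctured_orthant\<close>
    is outside one of them, and each complement has finite mass.\<close>
  define z :: "nat \<Rightarrow> real^'n" where "z n = (\<chi> j. 1 / real (Suc n))" for n
  have z: "z n \<in> pos_orthant" for n by (auto simp: pos_orthant_def z_def)
  show "\<exists>A. countable A \<and> A \<subseteq> sets \<mu> \<and> \<Union>A = space \<mu> \<and> (\<forall>a\<in>A. emeasure \<mu> a \<noteq> \<infinity>)"
  proof (intro exI conjI)
    show "countable (range (\<lambda>n. punctured_orthant - {0..z n}))" by simp
    show "range (\<lambda>n. punctured_orthant - {0..z n}) \<subseteq> sets \<mu>"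
      by (auto simp: sets_\<mu> sets_restrict_space intro!: image_eqI[of _ _ "- {0..z _}"])
    have "\<exists>n. \<not> y \<le> z n" if "y \<in> punctured_orthant" for y
    proof -
      from that have "0 \<le> y" "y \<noteq> 0" by (auto simp: punctured_orthant_def)
      then obtain j where "y $ j \<noteq> 0" "0 \<le> y $ j" by (auto simp: vec_eq_iff less_eq_vec_def)
      then have "0 < y $ j" by simp
      from reals_Archimedean[OF this] obtain n where "inverse (real (Suc n)) < y $ j" by auto
      then have "\<not> y \<le> z n" by (auto simp: less_eq_vec_def z_def field_simps not_le intro!: exI[of _ j])
      then show ?thesis ..
    qed
    then show "\<Union> (range (\<lambda>n. punctured_orthant - {0..z n})) = space \<mu>"
      by (fastforce simp: space_\<mu>)
    show "\<forall>a\<in>range (\<lambda>n. punctured_orthant - {0..z n}). emeasure \<mu> a \<noteq> \<infinity>"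
      using nn_integral_\<mu>_not_le_eq[OF z] unfolding emeasure_\<mu>_not_le by auto
  qed
qed

sublocale S: sigma_finite_measure \<mu> by (rule sigma_finite_\<mu>)

sublocale SY: pair_sigma_finite lborel \<mu> ..

end

section \<open>The max-stable law and the majorant\<close>

lemma nn_integral_exp_decay:
  assumes "k > 0"
  shows "(\<integral>\<^sup>+v. ennreal (exp (- k * v)) * indicator {0..} v \<partial>lborel) = ennreal (1 / k)"
proof -
  have "(\<integral>\<^sup>+v. ennreal (exp (- k * v)) * indicator {0..} v \<partial>lborel) = ennreal (0 - (- exp (- k * 0) / k))"
  proof (rule nn_integral_FTC_atLeast)
    show "DERIV (\<lambda>v. - exp (- k * v) / k) x :> exp (- k * x)" for x
      using assms by (auto intro!: derivative_eq_intros)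
    have "LIM v at_top. k * v :> at_top"
      by (rule filterlim_tendsto_pos_mult_at_top[OF tendsto_const assms filterlim_ident])
    then have "((\<lambda>v. exp (- k * v)) \<longlongrightarrow> 0) at_top"
      by (intro filterlim_compose[OF exp_at_bot]) (simp add: filterlim_uminus_at_bot)
    from tendsto_divide[OF tendsto_minus[OF this] tendsto_const[of k]] assms
    show "((\<lambda>v. - exp (- k * v) / k) \<longlongrightarrow> 0) at_top" by simp
  qed auto
  then show ?thesis by simp
qed

text \<open>Up to the factor s, the integrand times the radial density is the derivative of exp (-s
  r^-\<alpha>), which grows from 0 at 0 to 1 at infinity. The lemma later gives finite mass to the
  set of jumps that have an effect.\<close>

lemma nn_integral_ray_measure_finite:
  assumes s: "s > 0" and \<alpha>: "\<alpha> > 0"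
  shows "(\<integral>\<^sup>+r. ennreal (exp (- s * r powr (- \<alpha>))) \<partial>ray_measure \<alpha>) < \<infinity>"
proof -
  let ?f = "\<lambda>r. exp (- s * r powr (- \<alpha>)) * (s * (\<alpha> * r powr (- \<alpha> - 1)))"
  have lim0: "((\<lambda>r. exp (- s * r powr (- \<alpha>))) \<longlongrightarrow> 0) (at_right 0)"
  proof (rule filterlim_compose[OF exp_at_bot])
    have "filterlim (\<lambda>r::real. r powr (- \<alpha>)) at_top (at_right 0)"
    proof -
      have "LIM x at_right 0. \<alpha> * - ln x :> at_top"
        by (rule filterlim_tendsto_pos_mult_at_top[OF tendsto_const \<alpha>])
          (use ln_at_0 in \<open>simp add: filterlim_uminus_at_bot\<close>)
      then have "LIM x at_right 0. - \<alpha> * ln x :> at_top" by simp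
      then have "LIM x at_right 0. exp (- \<alpha> * ln x) :> at_top"
        by (rule filterlim_compose[OF exp_at_top])
      moreover have "\<forall>\<^sub>F x in at_right 0. exp (- \<alpha> * ln x) = x powr (- \<alpha>)"
        by (auto simp: eventually_at_filter powr_def intro!: always_eventually)
      ultimately show ?thesis by (rule filterlim_cong[THEN iffD1, OF refl refl, rotated])
    qed
    then show "LIM x at_right 0. - s * x powr - \<alpha> :> at_bot"
      using filterlim_tendsto_pos_mult_at_top[OF tendsto_const s, of "\<lambda>x. x powr - \<alpha>"]
      by (simp add: filterlim_uminus_at_bot)
  qed
  have lim1: "((\<lambda>r. exp (- s * r powr (- \<alpha>))) \<longlongrightarrow> exp (- s * 0)) at_top"
    using \<alpha> by (intro tendsto_intros tendsto_neg_powr filterlim_ident) auto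
  have "set_integrable lborel (einterval (ereal 0) \<infinity>) ?f"
  proof (rule interval_integral_FTC_nonneg)
    show "DERIV (\<lambda>r. exp (- s * r powr (- \<alpha>))) x :> ?f x" if "ereal 0 < ereal x" for x
      using that by (auto intro!: derivative_eq_intros)
    show "isCont ?f x" if "ereal 0 < ereal x" for x
      using that by (auto intro!: continuous_intros)
    show "((((\<lambda>r. exp (- s * r powr (- \<alpha>))) \<circ> real_of_ereal)) \<longlongrightarrow> 0) (at_right (ereal 0))"
      using lim0 by (simp add: ereal_tendsto_simps)
    show "((((\<lambda>r. exp (- s * r powr (- \<alpha>))) \<circ> real_of_ereal)) \<longlongrightarrow> exp (- s * 0)) (at_left \<infinity>)"
      using lim1 by (simp add: ereal_tendsto_simps)
  qed (use s \<alpha> in auto)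
  then have "integrable lborel (\<lambda>r. indicator {0<..} r *\<^sub>R ?f r)"
    by (simp add: set_integrable_def einterval_eq)
  then have "(\<integral>\<^sup>+r. ennreal (norm (indicator {0<..} r *\<^sub>R ?f r)) \<partial>lborel) < \<infinity>"
    by (simp add: integrable_iff_bounded)
  then have fin: "(\<integral>\<^sup>+r. ennreal (indicator {0<..} r *\<^sub>R ?f r) \<partial>lborel) < \<infinity>"
    using s \<alpha> by (simp add: abs_mult)
  have "ennreal s * (\<integral>\<^sup>+r. ennreal (exp (- s * r powr (- \<alpha>))) \<partial>ray_measure \<alpha>)
     = (\<integral>\<^sup>+r. ennreal (indicator {0<..} r *\<^sub>R ?f r) \<partial>lborel)"
    using s \<alpha> by (subst nn_integral_ray_measure)
      (auto simp: nn_integral_cmult[symmetric] indicator_def ennreal_mult[symmetric] ac_simps intro!: nn_integral_cong)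
  with fin have "ennreal s * (\<integral>\<^sup>+r. ennreal (exp (- s * r powr (- \<alpha>))) \<partial>ray_measure \<alpha>) < \<infinity>" by simp
  then show ?thesis using s by (auto simp: ennreal_mult_less_top)
qed

section \<open>Lipschitz functions and the majorant in one coordinate\<close>

abbreviation dist1 :: "real^'n \<Rightarrow> real^'n \<Rightarrow> real" where
  "dist1 x y \<equiv> (\<Sum>j\<in>UNIV. \<bar>x $ j - y $ j\<bar>)"

text \<open>Lipschitz on the whole space, unlike \<open>lip1\<close>, which yields Borel
  measurability at once. Functions on the orthant are brought into this form at the end by
  composition with \<open>sup y 0\<close>.\<close>

definition lip_l1 :: "(real^'n \<Rightarrow> real) \<Rightarrow> bool" where
  "lip_l1 h \<longleftrightarrow> (\<forall>x y. \<bar>h x - h y\<bar> \<le> dist1 x y)"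

lemma lip_l1_continuous:
  fixes h :: "real^'n \<Rightarrow> real"
  assumes "lip_l1 h"
  shows "continuous_on UNIV h"
proof -
  have "isCont h x" for x
  proof -
    have "((\<lambda>y. \<Sum>j\<in>UNIV. \<bar>y $ j - x $ j\<bar>) \<longlongrightarrow> (\<Sum>j\<in>UNIV. \<bar>x $ j - x $ j\<bar>)) (at x)"
      by (intro tendsto_intros)
    then have "((\<lambda>y. h y - h x) \<longlongrightarrow> 0) (at x)"
      by (rule_tac Lim_null_comparison) (use assms in \<open>auto simp: lip_l1_def\<close>)
    then show ?thesis by (simp add: isCont_def LIM_zero_cancel)
  qed
  then show ?thesis by (simp add: continuous_at_imp_continuous_on)
qed

lemma lip_l1_measurable: "lip_l1 h \<Longrightarrow> h \<in> borel_measurable borel"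
  by (intro borel_measurable_continuous_onI lip_l1_continuous)

text \<open>The largest displacement of a coordinate by a jump of size r after time v, times a bound
  on the probability that \<open>Z\<close> does not mask it. At r = 0 the power is 0 by convention
  and the last factor is 1, but the factor r still gives the value 0 that the marginal formula asks
  for.\<close>

definition maj1 :: "real \<Rightarrow> real \<Rightarrow> real \<Rightarrow> real" where
  "maj1 \<alpha> v r = exp (- v / \<alpha>) * r * exp (- (exp v - 1) * r powr (- \<alpha>))"

lemma maj1_nonneg: "0 \<le> r \<Longrightarrow> 0 \<le> maj1 \<alpha> v r"
  by (simp add: maj1_def)

lemma maj1_measurable [measurable (raw)]:
  assumes [measurable]: "f \<in> borel_measurable N" "g \<in> borel_measurable N"
  shows "(\<lambda>x. maj1 \<alpha> (f x) (g x)) \<in> borel_measurable N"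
  unfolding maj1_def by measurable

text \<open>Two rates compete. Dropping the last factor leaves r exp (-v/\<alpha>), with total r
  \<alpha>; dropping exp (-v/\<alpha>) and using v \<le> exp v - 1 leaves the rate r^-\<alpha>, with
  total r r^\<alpha>. The first bound serves large r, the second small r.\<close>

lemma nn_integral_maj1_le:
  assumes \<alpha>: "\<alpha> > 0" and r: "r > 0"
  shows "(\<integral>\<^sup>+v. ennreal (maj1 \<alpha> v r) * indicator {0..} v \<partial>lborel) \<le> ennreal (r * min \<alpha> (r powr \<alpha>))"
proof -
  let ?I = "\<integral>\<^sup>+v. ennreal (maj1 \<alpha> v r) * indicator {0..} v \<partial>lborel"
  have I: "?I \<le> ennreal (r * (1 / k))" if k: "k > 0" and le: "\<And>v. 0 \<le> v \<Longrightarrow> maj1 \<alpha> v r \<le> r * exp (- k * v)" for k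
  proof -
    have "?I \<le> (\<integral>\<^sup>+v. ennreal r * (ennreal (exp (- k * v)) * indicator {0..} v) \<partial>lborel)"
      by (rule nn_integral_mono) (use le r in \<open>auto simp: indicator_def ennreal_mult[symmetric] intro!: ennreal_leI\<close>)
    also have "\<dots> = ennreal r * ennreal (1 / k)"
      unfolding nn_integral_exp_decay[OF k, symmetric] by (rule nn_integral_cmult) measurable
    also have "\<dots> = ennreal (r * (1 / k))" using r k by (subst ennreal_mult) auto
    finally show ?thesis .
  qed
  have "?I \<le> ennreal (r * (1 / (1 / \<alpha>)))"
  proof (rule I)
    fix v :: real assume v: "0 \<le> v"
    have "maj1 \<alpha> v r \<le> exp (- v / \<alpha>) * r * 1"
      unfolding maj1_def using v r by (intro mult_left_mono) (auto intro!: mult_nonpos_nonneg)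
    then show "maj1 \<alpha> v r \<le> r * exp (- (1 / \<alpha>) * v)" by (simp add: mult.commute)
  qed (use \<alpha> in simp)
  moreover have "?I \<le> ennreal (r * (1 / r powr (- \<alpha>)))"
  proof (rule I)
    fix v :: real assume v: "0 \<le> v"
    have "v \<le> exp v - 1" using exp_ge_add_one_self[of v] by linarith
    then have "r powr (- \<alpha>) * v \<le> r powr (- \<alpha>) * (exp v - 1)" by (intro mult_left_mono) auto
    then have "exp (- (exp v - 1) * r powr - \<alpha>) \<le> exp (- (r powr - \<alpha>) * v)" by (simp add: algebra_simps)
    then have "maj1 \<alpha> v r \<le> 1 * r * exp (- (r powr (- \<alpha>)) * v)"
      unfolding maj1_def using v r \<alpha> by (intro mult_mono) auto
    then show "maj1 \<alpha> v r \<le> r * exp (- (r powr (- \<alpha>)) * v)" by simp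
  qed (use r in simp)
  moreover have "1 / r powr (- \<alpha>) = r powr \<alpha>" using r by (simp add: powr_minus field_simps)
  ultimately show ?thesis by (auto simp: min_def)
qed

lemma nn_integral_powr_tail_finite:
  assumes \<alpha>: "\<alpha> > 1"
  shows "(\<integral>\<^sup>+r. ennreal (r powr (- \<alpha>)) * indicator {1..} r \<partial>lborel) < \<infinity>"
proof -
  have "(\<integral>\<^sup>+r. ennreal (r powr (- \<alpha>)) * indicator {1..} r \<partial>lborel)
      = ennreal (0 - (1 powr (1 - \<alpha>) / (1 - \<alpha>)))"
  proof (rule nn_integral_FTC_atLeast[where F="\<lambda>r. r powr (1 - \<alpha>) / (1 - \<alpha>)"])
    show "DERIV (\<lambda>r. r powr (1 - \<alpha>) / (1 - \<alpha>)) x :> x powr (- \<alpha>)" if "1 \<le> x" for x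
      using DERIV_cdivide[OF has_real_derivative_powr[of x "1 - \<alpha>"], of "1 - \<alpha>"] that \<alpha> by simp
    have "((\<lambda>r::real. r powr (1 - \<alpha>)) \<longlongrightarrow> 0) at_top"
      using \<alpha> by (intro tendsto_neg_powr filterlim_ident) auto
    from tendsto_divide[OF this tendsto_const[of "1 - \<alpha>"]] \<alpha>
    show "((\<lambda>r. r powr (1 - \<alpha>) / (1 - \<alpha>)) \<longlongrightarrow> 0) at_top" by simp
  qed auto
  then show ?thesis by simp
qed

text \<open>Multiplied by the radial density, r min(\<alpha>, r^\<alpha>) becomes \<alpha>
  min(\<alpha> r^-\<alpha>, 1): bounded by \<alpha> on (0,1], and with a tail beyond 1 that is
  integrable because \<alpha> > 1.\<close>

lemma nn_integral_ray_frechet_finite: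
  assumes \<alpha>: "\<alpha> > 1"
  shows "(\<integral>\<^sup>+r. (\<integral>\<^sup>+v. ennreal (maj1 \<alpha> v r) * indicator {0..} v \<partial>lborel) \<partial>ray_measure \<alpha>) < \<infinity>"
proof -
  have "(\<integral>\<^sup>+r. (\<integral>\<^sup>+v. ennreal (maj1 \<alpha> v r) * indicator {0..} v \<partial>lborel) \<partial>ray_measure \<alpha>)
      \<le> (\<integral>\<^sup>+r. ennreal (r * min \<alpha> (r powr \<alpha>)) \<partial>ray_measure \<alpha>)"
    using \<alpha> by (intro nn_integral_mono nn_integral_maj1_le) (auto simp: space_ray_measure)
  also have "\<dots> \<le> (\<integral>\<^sup>+r. ennreal \<alpha> * indicator {0..1} r + ennreal \<alpha> * (ennreal (\<alpha> * r powr (- \<alpha>)) * indicator {1..} r) \<partial>lborel)"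
    unfolding nn_integral_ray_measure[of "\<lambda>r. ennreal (r * min \<alpha> (r powr \<alpha>))", simplified]
  proof (rule nn_integral_mono)
    fix r :: real
    show "ennreal (\<alpha> * r powr (- \<alpha> - 1)) * ennreal (r * min \<alpha> (r powr \<alpha>)) * indicator {0<..} r
       \<le> ennreal \<alpha> * indicator {0..1} r + ennreal \<alpha> * (ennreal (\<alpha> * r powr (- \<alpha>)) * indicator {1..} r)" (is "?l \<le> ?r")
    proof (cases "r > 0")
      case True
      have "r powr (- \<alpha> - 1) * r = r powr (- \<alpha>)" "r powr (- \<alpha>) * r powr \<alpha> = 1"
        using True powr_add[of r "- \<alpha> - 1" 1] powr_add[of r "- \<alpha>" \<alpha>] by auto
      moreover have "r powr (- \<alpha>) * min \<alpha> (r powr \<alpha>) = min (\<alpha> * r powr (- \<alpha>)) (r powr (- \<alpha>) * r powr \<alpha>)"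
        by (simp add: min_mult_distrib_left mult.commute)
      ultimately have "\<alpha> * r powr (- \<alpha> - 1) * (r * min \<alpha> (r powr \<alpha>)) = \<alpha> * min (\<alpha> * r powr (- \<alpha>)) 1"
        by (metis mult.assoc)
      then have "?l = ennreal (\<alpha> * min (\<alpha> * r powr (- \<alpha>)) 1)"
        using True \<alpha> by (simp add: ennreal_mult[symmetric])
      also have "\<dots> \<le> ennreal \<alpha> * (if r \<le> 1 then 1 else ennreal (\<alpha> * r powr (- \<alpha>)))"
        using \<alpha> by (auto simp: ennreal_mult[symmetric] intro!: ennreal_leI mult_left_mono)
      also have "\<dots> \<le> ?r" using True by (auto simp: indicator_def)
      finally show ?thesis .
    qed simp
  qed
  also have "\<dots> = ennreal \<alpha> + ennreal \<alpha> * (\<integral>\<^sup>+r. ennreal (\<alpha> * r powr (- \<alpha>)) * indicator {1..} r \<partial>lborel)"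
    by (subst nn_integral_add) (auto simp: nn_integral_cmult)
  also have "\<dots> = ennreal \<alpha> + ennreal \<alpha> * (ennreal \<alpha> * (\<integral>\<^sup>+r. ennreal (r powr (- \<alpha>)) * indicator {1..} r \<partial>lborel))"
    using \<alpha> by (subst nn_integral_cmult[symmetric]) (auto simp: ennreal_mult mult.assoc)
  also have "\<dots> < \<infinity>"
    using nn_integral_powr_tail_finite[OF \<alpha>] by (simp add: ennreal_mult_less_top)
  finally show ?thesis .
qed

context max_stable_law
begin

section \<open>Distribution and first moment of the max-stable vector\<close>

lemma Z_measurable [measurable]: "Z \<in> borel_measurable M"
  using ms by (auto simp: max_stable_def measurable_restrict_space2_iff)

lemma Z_pos: "\<omega> \<in> space M \<Longrightarrow> 0 < Z \<omega> $ j"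
  using ms by (auto simp: max_stable_def measurable_restrict_space2_iff pos_orthant_def)

lemma prob_Z_le: "z \<in> pos_orthant \<Longrightarrow> prob {\<omega> \<in> space M. Z \<omega> \<le> z} = exp (- \<Lambda> z)"
  using ms by (auto simp: max_stable_def cdf_vec_def \<Lambda>_def)

text \<open>Max-stability in the form used throughout: dividing z by s^(1/\<alpha>) multiplies
  \<Lambda> z by s.\<close>

lemma prob_scaled_Z_le:
  assumes z: "z \<in> pos_orthant" and s: "s > 0"
  shows "prob {\<omega> \<in> space M. s powr (1 / \<alpha>) *\<^sub>R Z \<omega> \<le> z} = exp (- s * \<Lambda> z)"
proof -
  define c where "c = s powr (1 / \<alpha>)"
  have c: "c > 0" using s by (simp add: c_def)
  have z': "(1 / c) *\<^sub>R z \<in> pos_orthant" using z c by (auto simp: pos_orthant_def)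
  have "{\<omega> \<in> space M. c *\<^sub>R Z \<omega> \<le> z} = {\<omega> \<in> space M. Z \<omega> \<le> (1 / c) *\<^sub>R z}"
    using c by (auto simp: less_eq_vec_def field_simps)
  then have "prob {\<omega> \<in> space M. c *\<^sub>R Z \<omega> \<le> z} = exp (- \<Lambda> ((1 / c) *\<^sub>R z))"
    using prob_Z_le[OF z'] by simp
  also have "\<Lambda> ((1 / c) *\<^sub>R z) = (1 / c) powr (- \<alpha>) * \<Lambda> z"
    using c by (intro \<Lambda>_scale z) auto
  also have "(1 / c) powr (- \<alpha>) = s"
    using s \<alpha> by (simp add: c_def powr_divide powr_powr powr_minus)
  finally show ?thesis by (simp add: c_def)
qed

text \<open>The event is the increasing limit of boxes whose other sides go to infinity; each has
  probability exp (-\<Lambda>), and side j alone bounds \<Lambda> from below.\<close>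

lemma prob_Z_nth_le:
  assumes a: "a > 0"
  shows "prob {\<omega> \<in> space M. Z \<omega> $ j \<le> a} \<le> exp (- (a powr (- \<alpha>)))"
proof -
  define z :: "nat \<Rightarrow> real^'n" where "z m = (\<chi> i. if i = j then a else real (Suc m))" for m
  have z: "z m \<in> pos_orthant" for m using a by (auto simp: z_def pos_orthant_def)
  have "{\<omega> \<in> space M. Z \<omega> $ j \<le> a} = (\<Union>m. {\<omega> \<in> space M. Z \<omega> \<le> z m})"
  proof safe
    fix \<omega> assume "\<omega> \<in> space M" "Z \<omega> $ j \<le> a"
    obtain m where "\<And>i. Z \<omega> $ i \<le> real m" using vec_le_real by blast
    then have "Z \<omega> \<le> z m" using \<open>Z \<omega> $ j \<le> a\<close>
      by (auto simp: z_def less_eq_vec_def intro: order_trans[of _ "real m"])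
    then show "\<omega> \<in> (\<Union>m. {\<omega> \<in> space M. Z \<omega> \<le> z m})" using \<open>\<omega> \<in> space M\<close> by auto
  next
    fix \<omega> m assume "Z \<omega> \<le> z m"
    then have "Z \<omega> $ j \<le> z m $ j" by (simp add: less_eq_vec_def)
    then show "Z \<omega> $ j \<le> a" by (simp add: z_def)
  qed
  moreover have "(\<lambda>m. prob {\<omega> \<in> space M. Z \<omega> \<le> z m}) \<longlonglongrightarrow> prob (\<Union>m. {\<omega> \<in> space M. Z \<omega> \<le> z m})"
  proof (rule finite_Lim_measure_incseq)
    have "z m \<le> z n" if "m \<le> n" for m n using that by (auto simp: z_def less_eq_vec_def)
    then show "incseq (\<lambda>m. {\<omega> \<in> space M. Z \<omega> \<le> z m})"
      by (auto simp: incseq_def intro: order_trans)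
  qed auto
  moreover have "prob {\<omega> \<in> space M. Z \<omega> \<le> z m} \<le> exp (- (a powr (- \<alpha>)))" for m
    using \<Lambda>_ge[OF z, of m j] by (simp add: prob_Z_le[OF z]) (simp add: z_def)
  ultimately show ?thesis by (auto intro: LIMSEQ_le_const2)
qed

lemma prob_scaled_Z_nth_le:
  assumes a: "a \<ge> 0" and s: "s > 0"
  shows "prob {\<omega> \<in> space M. s powr (1 / \<alpha>) * Z \<omega> $ j \<le> a} \<le> exp (- s * a powr (- \<alpha>))"
\<comment> \<open>At a = 0 the right side is 1, since \<open>0 powr _\<close> is 0, so that case is
  trivial.\<close>
proof (cases "a = 0")
  case False
  define c where "c = s powr (1 / \<alpha>)"
  have c: "c > 0" using s by (simp add: c_def)
  have "{\<omega> \<in> space M. c * Z \<omega> $ j \<le> a} = {\<omega> \<in> space M. Z \<omega> $ j \<le> a / c}"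
    using c by (auto simp: field_simps)
  moreover have "(a / c) powr (- \<alpha>) = s * a powr (- \<alpha>)"
    using s a \<alpha> c by (simp add: c_def powr_divide powr_powr powr_minus field_simps)
  ultimately show ?thesis
    using prob_Z_nth_le[of "a / c" j] a False c by (simp add: c_def)
qed simp

text \<open>A cube of side a together with 1 - exp (-\<Lambda>) \<le> \<Lambda>; the factor
  \<open>CARD('n)\<close> counts its sides in the union bound.\<close>

lemma prob_Z_nth_gt:
  assumes a: "a > 0"
  shows "prob {\<omega> \<in> space M. a < Z \<omega> $ j} \<le> CARD('n) * a powr (- \<alpha>)"
proof -
  let ?z = "(\<chi> i. a) :: real^'n"
  have z: "?z \<in> pos_orthant" using a by (auto simp: pos_orthant_def)
  have "prob {\<omega> \<in> space M. a < Z \<omega> $ j} \<le> prob {\<omega> \<in> space M. \<not> Z \<omega> \<le> ?z}"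
    by (rule finite_measure_mono) (auto simp: less_eq_vec_def not_le)
  also have "\<dots> = 1 - prob {\<omega> \<in> space M. Z \<omega> \<le> ?z}"
    by (rule prob_neg) auto
  also have "\<dots> \<le> \<Lambda> ?z" using prob_Z_le[OF z] exp_ge_add_one_self[of "- \<Lambda> ?z"] by simp
  also have "\<dots> \<le> CARD('n) * a powr (- \<alpha>)" using \<Lambda>_le[OF z] by simp
  finally show ?thesis .
qed

lemma integrable_Z_nth:
  assumes "\<alpha> > 1"
  shows "integrable M (\<lambda>\<omega>. Z \<omega> $ j)"
proof -
  interpret L: pair_sigma_finite M lborel ..
  have m: "(\<lambda>(\<omega>, a). indicator {1..<Z \<omega> $ j} a :: ennreal) \<in> borel_measurable (M \<Otimes>\<^sub>M lborel)"
    unfolding indicator_def atLeastLessThan_iff by measurable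
  have mi: "(\<lambda>\<omega>. \<integral>\<^sup>+a. indicator {1..<Z \<omega> $ j} a \<partial>lborel) \<in> borel_measurable M"
    by (rule lborel.borel_measurable_nn_integral[OF m])
  \<comment> \<open>Layer cake from level 1 on: levels below 1 contribute at most 1, those above are
    controlled by the tail a^-\<alpha>.\<close>
  have "(\<integral>\<^sup>+\<omega>. ennreal (Z \<omega> $ j) \<partial>M) \<le> (\<integral>\<^sup>+\<omega>. 1 + (\<integral>\<^sup>+a. indicator {1..<Z \<omega> $ j} a \<partial>lborel) \<partial>M)"
  proof (rule nn_integral_mono)
    fix \<omega>
    show "ennreal (Z \<omega> $ j) \<le> 1 + (\<integral>\<^sup>+a. indicator {1..<Z \<omega> $ j} a \<partial>lborel)"
      by (cases "1 \<le> Z \<omega> $ j") (auto simp: ennreal_plus[symmetric] ennreal_1[symmetric] simp del: ennreal_plus ennreal_1 intro: ennreal_leI)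
  qed
  also have "\<dots> = 1 + (\<integral>\<^sup>+a. (\<integral>\<^sup>+\<omega>. indicator {1..<Z \<omega> $ j} a \<partial>M) \<partial>lborel)"
    using L.Fubini[OF m] by (subst nn_integral_add[OF _ mi]) (auto simp: emeasure_space_1)
  also have "\<dots> \<le> 1 + (\<integral>\<^sup>+a. ennreal (CARD('n)) * (ennreal (a powr (- \<alpha>)) * indicator {1..} a) \<partial>lborel)"
  proof (intro add_left_mono nn_integral_mono)
    fix a :: real
    have "(\<integral>\<^sup>+\<omega>. indicator {1..<Z \<omega> $ j} a \<partial>M) = (\<integral>\<^sup>+\<omega>. indicator {1..} a * indicator {\<omega> \<in> space M. a < Z \<omega> $ j} \<omega> \<partial>M)"
      by (rule nn_integral_cong) (auto simp: indicator_def)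
    also have "\<dots> = indicator {1..} a * ennreal (prob {\<omega> \<in> space M. a < Z \<omega> $ j})"
      by (subst nn_integral_cmult) (auto simp: emeasure_eq_measure)
    also have "\<dots> \<le> ennreal (CARD('n)) * (ennreal (a powr (- \<alpha>)) * indicator {1..} a)"
      using prob_Z_nth_gt[of a j] by (cases "1 \<le> a") (auto simp: ennreal_mult[symmetric] ennreal_leI)
    finally show "(\<integral>\<^sup>+\<omega>. indicator {1..<Z \<omega> $ j} a \<partial>M) \<le> \<dots>" .
  qed
  also have "\<dots> = 1 + ennreal (CARD('n)) * (\<integral>\<^sup>+a. ennreal (a powr (- \<alpha>)) * indicator {1..} a \<partial>lborel)"
    by (subst nn_integral_cmult) auto
  also have "\<dots> < \<infinity>"
    using nn_integral_powr_tail_finite[OF assms] by (simp add: ennreal_mult_less_top)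
  finally show ?thesis
    using Z_pos by (intro integrableI_nonneg) (auto intro!: AE_I2 less_imp_le)
qed

section \<open>The majorant for increments of the semigroup\<close>

definition maj :: "real \<Rightarrow> real^'n \<Rightarrow> real" where
  "maj v y = (\<Sum>j\<in>UNIV. maj1 \<alpha> v (y $ j))"

abbreviation dom_total :: "real^'n \<Rightarrow> ennreal" where
  "dom_total y \<equiv> (\<integral>\<^sup>+v. ennreal (maj v y) * indicator {0..} v \<partial>lborel)"

lemma maj_measurable [measurable (raw)]:
  assumes [measurable]: "f \<in> borel_measurable K" "g \<in> borel_measurable K"
  shows "(\<lambda>x. maj (f x) (g x)) \<in> borel_measurable K"
  unfolding maj_def by measurable

lemma maj_nonneg: "0 \<le> y \<Longrightarrow> 0 \<le> maj v y"
  unfolding maj_def by (intro sum_nonneg maj1_nonneg) (auto simp: less_eq_vec_def)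

lemma nonneg_space_\<mu>: "y \<in> space \<mu> \<Longrightarrow> 0 \<le> y"
  by (auto simp: space_\<mu> punctured_orthant_def)

text \<open>The marginal formula splits the \<mu>-integral into one identical radial integral per
  coordinate.\<close>

lemma nn_integral_maj_finite:
  assumes "\<alpha> > 1"
  shows "(\<integral>\<^sup>+y. dom_total y \<partial>\<mu>) < \<infinity>"
proof -
  let ?\<phi> = "\<lambda>r. \<integral>\<^sup>+v. ennreal (maj1 \<alpha> v r) * indicator {0..} v \<partial>lborel"
  have "(\<integral>\<^sup>+y. dom_total y \<partial>\<mu>) = (\<integral>\<^sup>+y. (\<Sum>j\<in>UNIV. ?\<phi> (y $ j)) \<partial>\<mu>)"
  proof (rule nn_integral_cong)
    fix y assume "y \<in> space \<mu>"
    then have "0 \<le> maj1 \<alpha> v (y $ j)" for v j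
      using nonneg_space_\<mu>[of y] by (auto simp: less_eq_vec_def intro!: maj1_nonneg)
    then have "ennreal (maj v y) = (\<Sum>j\<in>UNIV. ennreal (maj1 \<alpha> v (y $ j)))" for v
      unfolding maj_def by (subst sum_ennreal) auto
    then show "dom_total y = (\<Sum>j\<in>UNIV. ?\<phi> (y $ j))"
      by (simp only: sum_distrib_right) (rule nn_integral_sum, measurable)
  qed
  also have "\<dots> = (\<Sum>j\<in>UNIV. \<integral>\<^sup>+y. ?\<phi> (y $ j) \<partial>\<mu>)"
    by (rule nn_integral_sum) (auto intro!: measurable_\<mu>)
  also have "\<dots> = (\<Sum>j\<in>(UNIV::'n set). \<integral>\<^sup>+r. ?\<phi> r \<partial>ray_measure \<alpha>)"
    by (rule sum.cong[OF refl], rule nn_integral_\<mu>_marginal) (auto simp: maj1_def)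
  also have "\<dots> < \<infinity>"
    using nn_integral_ray_frechet_finite[OF assms] by (simp add: ennreal_mult_less_top of_nat_less_top)
  finally show ?thesis .
qed

abbreviation \<rho> :: "(real \<times> (real^'n)) measure" where "\<rho> \<equiv> lborel \<Otimes>\<^sub>M \<mu>"
abbreviation sol :: "(real^'n \<Rightarrow> real) \<Rightarrow> real^'n \<Rightarrow> real" where "sol \<equiv> stein_sol \<alpha> M Z"
abbreviation integrand :: "(real^'n \<Rightarrow> real) \<Rightarrow> real^'n \<Rightarrow> real \<Rightarrow> real" where
  "integrand \<equiv> stein_integrand \<alpha> M Z"
abbreviation decay :: "real \<Rightarrow> real" where "decay t \<equiv> exp (- t / \<alpha>)"
abbreviation weight :: "real \<Rightarrow> real" where "weight t \<equiv> (1 - exp (- t)) powr (1 / \<alpha>)"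
abbreviation P :: "real \<Rightarrow> (real^'n \<Rightarrow> real) \<Rightarrow> real^'n \<Rightarrow> real" where
  "P t h x \<equiv> max_stable_semigroup \<alpha> M Z t h x"

abbreviation path :: "real \<Rightarrow> real^'n \<Rightarrow> 'a \<Rightarrow> real^'n" where
  "path t x \<omega> \<equiv> sup (decay t *\<^sub>R x) (weight t *\<^sub>R Z \<omega>)"

lemma semigroup_increment_bound:
  assumes h: "lip_l1 h" and x: "0 \<le> x" and y: "0 \<le> y" and v: "v > 0"
  shows "integrable M (\<lambda>\<omega>. h (path v (sup x y) \<omega>) - h (path v x \<omega>))" (is "integrable M ?D")
    and "(\<integral>\<omega>. \<bar>h (path v (sup x y) \<omega>) - h (path v x \<omega>)\<bar> \<partial>M) \<le> maj v y"
proof -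
  have [measurable]: "h \<in> borel_measurable borel" by (rule lip_l1_measurable[OF h])
  let ?B = "\<lambda>\<omega>. \<Sum>j\<in>UNIV. decay v * y $ j * indicator {\<omega> \<in> space M. weight v * Z \<omega> $ j \<le> decay v * y $ j} \<omega>"
  have xn: "0 \<le> x $ j" and yn: "0 \<le> y $ j" for j using x y by (auto simp: less_eq_vec_def)
  have le: "\<bar>?D \<omega>\<bar> \<le> ?B \<omega>" if "\<omega> \<in> space M" for \<omega>
  proof -
    have "\<bar>?D \<omega>\<bar> \<le> (\<Sum>j\<in>UNIV. \<bar>(path v (sup x y) \<omega>) $ j - (path v x \<omega>) $ j\<bar>)"
      using h unfolding lip_l1_def by blast
    also have "\<dots> \<le> ?B \<omega>"
    proof (rule sum_mono)
      fix j
      \<comment> \<open>One coordinate: if c, the part coming from \<open>Z\<close>, exceeds b, then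
        the jump is masked; otherwise it lifts the maximum by at most b.\<close>
      have *: "\<bar>max (max a b) c - max a c\<bar> \<le> (if c \<le> b then b else 0)" if "0 \<le> a" "0 \<le> b" for a b c :: real
        using that by auto
      have "max (decay v * x $ j) (decay v * y $ j) = decay v * max (x $ j) (y $ j)"
        by (simp add: max_mult_distrib_left)
      with *[of "decay v * x $ j" "decay v * y $ j" "weight v * Z \<omega> $ j"] xn yn that
      show "\<bar>(path v (sup x y) \<omega>) $ j - (path v x \<omega>) $ j\<bar>
         \<le> decay v * y $ j * indicator {\<omega> \<in> space M. weight v * Z \<omega> $ j \<le> decay v * y $ j} \<omega>"
        by (simp add: indicator_def split: if_splits)
    qed
    finally show ?thesis .
  qed
  have intB: "integrable M ?B" by (intro lintegrable_sum integrable_mult_right) (auto simp: emeasure_eq_measure)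
  show int: "integrable M ?D"
    by (rule lintegrable_bound[OF intB]) (use le in \<open>auto intro!: AE_I2 intro: order_trans[OF _ abs_ge_self]\<close>)
  have "(\<integral>\<omega>. \<bar>?D \<omega>\<bar> \<partial>M) \<le> (\<integral>\<omega>. ?B \<omega> \<partial>M)"
    using int intB le by (intro integral_mono) auto
  also have "\<dots> = (\<Sum>j\<in>UNIV. decay v * y $ j * prob {\<omega> \<in> space M. weight v * Z \<omega> $ j \<le> decay v * y $ j})"
    by (subst Bochner_Integration.integral_sum) (auto intro!: integrable_mult_right simp: emeasure_eq_measure)
  also have "\<dots> \<le> maj v y"
    unfolding maj_def maj1_def
  proof (intro sum_mono mult_left_mono)
    fix j
    have "prob {\<omega> \<in> space M. weight v * Z \<omega> $ j \<le> decay v * y $ j} \<le> exp (- (1 - exp (- v)) * (decay v * y $ j) powr (- \<alpha>))"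
      using v yn by (intro prob_scaled_Z_nth_le) auto
    \<comment> \<open>Since (exp (-v/\<alpha>))^-\<alpha> = exp v, the factor 1 - exp (-v) turns
      into exp v - 1.\<close>
    also have "- (1 - exp (- v)) * (decay v * y $ j) powr (- \<alpha>) = - (exp v - 1) * y $ j powr (- \<alpha>)"
    proof -
      have "decay v powr (- \<alpha>) = exp v" using \<alpha> by (simp add: powr_def)
      moreover have "(exp (- v) - 1) * exp v = 1 - exp v" by (simp add: algebra_simps exp_minus)
      ultimately show ?thesis using yn by (simp add: powr_mult mult.assoc[symmetric])
    qed
    finally show "prob {\<omega> \<in> space M. weight v * Z \<omega> $ j \<le> decay v * y $ j} \<le> exp (- (exp v - 1) * y $ j powr (- \<alpha>))" .
    show "0 \<le> decay v * y $ j" using yn by simp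
  qed
  finally show "(\<integral>\<omega>. \<bar>?D \<omega>\<bar> \<partial>M) \<le> maj v y" .
qed

section \<open>Indicators of boxes\<close>

text \<open>The T of the overview: it solves exp (-T/\<alpha>) max_j (x_j / z_j) = 1, and the
  inserted 1 clips it to 0 for points inside the box. It ends the stay outside the box, hence the
  name.\<close>

definition exit_time :: "real^'n \<Rightarrow> real^'n \<Rightarrow> real" where
  "exit_time z x = \<alpha> * ln (Max (insert 1 (range (\<lambda>j. x $ j / z $ j))))"

text \<open>The value of the semigroup on the indicator once the flow is inside: the probability
  that (1 - exp (-t))^(1/\<alpha>) \<open>Z\<close> lies below z.\<close>

definition inner_prob :: "real^'n \<Rightarrow> real \<Rightarrow> real" where
  "inner_prob z t = exp (- (1 - exp (- t)) * \<Lambda> z)"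

text \<open>Half-open because the semigroup vanishes on the indicator for t strictly before
  \<open>exit_time\<close>.\<close>

definition inner_integral :: "real^'n \<Rightarrow> real \<Rightarrow> real" where
  "inner_integral z T = (\<integral>t. indicator {0..<T} t * inner_prob z t \<partial>lborel)"

lemma exit_time_nonneg: "0 \<le> exit_time z x"
proof -
  have "1 \<le> Max (insert 1 (range (\<lambda>j. x $ j / z $ j)))" by (rule Max_ge) auto
  then show ?thesis unfolding exit_time_def using \<alpha> by simp
qed

lemma inner_prob_continuous: "continuous_on S (inner_prob z)"
  unfolding inner_prob_def by (intro continuous_intros)

lemma inner_prob_measurable [measurable]: "inner_prob z \<in> borel_measurable borel"
  by (rule borel_measurable_continuous_onI[OF inner_prob_continuous])

lemma inner_prob_bounds: "0 \<le> t \<Longrightarrow> inner_prob z t \<le> 1" "0 \<le> inner_prob z t"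
  using \<Lambda>_nonneg[of z] by (auto simp: inner_prob_def intro!: mult_nonpos_nonneg)

text \<open>The gap is \<open>inner_prob z t\<close> times 1 - exp (-q) with q = exp (-t) \<Lambda>
  z, and 1 - exp (-q) \<le> q. The decay exp (-t) makes the Stein integral of an indicator converge
  for every \<alpha> > 0.\<close>

lemma inner_prob_limit_bounds:
  assumes "0 \<le> t"
  shows "0 \<le> inner_prob z t - exp (- \<Lambda> z)" "inner_prob z t - exp (- \<Lambda> z) \<le> \<Lambda> z * exp (- t)"
proof -
  have le: "(1 - exp (- t)) * \<Lambda> z \<le> 1 * \<Lambda> z" by (rule mult_right_mono) (auto simp: \<Lambda>_nonneg)
  then show "0 \<le> inner_prob z t - exp (- \<Lambda> z)" by (simp add: inner_prob_def algebra_simps)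
  have "inner_prob z t - exp (- \<Lambda> z) = inner_prob z t * (1 - exp (- (exp (- t) * \<Lambda> z)))"
    by (simp add: inner_prob_def right_diff_distrib exp_add[symmetric]) (simp add: algebra_simps)
  also have "\<dots> \<le> 1 * (exp (- t) * \<Lambda> z)"
    using exp_ge_add_one_self[of "- (exp (- t) * \<Lambda> z)"] inner_prob_bounds(1)[OF assms, of z] \<Lambda>_nonneg[of z]
    by (intro mult_mono) (auto simp: inner_prob_bounds)
  finally show "inner_prob z t - exp (- \<Lambda> z) \<le> \<Lambda> z * exp (- t)" by (simp add: mult.commute)
qed

lemma integrable_exp_tail:
  assumes "k > 0"
  shows "integrable lborel (\<lambda>t. indicator {0..} t * exp (- k * t) :: real)"
proof -
  have "(\<integral>\<^sup>+t. ennreal (indicator {0..} t * exp (- k * t)) \<partial>lborel) = (\<integral>\<^sup>+t. ennreal (exp (- k * t)) * indicator {0..} t \<partial>lborel)"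
    by (rule nn_integral_cong) (auto simp: indicator_def)
  then show ?thesis
    using nn_integral_exp_decay[OF assms] by (intro integrableI_nonneg) auto
qed

lemmas integrable_exp_neg = integrable_exp_tail[of 1, simplified]

lemma integrable_inner_prob_limit:
  "integrable lborel (\<lambda>t. indicator {0..} t * (inner_prob z t - exp (- \<Lambda> z)))"
  by (rule lintegrable_bound[OF integrable_mult_right[OF integrable_exp_neg, of "\<Lambda> z"]])
    (use inner_prob_limit_bounds[of _ z] in \<open>auto simp: indicator_def \<Lambda>_nonneg intro!: AE_I2\<close>)

lemma integrable_inner_prob: "integrable lborel (\<lambda>t. indicator {a..<b} t * inner_prob z t)" if "0 \<le> a"
  by (rule lintegrable_bound[of _ "indicator {a..b} :: real \<Rightarrow> real"])
    (use that inner_prob_bounds[where z=z] in \<open>auto simp: emeasure_lborel_Icc_eq split: split_indicator intro!: AE_I2\<close>)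

text \<open>The derivative theorem is about the gauge integral, hence the detour. T > 0 is interior
  to [0, T+1], so the derivative is two-sided.\<close>

lemma inner_integral_has_derivative:
  assumes "T > 0"
  shows "(inner_integral z has_real_derivative inner_prob z T) (at T)"
proof -
  have eq: "inner_integral z u = integral {0..u} (inner_prob z)" for u
  proof -
    have "set_integrable lborel {0..u} (inner_prob z)"
      by (rule borel_integrable_atLeastAtMost') (rule inner_prob_continuous)
    from set_borel_integral_eq_integral(2)[OF this]
    have "integral {0..u} (inner_prob z) = (\<integral>t. indicator {0..u} t * inner_prob z t \<partial>lborel)"
      by (simp add: set_lebesgue_integral_def)
    also have "\<dots> = inner_integral z u"
      unfolding inner_integral_def
    proof (rule integral_cong_AE)
      show "AE t in lborel. indicator {0..u} t * inner_prob z t = indicator {0..<u} t * inner_prob z t"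
        using AE_lborel_singleton[of u] by eventually_elim (auto split: split_indicator)
    qed measurable
    finally show ?thesis ..
  qed
  have "((\<lambda>u. integral {0..u} (inner_prob z)) has_real_derivative inner_prob z T) (at T within {0..T+1})"
    using assms by (intro integral_has_real_derivative inner_prob_continuous) auto
  moreover have "at T within {0..T+1} = at T"
    by (rule at_within_interior) (use assms in simp)
  ultimately show ?thesis unfolding eq[symmetric] by simp
qed

lemma inner_integral_diff:
  assumes "0 \<le> a" "a \<le> b"
  shows "inner_integral z b - inner_integral z a = (\<integral>t. indicator {a..<b} t * inner_prob z t \<partial>lborel)"
  unfolding inner_integral_def
  by (subst lintegral_diff[symmetric, OF integrable_inner_prob integrable_inner_prob])
    (use assms in \<open>auto intro!: lintegral_cong simp: indicator_def\<close>)

text \<open>The integrand is minus the derivative of \<open>inner_prob z\<close>, whose limit at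
  infinity is exp (-\<Lambda> z).\<close>

lemma nn_integral_inner_prob_tail:
  assumes "0 \<le> a"
  shows "(\<integral>\<^sup>+t. ennreal (inner_prob z t * (exp (- t) * \<Lambda> z)) * indicator {a..} t \<partial>lborel)
    = ennreal (inner_prob z a - exp (- \<Lambda> z))"
proof -
  have "(\<integral>\<^sup>+t. ennreal (inner_prob z t * (exp (- t) * \<Lambda> z)) * indicator {a..} t \<partial>lborel)
      = ennreal (- exp (- \<Lambda> z) - (- inner_prob z a))"
  proof (rule nn_integral_FTC_atLeast[where F="\<lambda>t. - inner_prob z t"])
    show "DERIV (\<lambda>t. - inner_prob z t) t :> inner_prob z t * (exp (- t) * \<Lambda> z)" for t
      unfolding inner_prob_def by (auto intro!: derivative_eq_intros)
    have "((\<lambda>t::real. exp (- t)) \<longlongrightarrow> 0) at_top"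
      by (rule filterlim_compose[OF exp_at_bot filterlim_uminus_at_bot_at_top])
    then have "((\<lambda>t. - exp (- (1 - exp (- t)) * \<Lambda> z)) \<longlongrightarrow> - exp (- (1 - 0) * \<Lambda> z)) at_top"
      by (intro tendsto_intros)
    then show "((\<lambda>t. - inner_prob z t) \<longlongrightarrow> - exp (- \<Lambda> z)) at_top" by (simp add: inner_prob_def)
  qed (auto simp: inner_prob_bounds \<Lambda>_nonneg)
  then show ?thesis by simp
qed

context
  fixes z :: "real^'n"
  assumes z: "z \<in> pos_orthant"
begin

lemma exit_time_le_iff:
  assumes t: "0 \<le> t"
  shows "exit_time z x \<le> t \<longleftrightarrow> decay t *\<^sub>R x \<le> z"
proof -
  let ?m = "Max (insert 1 (range (\<lambda>j. x $ j / z $ j)))"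
  have m: "1 \<le> ?m" by (rule Max_ge) auto
  have "exit_time z x \<le> t \<longleftrightarrow> ln ?m \<le> t / \<alpha>"
    unfolding exit_time_def using \<alpha> by (simp add: field_simps)
  also have "\<dots> \<longleftrightarrow> ?m \<le> exp (t / \<alpha>)"
    using m ln_le_cancel_iff[of ?m "exp (t / \<alpha>)"] by simp
  also have "\<dots> \<longleftrightarrow> (\<forall>j. x $ j / z $ j \<le> exp (t / \<alpha>))"
    using t \<alpha> by auto
  also have "\<dots> \<longleftrightarrow> decay t *\<^sub>R x \<le> z"
    using z by (auto simp: less_eq_vec_def pos_orthant_def exp_minus field_simps)
  finally show ?thesis .
qed

text \<open>An upper bound z holds for a maximum iff it holds for both points, so the two sides lie
  below the same thresholds t.\<close>

lemma exit_time_sup: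
  shows "exit_time z (sup x y) = max (exit_time z x) (exit_time z y)"
proof -
  have *: "exit_time z (sup x y) \<le> t \<longleftrightarrow> exit_time z x \<le> t \<and> exit_time z y \<le> t" if "0 \<le> t" for t
    unfolding exit_time_le_iff[OF that] by (simp add: scaleR_sup_vec)
  show ?thesis
    using *[of "exit_time z (sup x y)"] *[of "max (exit_time z x) (exit_time z y)"]
    by (auto simp: exit_time_nonneg le_max_iff_disj intro!: antisym)
qed

lemma exit_time_eq_0_iff:
  shows "exit_time z x = 0 \<longleftrightarrow> x \<le> z"
  using exit_time_le_iff[of 0 x] exit_time_nonneg[of z x] by auto

lemma semigroup_indicator:
  assumes x: "0 \<le> x" and t: "0 \<le> t"
  shows "P t (indicator {0..z}) x = (if exit_time z x \<le> t then inner_prob z t else 0)"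
proof -
  have "P t (indicator {0..z}) x = (\<integral>\<omega>. (if exit_time z x \<le> t then 1 else 0) * indicator {\<omega> \<in> space M. weight t *\<^sub>R Z \<omega> \<le> z} \<omega> \<partial>M)"
    unfolding max_stable_semigroup_def exit_time_le_iff[OF t]
  proof (intro lintegral_cong refl)
    fix \<omega> assume "\<omega> \<in> space M"
    then have "0 \<le> path t x \<omega>"
      using x by (auto simp: less_eq_vec_def intro!: max.coboundedI1)
    then show "indicator {0..z} (path t x \<omega>) =
      ((if decay t *\<^sub>R x \<le> z then 1 else 0) * indicator {\<omega> \<in> space M. weight t *\<^sub>R Z \<omega> \<le> z} \<omega> :: real)"
      using \<open>\<omega> \<in> space M\<close> by (auto simp: indicator_def)
  qed
  also have "\<dots> = (if exit_time z x \<le> t then prob {\<omega> \<in> space M. weight t *\<^sub>R Z \<omega> \<le> z} else 0)"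
    by simp
  also have "prob {\<omega> \<in> space M. weight t *\<^sub>R Z \<omega> \<le> z} = inner_prob z t"
  \<comment> \<open>At t = 0 the weight is 0 and z is nonnegative, so the probability is 1;
    \<open>prob_scaled_Z_le\<close> covers only positive scales.\<close>
  proof (cases "t = 0")
    case True
    have "0 \<le> z" using z by (auto simp: pos_orthant_def less_eq_vec_def less_imp_le)
    then show ?thesis using True by (simp add: inner_prob_def prob_space)
  next
    case False
    then show ?thesis using t prob_scaled_Z_le[OF z, of "1 - exp (- t)"] by (simp add: inner_prob_def)
  qed
  finally show ?thesis .
qed

lemma expectation_indicator:
  shows "(\<integral>\<omega>. indicator {0..z} (Z \<omega>) \<partial>M) = exp (- \<Lambda> z)"
proof -
  have "(\<integral>\<omega>. indicator {0..z} (Z \<omega>) \<partial>M) = (\<integral>\<omega>. indicator {\<omega> \<in> space M. Z \<omega> \<le> z} \<omega> \<partial>M :: real)"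
    by (intro lintegral_cong refl)
      (auto simp: indicator_def less_eq_vec_def less_imp_le[OF Z_pos])
  then show ?thesis using prob_Z_le[OF z] by simp
qed

text \<open>The vanishing before entry is written as the formula valid after entry minus its missing
  piece; only that piece depends on x.\<close>

lemma integrand_indicator:
  assumes x: "0 \<le> x"
  shows "indicator {0..} t *\<^sub>R integrand (indicator {0..z}) x t =
    indicator {0..} t * (inner_prob z t - exp (- \<Lambda> z)) - indicator {0..<exit_time z x} t * inner_prob z t"
  using semigroup_indicator[OF x, of t]
  by (cases "0 \<le> t"; cases "t < exit_time z x")
    (auto simp: stein_integrand_def expectation_indicator)

lemma integrand_indicator_integrable:
  assumes x: "0 \<le> x"
  shows "set_integrable lborel {0..} (integrand (indicator {0..z}) x)"
  unfolding set_integrable_def integrand_indicator[OF assms]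
  by (intro lintegrable_diff integrable_inner_prob_limit integrable_inner_prob) simp

text \<open>The part independent of x is recognised as the value at 0, where the entry time is
  0.\<close>

lemma sol_indicator:
  assumes x: "0 \<le> x"
  shows "sol (indicator {0..z}) x =
    sol (indicator {0..z}) 0 + inner_integral z (exit_time z x)"
proof -
  have "sol (indicator {0..z}) x =
      - (\<integral>t. indicator {0..} t * (inner_prob z t - exp (- \<Lambda> z)) \<partial>lborel) + inner_integral z (exit_time z x)"
    if "0 \<le> x" for x
    unfolding stein_sol_def set_lebesgue_integral_def integrand_indicator[OF that] inner_integral_def
    by (subst lintegral_diff[OF integrable_inner_prob_limit integrable_inner_prob]) auto
  from this[OF x] this[of 0] show ?thesis
    using exit_time_eq_0_iff[of 0] z
    by (auto simp: inner_integral_def pos_orthant_def less_eq_vec_def less_imp_le)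
qed

text \<open>Tonelli: the increment is the integral of \<open>inner_prob z\<close> from T(x) to
  max(T(x), T(y)). With the integrals exchanged, the inner one is \<mu>(T > t) = exp (-t) \<Lambda>
  z, and the product is an exact derivative.\<close>

lemma integral_jump_indicator:
  assumes x: "0 \<le> x"
  defines "f \<equiv> sol (indicator {0..z})"
  shows "integrable \<mu> (\<lambda>y. f (sup x y) - f x)"
    and "(\<integral>y. f (sup x y) - f x \<partial>\<mu>) = inner_prob z (exit_time z x) - exp (- \<Lambda> z)"
proof -
  interpret Q: pair_sigma_finite \<mu> lborel ..
  define a where "a = exit_time z x"
  have a: "0 \<le> a" by (simp add: a_def exit_time_nonneg)
  \<comment> \<open>For t \<ge> 0 the last indicator says t < T(y), so k is the integrand of the
    increment as a function of y and t jointly.\<close>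
  define k where "k y t = ennreal (inner_prob z t) * indicator {a..} t * indicator {y. \<not> decay t *\<^sub>R y \<le> z} y" for y t
  have km0: "(\<lambda>p. k (fst p) (snd p)) \<in> borel_measurable (borel \<Otimes>\<^sub>M borel)"
    unfolding k_def indicator_def mem_Collect_eq by measurable
  have km: "(\<lambda>(y, t). k y t) \<in> borel_measurable (\<mu> \<Otimes>\<^sub>M lborel)"
  proof -
    have "(\<lambda>p. (fst p, snd p)) \<in> measurable (\<mu> \<Otimes>\<^sub>M lborel) (borel \<Otimes>\<^sub>M borel)"
      by (intro measurable_Pair measurable_compose[OF measurable_fst measurable_\<mu>]) auto
    from measurable_compose[OF this km0] show ?thesis by (simp add: case_prod_unfold)
  qed
  have diff: "ennreal (f (sup x y) - f x) = (\<integral>\<^sup>+t. k y t \<partial>lborel)" and nonneg: "0 \<le> f (sup x y) - f x"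
    if "0 \<le> y" for y
  proof -
    have "0 \<le> sup x y" using x by (rule order_trans) simp
    then have "f (sup x y) - f x = inner_integral z (max a (exit_time z y)) - inner_integral z a"
      unfolding f_def sol_indicator[OF x] a_def exit_time_sup[symmetric]
      by (subst sol_indicator) auto
    also have "\<dots> = (\<integral>t. indicator {a..<max a (exit_time z y)} t * inner_prob z t \<partial>lborel)"
      by (rule inner_integral_diff) (use a in auto)
    finally have eq: "f (sup x y) - f x = \<dots>" .
    show "0 \<le> f (sup x y) - f x" unfolding eq
      by (rule Bochner_Integration.integral_nonneg) (auto simp: inner_prob_bounds)
    have "ennreal (f (sup x y) - f x) = (\<integral>\<^sup>+t. ennreal (indicator {a..<max a (exit_time z y)} t * inner_prob z t) \<partial>lborel)"
      unfolding eq using a by (intro nn_integral_eq_integral[symmetric] integrable_inner_prob AE_I2) (auto simp: inner_prob_bounds)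
    also have "\<dots> = (\<integral>\<^sup>+t. k y t \<partial>lborel)"
    proof (rule nn_integral_cong)
      fix t
      show "ennreal (indicator {a..<max a (exit_time z y)} t * inner_prob z t) = k y t"
        using a exit_time_le_iff[of t y] by (auto simp: k_def indicator_def)
    qed
    finally show "ennreal (f (sup x y) - f x) = (\<integral>\<^sup>+t. k y t \<partial>lborel)" .
  qed
  have "(\<integral>\<^sup>+y. ennreal (f (sup x y) - f x) \<partial>\<mu>) = (\<integral>\<^sup>+y. (\<integral>\<^sup>+t. k y t \<partial>lborel) \<partial>\<mu>)"
    by (rule nn_integral_cong) (use diff nonneg_space_\<mu> in auto)
  also have "\<dots> = (\<integral>\<^sup>+t. (\<integral>\<^sup>+y. k y t \<partial>\<mu>) \<partial>lborel)"
    using Q.Fubini'[OF km] by simp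
  also have "\<dots> = (\<integral>\<^sup>+t. ennreal (inner_prob z t * (exp (- t) * \<Lambda> z)) * indicator {a..} t \<partial>lborel)"
  proof (rule nn_integral_cong)
    fix t :: real
    have "decay t powr \<alpha> = exp (- t)" using \<alpha> by (simp add: powr_def)
    moreover have "(\<lambda>y. indicator {y. \<not> decay t *\<^sub>R y \<le> z} y :: ennreal) \<in> borel_measurable \<mu>"
      by (intro measurable_\<mu>) measurable
    ultimately show "(\<integral>\<^sup>+y. k y t \<partial>\<mu>) = ennreal (inner_prob z t * (exp (- t) * \<Lambda> z)) * indicator {a..} t"
      unfolding k_def using nn_integral_\<mu>_scale_not_le[OF z, of "decay t"]
      by (subst nn_integral_cmult) (auto simp: ennreal_mult inner_prob_bounds \<Lambda>_nonneg ac_simps)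
  qed
  also have "\<dots> = ennreal (inner_prob z a - exp (- \<Lambda> z))" by (rule nn_integral_inner_prob_tail[OF a])
  finally have nn: "(\<integral>\<^sup>+y. ennreal (f (sup x y) - f x) \<partial>\<mu>) = ennreal (inner_prob z a - exp (- \<Lambda> z))" .
  \<comment> \<open>Measurability in y is read off the kernel k, since the increment equals its
    integral over t.\<close>
  have "(\<lambda>y. enn2real (\<integral>\<^sup>+t. k y t \<partial>lborel)) \<in> borel_measurable \<mu>"
    using km by measurable
  then have meas: "(\<lambda>y. f (sup x y) - f x) \<in> borel_measurable \<mu>"
    by (rule measurable_cong[THEN iffD1, rotated])
      (use nonneg_space_\<mu> in \<open>auto simp: diff[symmetric] intro!: enn2real_ennreal nonneg\<close>)
  have "integrable \<mu> (\<lambda>y. f (sup x y) - f x) \<and> (\<integral>y. f (sup x y) - f x \<partial>\<mu>) = inner_prob z a - exp (- \<Lambda> z)"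
    using nn meas inner_prob_limit_bounds[OF a, of z] nonneg nonneg_space_\<mu>
    by (subst nn_integral_eq_integrable[symmetric]) (auto intro!: AE_I2)
  then show "integrable \<mu> (\<lambda>y. f (sup x y) - f x)"
    and "(\<integral>y. f (sup x y) - f x \<partial>\<mu>) = inner_prob z (exit_time z x) - exp (- \<Lambda> z)"
    by (auto simp: a_def)
qed

text \<open>Along a ray the largest ratio m is multiplied by s, whichever coordinates attain it, so
  ties do no harm: T(s x) = \<alpha> ln (s m) outside the box, with derivative \<alpha> at s = 1.
  Strictly inside, g is locally constant. The condition \<open>ne\<close> separates the two
  regimes.\<close>

lemma radial_sol_indicator:
  assumes x: "0 \<le> x" and ne: "\<And>j. x $ j \<noteq> z $ j"
  shows "((\<lambda>s. sol (indicator {0..z}) (s *\<^sub>R x)) has_real_derivative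
    (if x \<le> z then 0 else \<alpha> * inner_prob z (exit_time z x))) (at 1)"
proof -
  let ?f = "sol (indicator {0..z})"
  have zp: "0 < z $ j" for j using z by (auto simp: pos_orthant_def)
  note pos = eventually_pos_nhds_1
  have f_eq: "?f (s *\<^sub>R x) = ?f 0 + inner_integral z (exit_time z (s *\<^sub>R x))" if "0 < s" for s
    using x that by (intro sol_indicator z) (auto simp: less_eq_vec_def)
  show ?thesis
  proof (cases "x \<le> z")
    case True
    then have lt: "x $ j < z $ j" for j using ne[of j] by (auto simp: less_eq_vec_def order_less_le)
    have "\<forall>\<^sub>F s in nhds 1. s * x $ j < z $ j" for j
    proof (rule order_tendstoD(2)[where y="1 * x $ j"])
      show "((\<lambda>s. s * x $ j) \<longlongrightarrow> 1 * x $ j) (nhds 1)" by (intro tendsto_intros filterlim_ident)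
    qed (use lt in simp)
    then have "\<forall>\<^sub>F s in nhds 1. \<forall>j. s * x $ j < z $ j" by (rule eventually_all_finite)
    with pos have "\<forall>\<^sub>F s in nhds 1. ?f (s *\<^sub>R x) = ?f 0"
    proof eventually_elim
      case (elim s)
      then have "s *\<^sub>R x \<le> z" by (auto simp: less_eq_vec_def less_imp_le)
      then have "exit_time z (s *\<^sub>R x) = 0" using exit_time_eq_0_iff by simp
      then show ?case using f_eq[of s] elim by (simp add: inner_integral_def)
    qed
    then have "((\<lambda>s. ?f (s *\<^sub>R x)) has_real_derivative 0) (at 1) \<longleftrightarrow> ((\<lambda>s. ?f 0) has_real_derivative 0) (at 1)"
      by (intro DERIV_cong_ev) auto
    then show ?thesis using True by simp
  next
    case False
    let ?R = "range (\<lambda>j. x $ j / z $ j)"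
    define m where "m = Max ?R"
    from False obtain i where "z $ i < x $ i" by (auto simp: less_eq_vec_def not_le)
    then have "1 < x $ i / z $ i" using zp[of i] by simp
    also have "x $ i / z $ i \<le> m" unfolding m_def by (rule Max_ge) auto
    finally have m: "1 < m" .
    \<comment> \<open>With s m > 1 for s near 1, the clipping at 1 is inactive.\<close>
    have "\<forall>\<^sub>F s in nhds 1. 1 < s * m"
    proof (rule order_tendstoD(1)[where y="1 * m"])
      show "((\<lambda>s. s * m) \<longlongrightarrow> 1 * m) (nhds 1)" by (intro tendsto_intros filterlim_ident)
    qed (use m in simp)
    with pos have ev: "\<forall>\<^sub>F s in nhds 1. exit_time z (s *\<^sub>R x) = \<alpha> * ln (s * m)"
    proof eventually_elim
      case (elim s)
      have "range (\<lambda>j. (s *\<^sub>R x) $ j / z $ j) = (\<lambda>q. s * q) ` ?R" by (auto simp: image_iff)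
      moreover have "Max ((\<lambda>q. s * q) ` ?R) = s * Max ?R"
        using elim by (intro mono_Max_commute[symmetric]) (auto simp: mono_def)
      ultimately have "Max (insert 1 (range (\<lambda>j. (s *\<^sub>R x) $ j / z $ j))) = max 1 (s * m)"
        by (subst Max_insert) (auto simp: m_def)
      then show ?case using elim by (simp add: exit_time_def)
    qed
    have x1: "exit_time z x = \<alpha> * ln m" using eventually_nhds_x_imp_x[OF ev] by simp
    have "0 < exit_time z x" using m \<alpha> by (simp add: x1)
    from inner_integral_has_derivative[OF this]
    have D: "(inner_integral z has_real_derivative inner_prob z (exit_time z x)) (at (\<alpha> * ln (1 * m)))"
      by (simp add: x1)
    have "((\<lambda>s. \<alpha> * ln (s * m)) has_real_derivative \<alpha>) (at 1)"
      using m by (auto intro!: derivative_eq_intros)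
    from DERIV_chain2[OF D this]
    have "((\<lambda>s. ?f 0 + inner_integral z (\<alpha> * ln (s * m))) has_real_derivative 0 + inner_prob z (exit_time z x) * \<alpha>) (at 1)"
      by (intro DERIV_add) auto
    moreover have "\<forall>\<^sub>F s in nhds 1. ?f (s *\<^sub>R x) = ?f 0 + inner_integral z (\<alpha> * ln (s * m))"
      using pos ev by eventually_elim (use f_eq in simp)
    ultimately have "((\<lambda>s. ?f (s *\<^sub>R x)) has_real_derivative 0 + inner_prob z (exit_time z x) * \<alpha>) (at 1)"
      by (subst DERIV_cong_ev[OF refl _ refl]) auto
    then show ?thesis using False by (simp add: mult.commute)
  qed
qed

text \<open>Outside the box the drift contributes minus \<open>inner_prob\<close> at T, which
  cancels that term of the jump integral and leaves -exp (-\<Lambda> z). Inside, the drift is 0 and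
  \<open>inner_prob z 0\<close> is 1.\<close>

lemma generator_sol_indicator:
  assumes x: "0 \<le> x" and ne: "\<And>j. x $ j \<noteq> z $ j"
  shows "generator_defined \<alpha> \<nu> (sol (indicator {0..z})) x"
    and "generator \<alpha> \<nu> (sol (indicator {0..z})) x = indicator {0..z} x - cdf_vec M Z z"
proof -
  note D = radial_sol_indicator[OF assms]
  show "generator_defined \<alpha> \<nu> (sol (indicator {0..z})) x"
    unfolding generator_defined_def
    using D integral_jump_indicator(1)[OF x] by (auto simp: real_differentiable_def)
  have c: "cdf_vec M Z z = exp (- \<Lambda> z)" by (simp add: cdf_vec_def prob_Z_le[OF z])
  show "generator \<alpha> \<nu> (sol (indicator {0..z})) x = indicator {0..z} x - cdf_vec M Z z"
    unfolding generator_def radial_deriv_def DERIV_imp_deriv[OF D] integral_jump_indicator(2)[OF x] c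
    using \<alpha> x exit_time_eq_0_iff[of x] by (auto simp: indicator_def inner_prob_def)
qed

text \<open>A strictly largest ratio stays the largest nearby, so T(y) is locally the smooth
  function \<alpha> ln (y_j / z_j) of one coordinate. The last hypothesis avoids the kinks at tied
  maxima.\<close>

lemma sol_indicator_differentiable:
  assumes x: "0 \<le> x" and ne: "\<And>j. x $ j \<noteq> z $ j"
    and "x \<le> z \<or> (\<exists>j. \<forall>i. i \<noteq> j \<longrightarrow> x $ i / z $ i < x $ j / z $ j)"
  shows "sol (indicator {0..z}) differentiable (at x within {0..})"
proof -
  let ?f = "sol (indicator {0..z})"
  have zp: "0 < z $ j" for j using z by (auto simp: pos_orthant_def)
  have nth: "((\<lambda>y. y $ j) \<longlongrightarrow> x $ j) (nhds x)" for j
    by (intro tendsto_vec_nth filterlim_ident)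
  \<comment> \<open>The formula for the solution holds on the orthant only; agreement there is
    enough for a derivative within it.\<close>
  have transfer: "?f differentiable (at x within {0..})"
    if g: "g differentiable (at x within {0..})" and ev: "\<forall>\<^sub>F y in nhds x. 0 \<le> y \<longrightarrow> ?f y = g y" for g
  proof -
    from g obtain g' where g': "(g has_derivative g') (at x within {0..})" by (auto simp: differentiable_def)
    have "\<forall>\<^sub>F y in at x within {0..}. g y = ?f y"
      using ev by (auto simp: eventually_at_filter elim: eventually_mono)
    from has_derivative_transform_eventually[OF g' this] eventually_nhds_x_imp_x[OF ev] x
    show ?thesis by (auto simp: differentiable_def)
  qed
  show ?thesis
  proof (cases "x \<le> z")
    case True
    then have lt: "x $ j < z $ j" for j using ne[of j] by (auto simp: less_eq_vec_def order_less_le)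
    have "\<forall>\<^sub>F y in nhds x. \<forall>j. y $ j < z $ j"
      by (rule eventually_all_finite) (rule order_tendstoD(2)[OF nth lt])
    then have "\<forall>\<^sub>F y in nhds x. 0 \<le> y \<longrightarrow> ?f y = ?f 0"
    proof eventually_elim
      case (elim y)
      then have "y \<le> z" by (auto simp: less_eq_vec_def less_imp_le)
      then have "exit_time z y = 0" using exit_time_eq_0_iff by simp
      then show ?case using sol_indicator[of y] by (auto simp: inner_integral_def)
    qed
    then show ?thesis by (intro transfer[of "\<lambda>_. ?f 0"]) auto
  next
    case False
    with assms(3) obtain j where j: "\<And>i. i \<noteq> j \<Longrightarrow> x $ i / z $ i < x $ j / z $ j" by auto
    from False obtain i where i: "z $ i < x $ i" by (auto simp: less_eq_vec_def not_le)
    then have "1 < x $ i / z $ i" using zp[of i] by simp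
    also have "x $ i / z $ i \<le> x $ j / z $ j" using j[of i] by (cases "i = j") auto
    finally have xj: "1 < x $ j / z $ j" .
    have nth': "((\<lambda>y. y $ i / z $ i) \<longlongrightarrow> x $ i / z $ i) (nhds x)" for i
      using zp[of i] by (intro tendsto_divide nth tendsto_const) auto
    have "\<forall>\<^sub>F y in nhds x. \<forall>i. i \<noteq> j \<longrightarrow> y $ i / z $ i < y $ j / z $ j"
    proof (rule eventually_all_finite)
      fix i
      show "\<forall>\<^sub>F y in nhds x. i \<noteq> j \<longrightarrow> y $ i / z $ i < y $ j / z $ j"
      proof (cases "i = j")
        case False
        have "((\<lambda>y. y $ j / z $ j - y $ i / z $ i) \<longlongrightarrow> x $ j / z $ j - x $ i / z $ i) (nhds x)"
          by (intro tendsto_diff nth')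
        from order_tendstoD(1)[OF this, of 0] j[OF False] show ?thesis
          by (auto elim: eventually_mono)
      qed simp
    qed
    moreover have "\<forall>\<^sub>F y in nhds x. 1 < y $ j / z $ j" by (rule order_tendstoD(1)[OF nth' xj])
    ultimately have ev: "\<forall>\<^sub>F y in nhds x. exit_time z y = \<alpha> * ln (y $ j / z $ j)"
    proof eventually_elim
      case (elim y)
      have "Max (insert 1 (range (\<lambda>i. y $ i / z $ i))) = y $ j / z $ j"
      proof (rule Max_eqI)
        fix q assume "q \<in> insert 1 (range (\<lambda>i. y $ i / z $ i))"
        then show "q \<le> y $ j / z $ j" using elim by (auto simp: less_imp_le)
      qed auto
      then show ?case by (simp add: exit_time_def)
    qed
    have x1: "exit_time z x = \<alpha> * ln (x $ j / z $ j)" using eventually_nhds_x_imp_x[OF ev] .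
    have "0 < exit_time z x" using xj \<alpha> by (simp add: x1 ln_gt_zero)
    from inner_integral_has_derivative[OF this]
    have D: "(inner_integral z has_real_derivative inner_prob z (exit_time z x)) (at (\<alpha> * ln (x $ j / z $ j)))"
      by (simp add: x1)
    have "((\<lambda>q. \<alpha> * ln (q / z $ j)) has_real_derivative \<alpha> * (1 / (x $ j / z $ j) * (1 / z $ j))) (at (x $ j))"
      using xj zp[of j] by (auto intro!: derivative_eq_intros)
    from DERIV_chain2[OF D this]
    have D2: "((\<lambda>q. inner_integral z (\<alpha> * ln (q / z $ j))) has_real_derivative
        inner_prob z (exit_time z x) * (\<alpha> * (1 / (x $ j / z $ j) * (1 / z $ j)))) (at (x $ j))" .
    have "((\<lambda>y::real^'n. y $ j) has_derivative (\<lambda>y. y $ j)) (at x within {0..})"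
      by (rule bounded_linear_imp_has_derivative[OF bounded_linear_vec_nth])
    from DERIV_compose_FDERIV[OF D2 this]
    have "(\<lambda>y. inner_integral z (\<alpha> * ln (y $ j / z $ j))) differentiable (at x within {0..})"
      by (auto simp: differentiable_def)
    then have "(\<lambda>y. ?f 0 + inner_integral z (\<alpha> * ln (y $ j / z $ j))) differentiable (at x within {0..})"
      by (intro differentiable_add differentiable_const)
    moreover have "\<forall>\<^sub>F y in nhds x. 0 \<le> y \<longrightarrow> ?f y = ?f 0 + inner_integral z (\<alpha> * ln (y $ j / z $ j))"
      using ev
    proof eventually_elim
      case (elim y)
      then show ?case using sol_indicator[of y] by auto
    qed
    ultimately show ?thesis by (rule transfer)
  qed
qed

end

end

section \<open>The semigroup along the flow\<close>

context
  fixes A B C D :: "(real^'n) measure"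
  assumes fin: "finite_measure A" "finite_measure B" "finite_measure C" "finite_measure D"
    and sets: "sets A = sets borel" "sets B = sets borel" "sets C = sets borel" "sets D = sets borel"
    and box: "\<And>z. measure A {..z} + measure B {..z} = measure C {..z} + measure D {..z}"
begin

text \<open>Pi-lambda over the sets {..a}. Stating an identity of differences as a balance of sums
  keeps all four measures nonnegative. The complement step requires equal total mass, obtained by
  exhausting the space with such sets.\<close>

lemma measure_sum_eq_of_boxes:
  assumes S: "S \<in> sets borel"
  shows "measure A S + measure B S = measure C S + measure D S"
proof -
  define z :: "nat \<Rightarrow> real^'n" where "z n = (\<chi> j. real n)" for n
  have inc: "incseq (\<lambda>n. {..z n})"
    by (auto simp: incseq_def z_def less_eq_vec_def intro: order_trans)
  have un: "(\<Union>n. {..z n}) = UNIV"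
  proof safe
    fix x :: "real^'n"
    obtain m where "\<And>i. x $ i \<le> real m" using vec_le_real by blast
    then show "x \<in> (\<Union>n. {..z n})" by (auto simp: z_def less_eq_vec_def)
  qed auto
  have lim: "(\<lambda>n. measure K {..z n}) \<longlonglongrightarrow> measure K UNIV" if "finite_measure K" "sets K = sets borel" for K
  proof -
    have "(\<lambda>n. measure K {..z n}) \<longlonglongrightarrow> measure K (\<Union>n. {..z n})"
      by (rule finite_measure.finite_Lim_measure_incseq[OF that(1) _ inc]) (auto simp: that(2))
    then show ?thesis by (simp only: un)
  qed
  have total: "measure A UNIV + measure B UNIV = measure C UNIV + measure D UNIV"
  proof (rule LIMSEQ_unique)
    show "(\<lambda>n. measure A {..z n} + measure B {..z n}) \<longlonglongrightarrow> measure A UNIV + measure B UNIV"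
      by (intro tendsto_add lim fin sets)
    show "(\<lambda>n. measure A {..z n} + measure B {..z n}) \<longlonglongrightarrow> measure C UNIV + measure D UNIV"
      unfolding box by (intro tendsto_add lim fin sets)
  qed
  have mem: "S \<in> sigma_sets UNIV (range (\<lambda>a::real^'n. {..a}))"
    using S by (simp add: borel_eq_atMost)
  have stable: "Int_stable (range (\<lambda>a::real^'n. {..a}))"
  proof (rule Int_stableI_image)
    fix a b :: "real^'n"
    show "\<exists>c\<in>UNIV. {..a} \<inter> {..b} = {..c}" by (intro bexI[of _ "inf a b"]) auto
  qed
  have "range (\<lambda>a::real^'n. {..a}) \<subseteq> Pow UNIV" by simp
  from stable this mem show ?thesis
  proof (induction rule: sigma_sets_induct_disjoint)
    case (basic S)
    then show ?case using box by auto
  next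
    case empty
    then show ?case by simp
  next
    case (compl S)
    have "S \<in> sets borel" using compl(1) by (simp add: borel_eq_atMost)
    then have "measure K (UNIV - S) = measure K UNIV - measure K S" if "finite_measure K" "sets K = sets borel" for K
      using finite_measure.finite_measure_compl[OF that(1), of S] sets_eq_imp_space_eq[OF that(2)] that(2) by simp
    then show ?case using compl(2) total fin sets by simp
  next
    case (union F)
    have "range F \<subseteq> sets borel" using union(2) by (simp add: borel_eq_atMost)
    then have "(\<lambda>i. measure K (F i)) sums measure K (\<Union>i. F i)" if "finite_measure K" "sets K = sets borel" for K
      using finite_measure.finite_measure_UNION[OF that(1) _ union(1)] that(2) by simp
    then have "(\<lambda>i. measure A (F i) + measure B (F i)) sums (measure A (\<Union>i. F i) + measure B (\<Union>i. F i))"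
      and "(\<lambda>i. measure C (F i) + measure D (F i)) sums (measure C (\<Union>i. F i) + measure D (\<Union>i. F i))"
      using fin sets by (auto intro!: sums_add)
    then show ?case using union(3) sums_unique2 by simp
  qed
qed

lemma nn_integral_sum_eq_of_boxes:
  assumes f: "f \<in> borel_measurable borel"
  shows "(\<integral>\<^sup>+x. f x \<partial>A) + (\<integral>\<^sup>+x. f x \<partial>B) = (\<integral>\<^sup>+x. f x \<partial>C) + (\<integral>\<^sup>+x. f x \<partial>D)"
proof -
  have meas: "g \<in> borel_measurable A" "g \<in> borel_measurable B" "g \<in> borel_measurable C" "g \<in> borel_measurable D"
    if "g \<in> borel_measurable borel" for g :: "real^'n \<Rightarrow> ennreal"
    using that sets by (simp_all cong: measurable_cong_sets)
  show ?thesis using f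
  proof (induction f rule: borel_measurable_induct)
    case (cong f g)
    then have "f = g" by auto
    then show ?case using cong by simp
  next
    case (set S)
    then show ?case
      using measure_sum_eq_of_boxes[OF set] sets
      by (simp add: fin finite_measure.emeasure_eq_measure ennreal_plus[symmetric] del: ennreal_plus)
  next
    case (mult u c)
    then show ?case by (simp add: nn_integral_cmult meas distrib_left[symmetric])
  next
    case (add u v)
    have "(\<integral>\<^sup>+x. v x + u x \<partial>A) + (\<integral>\<^sup>+x. v x + u x \<partial>B) =
        ((\<integral>\<^sup>+x. v x \<partial>A) + (\<integral>\<^sup>+x. v x \<partial>B)) + ((\<integral>\<^sup>+x. u x \<partial>A) + (\<integral>\<^sup>+x. u x \<partial>B))"
      using add by (simp add: nn_integral_add meas ac_simps)
    also have "\<dots> = (\<integral>\<^sup>+x. v x + u x \<partial>C) + (\<integral>\<^sup>+x. v x + u x \<partial>D)"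
      using add by (simp only: add.IH) (simp add: nn_integral_add meas ac_simps)
    finally show ?case .
  next
    case (seq U)
    have inc: "incseq (\<lambda>i. \<integral>\<^sup>+x. U i x \<partial>K)" for K
      unfolding incseq_def
    proof (intro allI impI nn_integral_mono)
      fix m n :: nat and x assume "m \<le> n"
      then have "U m \<le> U n" using \<open>incseq U\<close> by (simp add: incseq_def)
      then show "U m x \<le> U n x" by (rule le_funD)
    qed
    have SUP: "(\<integral>\<^sup>+x. (SUP i. U i) x \<partial>K) = (SUP i. \<integral>\<^sup>+x. U i x \<partial>K)" if "sets K = sets borel" for K
      unfolding SUP_apply
      by (rule nn_integral_monotone_convergence_SUP[OF \<open>incseq U\<close>])
        (use seq(1) that in \<open>simp cong: measurable_cong_sets\<close>)
    show ?case unfolding SUP[OF sets(1)] SUP[OF sets(2)] SUP[OF sets(3)] SUP[OF sets(4)]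
      unfolding ennreal_SUP_add[OF inc inc, symmetric] seq.IH ..
  qed
qed

lemma integral_sum_eq_of_boxes:
  fixes \<phi> :: "real^'n \<Rightarrow> real"
  assumes \<phi>: "\<phi> \<in> borel_measurable borel" and bd: "\<And>x. \<bar>\<phi> x\<bar> \<le> K"
  shows "(\<integral>x. \<phi> x \<partial>A) + (\<integral>x. \<phi> x \<partial>B) = (\<integral>x. \<phi> x \<partial>C) + (\<integral>x. \<phi> x \<partial>D)"
proof -
  have int: "integrable E \<phi>" if "finite_measure E" "sets E = sets borel" for E
    by (rule finite_measure.integrable_const_bound[OF that(1), of _ K])
      (use \<phi> bd that in \<open>auto cong: measurable_cong_sets\<close>)
  \<comment> \<open>Adding the bound K makes the function nonnegative; the extra terms, K times the
    total masses, cancel because the masses balance.\<close>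
  have nn: "(\<integral>\<^sup>+x. ennreal (\<phi> x + K) \<partial>E) = ennreal ((\<integral>x. \<phi> x \<partial>E) + measure E UNIV * K)"
    and pos: "0 \<le> (\<integral>x. \<phi> x \<partial>E) + measure E UNIV * K"
    if "finite_measure E" "sets E = sets borel" for E
  proof -
    interpret finite_measure E by fact
    have "space E = UNIV" using sets_eq_imp_space_eq[OF that(2)] by simp
    have nneg: "0 \<le> \<phi> x + K" for x using bd[of x] by linarith
    have *: "(\<integral>x. \<phi> x + K \<partial>E) = (\<integral>x. \<phi> x \<partial>E) + measure E UNIV * K"
      using int[OF that] \<open>space E = UNIV\<close> by simp
    show "0 \<le> (\<integral>x. \<phi> x \<partial>E) + measure E UNIV * K" unfolding *[symmetric]
      by (rule Bochner_Integration.integral_nonneg) (rule nneg)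
    show "(\<integral>\<^sup>+x. ennreal (\<phi> x + K) \<partial>E) = ennreal ((\<integral>x. \<phi> x \<partial>E) + measure E UNIV * K)"
      unfolding *[symmetric] using int[OF that] nneg by (intro nn_integral_eq_integral) auto
  qed
  have "(\<integral>\<^sup>+x. ennreal (\<phi> x + K) \<partial>A) + (\<integral>\<^sup>+x. ennreal (\<phi> x + K) \<partial>B) =
      (\<integral>\<^sup>+x. ennreal (\<phi> x + K) \<partial>C) + (\<integral>\<^sup>+x. ennreal (\<phi> x + K) \<partial>D)"
    using \<phi> by (intro nn_integral_sum_eq_of_boxes) auto
  then have "(\<integral>x. \<phi> x \<partial>A) + measure A UNIV * K + ((\<integral>x. \<phi> x \<partial>B) + measure B UNIV * K) =
      (\<integral>x. \<phi> x \<partial>C) + measure C UNIV * K + ((\<integral>x. \<phi> x \<partial>D) + measure D UNIV * K)"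
    unfolding nn[OF fin(1) sets(1)] nn[OF fin(2) sets(2)] nn[OF fin(3) sets(3)] nn[OF fin(4) sets(4)]
    using pos[OF fin(1) sets(1)] pos[OF fin(2) sets(2)] pos[OF fin(3) sets(3)] pos[OF fin(4) sets(4)]
    by (simp add: ennreal_plus[symmetric] del: ennreal_plus)
  moreover have "measure A UNIV * K + measure B UNIV * K = measure C UNIV * K + measure D UNIV * K"
    using measure_sum_eq_of_boxes[of UNIV] by (simp add: distrib_right[symmetric])
  ultimately show ?thesis by linarith
qed

end

context max_stable_law
begin

section \<open>The flow identity for bounded measurable functions\<close>

definition jump :: "(real^'n \<Rightarrow> real) \<Rightarrow> real \<Rightarrow> real^'n \<Rightarrow> real^'n \<Rightarrow> real" where
  "jump h v x y = P v h (sup x y) - P v h x"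

lemma P_measurable [measurable (raw)]:
  assumes [measurable]: "h \<in> borel_measurable borel" "f \<in> borel_measurable K" "g \<in> borel_measurable K"
  shows "(\<lambda>p. P (f p) h (g p)) \<in> borel_measurable K"
  unfolding max_stable_semigroup_def by measurable

lemma jump_measurable [measurable (raw)]:
  assumes [measurable]: "h \<in> borel_measurable borel" "f \<in> borel_measurable K"
    "g \<in> borel_measurable K" "k \<in> borel_measurable K"
  shows "(\<lambda>p. jump h (f p) (g p) (k p)) \<in> borel_measurable K"
  unfolding jump_def by measurable

lemma coordinates_measurable:
  "(\<lambda>q. (fst (fst q), snd (fst q), Z (snd q)))
     \<in> measurable (\<rho> \<Otimes>\<^sub>M M) (borel \<Otimes>\<^sub>M (borel \<Otimes>\<^sub>M borel))"
proof (intro measurable_Pair)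
  show "(\<lambda>q. fst (fst q)) \<in> borel_measurable (\<rho> \<Otimes>\<^sub>M M)"
    by (rule measurable_compose[OF measurable_fst]) (use measurable_fst[of lborel \<mu>] in simp)
  show "(\<lambda>q. snd (fst q)) \<in> borel_measurable (\<rho> \<Otimes>\<^sub>M M)"
    by (rule measurable_compose[OF measurable_fst measurable_compose[OF measurable_snd measurable_\<mu>]]) simp
  show "(\<lambda>q. Z (snd q)) \<in> borel_measurable (\<rho> \<Otimes>\<^sub>M M)"
    by (rule measurable_compose[OF measurable_snd Z_measurable])
qed

text \<open>At y_j = 0 the summand is set to 0, the limit of exp (-s r^-\<alpha>) at 0, because
  \<open>0 powr _\<close> = 0 would give 1 and the marginal formula asks for a function vanishing at
  0.\<close>

lemma nn_integral_\<mu>_exp_finite: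
  assumes "s > 0"
  shows "(\<integral>\<^sup>+y. (\<Sum>j\<in>UNIV. ennreal (if y $ j = 0 then 0 else exp (- s * (y $ j) powr (- \<alpha>)))) \<partial>\<mu>) < \<infinity>"
proof -
  let ?f = "\<lambda>r. ennreal (if r = 0 then 0 else exp (- s * r powr (- \<alpha>)))"
  have "(\<integral>\<^sup>+y. (\<Sum>j\<in>UNIV. ?f (y $ j)) \<partial>\<mu>) = (\<Sum>j\<in>(UNIV::'n set). \<integral>\<^sup>+y. ?f (y $ j) \<partial>\<mu>)"
    by (rule nn_integral_sum) (auto intro!: measurable_\<mu>)
  also have "\<dots> = (\<Sum>j\<in>(UNIV::'n set). \<integral>\<^sup>+r. ?f r \<partial>ray_measure \<alpha>)"
    by (intro sum.cong refl nn_integral_\<mu>_marginal) auto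
  also have "(\<integral>\<^sup>+r. ?f r \<partial>ray_measure \<alpha>) = (\<integral>\<^sup>+r. ennreal (exp (- s * r powr (- \<alpha>))) \<partial>ray_measure \<alpha>)"
    by (intro nn_integral_cong) (auto simp: space_ray_measure)
  finally show ?thesis
    using nn_integral_ray_measure_finite[OF assms \<alpha>] by (simp add: ennreal_mult_less_top of_nat_less_top)
qed

text \<open>Both semigroup values are expectations of h (X \<sigma> Z), at \<sigma> = 0 and \<sigma>
  = \<tau>, and a jump y at time \<sigma> shows up at the final time as Y \<sigma> y. With A and C
  the two laws, and B and D the final state without and with an effective jump, the claim is the
  balance A + B = C + D, to be checked on boxes. Since \<tau> < u the scale s \<tau> is positive,
  which bounds the mass of effective jumps.\<close>

lemma semigroup_flow_bounded:
  fixes h :: "real^'n \<Rightarrow> real"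
  assumes h [measurable]: "h \<in> borel_measurable borel" and bd: "\<And>x. \<bar>h x\<bar> \<le> K"
    and x: "0 \<le> x" and \<tau>: "0 \<le> \<tau>" "\<tau> < u"
  shows "P u h x - P (u - \<tau>) h (decay \<tau> *\<^sub>R x) =
    (\<integral>p. indicator {0..\<tau>} (fst p) * jump h (u - fst p) (decay (fst p) *\<^sub>R x) (snd p) \<partial>\<rho>)"
proof -
  interpret W: pair_sigma_finite \<rho> M ..
  let ?Q = "\<rho> \<Otimes>\<^sub>M M"
  let ?BB = "borel \<Otimes>\<^sub>M (borel \<Otimes>\<^sub>M borel) :: (real \<times> (real^'n) \<times> (real^'n)) measure"
  define T where "T = (\<lambda>q::(real \<times> (real^'n)) \<times> 'a. (fst (fst q), snd (fst q), Z (snd q)))"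
  \<comment> \<open>s \<sigma> powr (1 / \<alpha>) is the weight for the remaining time u -
    \<sigma>. The decays over \<sigma> and over u - \<sigma> compose to the decay over u, so the
    first part of X does not involve \<sigma>.\<close>
  define s where "s \<sigma> = 1 - exp (\<sigma> - u)" for \<sigma>
  define X where "X \<sigma> w = sup (decay u *\<^sub>R x) (s \<sigma> powr (1 / \<alpha>) *\<^sub>R w)" for \<sigma> and w :: "real^'n"
  define Y where "Y \<sigma> y = decay (u - \<sigma>) *\<^sub>R y" for \<sigma> and y :: "real^'n"
  \<comment> \<open>Outside \<open>V\<close> a jump to \<open>Y\<close> leaves \<open>X\<close> unchanged; restricting to \<open>V\<close> makes the jump measures \<open>B\<close> and
    \<open>D\<close> below finite although \<open>\<mu>\<close> is not.\<close>
  define V where "V = {(\<sigma>, y, w). 0 \<le> \<sigma> \<and> \<sigma> \<le> \<tau> \<and> \<not> Y \<sigma> y \<le> X \<sigma> w}"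
  define F2 where "F2 = (\<lambda>(\<sigma>, y :: real^'n, w). X \<sigma> w)"
  define F4 where "F4 = (\<lambda>(\<sigma>, y, w). sup (X \<sigma> w) (Y \<sigma> y))"
  define FI where "FI z = (\<lambda>(\<sigma>, y, w). indicator {0..\<tau>} \<sigma> * indicator {y. \<not> Y \<sigma> y \<le> z} y * indicator {w. X \<sigma> w \<le> z} w :: ennreal)" for z
  have T [measurable]: "T \<in> measurable ?Q ?BB" unfolding T_def by (rule coordinates_measurable)
  have XZ [measurable]: "(\<lambda>\<omega>. X \<sigma> (Z \<omega>)) \<in> borel_measurable M" for \<sigma>
    unfolding X_def by measurable
  have Xm [measurable]: "(\<lambda>p. X (fst p) (snd (snd p))) \<in> borel_measurable ?BB"
    unfolding X_def s_def by measurable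
  have Ym [measurable]: "(\<lambda>p. Y (fst p) (fst (snd p))) \<in> borel_measurable ?BB"
    unfolding Y_def by measurable
  have F2 [measurable]: "F2 \<in> borel_measurable ?BB"
    unfolding F2_def case_prod_unfold by measurable
  have F4 [measurable]: "F4 \<in> borel_measurable ?BB"
    unfolding F4_def case_prod_unfold by measurable
  have FI [measurable]: "FI z \<in> borel_measurable ?BB" for z
    unfolding FI_def case_prod_unfold indicator_def mem_Collect_eq by measurable
  have V [measurable]: "V \<in> sets ?BB"
  proof -
    have "V = {p \<in> space ?BB. 0 \<le> fst p \<and> fst p \<le> \<tau> \<and> \<not> Y (fst p) (fst (snd p)) \<le> X (fst p) (snd (snd p))}"
      by (auto simp: V_def space_pair_measure)
    also have "\<dots> \<in> sets ?BB" by measurable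
    finally show ?thesis .
  qed
  have iter: "(\<integral>\<^sup>+q. G (T q) \<partial>?Q) = (\<integral>\<^sup>+\<sigma>. (\<integral>\<^sup>+y. (\<integral>\<^sup>+\<omega>. G (\<sigma>, y, Z \<omega>) \<partial>M) \<partial>\<mu>) \<partial>lborel)"
    if [measurable]: "G \<in> borel_measurable ?BB" for G
  proof -
    have "(\<integral>\<^sup>+q. G (T q) \<partial>?Q) = (\<integral>\<^sup>+p. (\<integral>\<^sup>+\<omega>. G (T (p, \<omega>)) \<partial>M) \<partial>\<rho>)"
      by (rule nn_integral_fst[symmetric]) measurable
    also have "\<dots> = (\<integral>\<^sup>+\<sigma>. (\<integral>\<^sup>+y. (\<integral>\<^sup>+\<omega>. G (T ((\<sigma>, y), \<omega>)) \<partial>M) \<partial>\<mu>) \<partial>lborel)"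
      by (rule S.nn_integral_fst[symmetric]) measurable
    finally show ?thesis by (simp add: T_def)
  qed
  have s\<tau>: "0 < s \<tau>" and s_ge: "\<sigma> \<le> \<tau> \<Longrightarrow> s \<tau> \<le> s \<sigma>" for \<sigma>
    using \<tau> by (auto simp: s_def)
  let ?S = "\<lambda>y::real^'n. \<Sum>j\<in>UNIV. ennreal (if y $ j = 0 then 0 else exp (- s \<tau> * (y $ j) powr (- \<alpha>)))"
  \<comment> \<open>An effective jump beats X in some coordinate, hence beats the scaled Z there,
    with probability at most exp (-s \<sigma> y_j^-\<alpha>); replacing s \<sigma> by the smaller s
    \<tau> makes the bound uniform in \<sigma>.\<close>
  have ZV: "(\<integral>\<^sup>+\<omega>. indicator V (\<sigma>, y, Z \<omega>) \<partial>M) \<le> indicator {0..\<tau>} \<sigma> *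
      ?S y"
    if y: "0 \<le> y" for \<sigma> y
  proof (cases "0 \<le> \<sigma> \<and> \<sigma> \<le> \<tau>")
    case False
    then have "indicator V (\<sigma>, y, Z \<omega>) = (0::ennreal)" for \<omega> by (auto simp: V_def)
    then show ?thesis by simp
  next
    case True
    have s\<sigma>: "0 < s \<sigma>" using s\<tau> s_ge[of \<sigma>] True by simp
    have yn: "0 \<le> y $ j" for j using y by (auto simp: less_eq_vec_def)
    let ?E = "\<lambda>j. {\<omega> \<in> space M. s \<sigma> powr (1 / \<alpha>) * Z \<omega> $ j \<le> y $ j}"
    have "(\<integral>\<^sup>+\<omega>. indicator V (\<sigma>, y, Z \<omega>) \<partial>M) \<le> (\<integral>\<^sup>+\<omega>. (\<Sum>j\<in>UNIV. indicator (?E j) \<omega>) \<partial>M)"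
    proof (rule nn_integral_mono)
      fix \<omega> assume \<omega>: "\<omega> \<in> space M"
      show "indicator V (\<sigma>, y, Z \<omega>) \<le> (\<Sum>j\<in>UNIV. indicator (?E j) \<omega> :: ennreal)"
      proof (cases "Y \<sigma> y \<le> X \<sigma> (Z \<omega>)")
        case False
        then obtain j where "X \<sigma> (Z \<omega>) $ j < Y \<sigma> y $ j" by (auto simp: less_eq_vec_def not_le)
        moreover have "Y \<sigma> y $ j \<le> 1 * y $ j"
          unfolding Y_def vector_scaleR_component real_scaleR_def using yn True \<tau> \<alpha>
          by (intro mult_right_mono) (auto intro!: divide_nonpos_pos)
        moreover have "s \<sigma> powr (1 / \<alpha>) * Z \<omega> $ j \<le> X \<sigma> (Z \<omega>) $ j" by (simp add: X_def)
        ultimately have "\<omega> \<in> ?E j" using \<omega> by simp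
        then have "indicator V (\<sigma>, y, Z \<omega>) \<le> (indicator (?E j) \<omega> :: ennreal)" by (simp add: indicator_def)
        also have "\<dots> \<le> (\<Sum>j\<in>UNIV. indicator (?E j) \<omega>)" by (rule member_le_sum) auto
        finally show ?thesis .
      qed (simp add: V_def)
    qed
    also have "\<dots> = (\<Sum>j\<in>UNIV. ennreal (prob (?E j)))"
      by (subst nn_integral_sum) (auto simp: emeasure_eq_measure)
    also have "\<dots> \<le> ?S y"
    proof (intro sum_mono ennreal_leI)
      fix j
      show "prob (?E j) \<le> (if y $ j = 0 then 0 else exp (- s \<tau> * (y $ j) powr (- \<alpha>)))"
      proof (cases "y $ j = 0")
        \<comment> \<open>Strict positivity of Z makes the event empty, in line with the value 0
          chosen at y_j = 0.\<close>
        case eq: True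
        have "0 < s \<sigma> powr (1 / \<alpha>) * Z \<omega> $ j" if "\<omega> \<in> space M" for \<omega>
          using s\<sigma> Z_pos[OF that] by simp
        then have E0: "?E j = {}" using eq by (auto simp: not_le)
        show ?thesis unfolding E0 using eq by simp
      next
        case ne: False
        have "prob (?E j) \<le> exp (- s \<sigma> * (y $ j) powr (- \<alpha>))"
          by (rule prob_scaled_Z_nth_le[OF yn s\<sigma>])
        also have "\<dots> \<le> exp (- s \<tau> * (y $ j) powr (- \<alpha>))"
          using s_ge[of \<sigma>] True by (simp add: mult_right_mono)
        finally show ?thesis using ne by simp
      qed
    qed
    finally show ?thesis using True by simp
  qed
  have fin: "(\<integral>\<^sup>+q. indicator V (T q) \<partial>?Q) < \<infinity>"
  proof -
    have "(\<integral>\<^sup>+q. indicator V (T q) \<partial>?Q) \<le> (\<integral>\<^sup>+\<sigma>. (\<integral>\<^sup>+y. indicator {0..\<tau>} \<sigma> * ?S y \<partial>\<mu>) \<partial>lborel)"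
      unfolding iter[OF borel_measurable_indicator[OF V]]
      by (intro nn_integral_mono ZV nonneg_space_\<mu>)
    also have "\<dots> = (\<integral>\<^sup>+\<sigma>. indicator {0..\<tau>} \<sigma> * (\<integral>\<^sup>+y. ?S y \<partial>\<mu>) \<partial>lborel)"
      by (intro nn_integral_cong nn_integral_cmult measurable_\<mu>) measurable
    also have "\<dots> = ennreal \<tau> * (\<integral>\<^sup>+y. ?S y \<partial>\<mu>)"
      using \<tau> by (subst nn_integral_multc) auto
    also have "\<dots> < \<infinity>" using nn_integral_\<mu>_exp_finite[OF s\<tau>] by (simp add: ennreal_mult_less_top)
    finally show ?thesis .
  qed
  define A where "A = distr M borel (\<lambda>\<omega>. X 0 (Z \<omega>))"
  define C where "C = distr M borel (\<lambda>\<omega>. X \<tau> (Z \<omega>))"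
  define QV where "QV = density ?Q (\<lambda>q. ennreal (indicator V (T q)))"
  define B where "B = distr QV borel (\<lambda>q. F2 (T q))"
  define D where "D = distr QV borel (\<lambda>q. F4 (T q))"
  have QV_sets [measurable_cong]: "sets QV = sets ?Q" by (simp add: QV_def)
  interpret QV: finite_measure QV
  proof
    have "emeasure QV (space QV) = (\<integral>\<^sup>+q. 1 \<partial>QV)" by simp
    also have "\<dots> = (\<integral>\<^sup>+q. indicator V (T q) \<partial>?Q)" unfolding QV_def by (subst nn_integral_density) (auto simp: ennreal_indicator)
    finally show "emeasure QV (space QV) \<noteq> \<infinity>" using fin by simp
  qed
  have fins: "finite_measure A" "finite_measure B" "finite_measure C" "finite_measure D"
    unfolding A_def B_def C_def D_def
    by (auto intro!: finite_measure_distr QV.finite_measure_distr)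
  have setss: "sets A = sets borel" "sets B = sets borel" "sets C = sets borel" "sets D = sets borel"
    by (auto simp: A_def B_def C_def D_def)
  define pX where "pX z \<sigma> = prob {\<omega> \<in> space M. X \<sigma> (Z \<omega>) \<le> z}" for z \<sigma>
  \<comment> \<open>The probability is 0 if some coordinate of z is not positive, since s \<sigma>
    and Z are positive, or if z is not above the deterministic part.\<close>
  have probX: "pX z \<sigma> =
      (if z \<in> pos_orthant \<and> decay u *\<^sub>R x \<le> z then exp (- s \<sigma> * \<Lambda> z) else 0)" if "\<sigma> \<le> \<tau>" for \<sigma> z
  proof -
    have s\<sigma>: "0 < s \<sigma>" using s\<tau> s_ge[of \<sigma>] that by simp
    show ?thesis
    proof (cases "z \<in> pos_orthant \<and> decay u *\<^sub>R x \<le> z")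
      case True
      then have "{\<omega> \<in> space M. X \<sigma> (Z \<omega>) \<le> z} = {\<omega> \<in> space M. s \<sigma> powr (1 / \<alpha>) *\<^sub>R Z \<omega> \<le> z}"
        by (auto simp: X_def)
      then show ?thesis using True prob_scaled_Z_le[OF _ s\<sigma>] by (simp add: pX_def)
    next
      case False
      have "\<not> X \<sigma> (Z \<omega>) \<le> z" if "\<omega> \<in> space M" for \<omega>
      proof
        assume le: "X \<sigma> (Z \<omega>) \<le> z"
        have "0 < z $ j" for j
        proof -
          have "0 < s \<sigma> powr (1 / \<alpha>) * Z \<omega> $ j" using s\<sigma> Z_pos[OF that] by simp
          also have "\<dots> \<le> X \<sigma> (Z \<omega>) $ j" by (simp add: X_def)
          also have "\<dots> \<le> z $ j" using le by (simp add: less_eq_vec_def)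
          finally show ?thesis .
        qed
        moreover have "decay u *\<^sub>R x \<le> z" using le by (simp add: X_def)
        ultimately show False using False by (simp add: pos_orthant_def)
      qed
      then have E0: "{\<omega> \<in> space M. X \<sigma> (Z \<omega>) \<le> z} = {}" by auto
      show ?thesis unfolding pX_def if_not_P[OF False] E0 by simp
    qed
  qed
  have box: "measure A {..z} + measure B {..z} = measure C {..z} + measure D {..z}" for z
  proof -
    let ?I = "\<integral>\<^sup>+q. FI z (T q) \<partial>?Q"
    have AC: "emeasure (distr M borel (\<lambda>\<omega>. X \<sigma> (Z \<omega>))) {..z} = ennreal (pX z \<sigma>)" for \<sigma>
      by (subst emeasure_distr) (auto simp: pX_def emeasure_eq_measure vimage_def Int_def conj_commute)
    have mA: "measure A {..z} = pX z 0" and mC: "measure C {..z} = pX z \<tau>"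
      using AC by (auto simp: A_def C_def measure_def pX_def)
    have BD': "emeasure (distr QV borel (\<lambda>q. F (T q))) {..z} = (\<integral>\<^sup>+q. indicator V (T q) * indicator {..z} (F (T q)) \<partial>?Q)"
      if [measurable]: "F \<in> borel_measurable ?BB" for F
    proof -
      let ?D = "distr QV borel (\<lambda>q. F (T q))"
      have "emeasure ?D {..z} = (\<integral>\<^sup>+v. indicator {..z} v \<partial>?D)" by simp
      also have "\<dots> = (\<integral>\<^sup>+q. indicator {..z} (F (T q)) \<partial>QV)" by (rule nn_integral_distr) measurable
      also have "\<dots> = (\<integral>\<^sup>+q. indicator V (T q) * indicator {..z} (F (T q)) \<partial>?Q)"
        unfolding QV_def by (subst nn_integral_density) (auto simp: ennreal_indicator)
      finally show ?thesis .
    qed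
    \<comment> \<open>A jump leads out of the box exactly when X lies below z and Y does not; then Y
      is not below X either, so the jump is automatically effective.\<close>
    have pt: "indicator V p * indicator {..z} (F2 p) = indicator V p * indicator {..z} (F4 p) + FI z p" for p
    proof (cases p)
      case (fields \<sigma> y w)
      show ?thesis
      proof (cases "X \<sigma> w \<le> z")
        case True
        then have "Y \<sigma> y \<le> X \<sigma> w \<Longrightarrow> Y \<sigma> y \<le> z" by (rule order_trans[rotated])
        with True show ?thesis by (auto simp: fields V_def F2_def F4_def FI_def indicator_def)
      qed (auto simp: fields F2_def F4_def FI_def)
    qed
    have BD: "emeasure B {..z} = emeasure D {..z} + ?I"
      unfolding B_def D_def BD'[OF F2] BD'[OF F4] by (subst nn_integral_add[symmetric]) (auto simp: pt)
    let ?R = "\<lambda>\<sigma>. indicator {0..\<tau>} \<sigma> * ((\<integral>\<^sup>+y. indicator {y. \<not> Y \<sigma> y \<le> z} y \<partial>\<mu>) * ennreal (pX z \<sigma>))"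
    have "?I = (\<integral>\<^sup>+\<sigma>. ?R \<sigma> \<partial>lborel)"
    proof (subst iter[OF FI], rule nn_integral_cong)
      fix \<sigma> :: real
      have 1: "(\<integral>\<^sup>+\<omega>. FI z (\<sigma>, y, Z \<omega>) \<partial>M) = indicator {0..\<tau>} \<sigma> * indicator {y. \<not> Y \<sigma> y \<le> z} y * ennreal (pX z \<sigma>)" for y
      proof -
        have "(\<integral>\<^sup>+\<omega>. FI z (\<sigma>, y, Z \<omega>) \<partial>M) = (\<integral>\<^sup>+\<omega>. indicator {0..\<tau>} \<sigma> * indicator {y. \<not> Y \<sigma> y \<le> z} y *
            indicator {\<omega> \<in> space M. X \<sigma> (Z \<omega>) \<le> z} \<omega> \<partial>M)"
          by (rule nn_integral_cong) (auto simp: FI_def indicator_def)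
        then show ?thesis by (subst (asm) nn_integral_cmult) (auto simp: emeasure_eq_measure pX_def)
      qed
      have [measurable]: "(\<lambda>y. indicator {y. \<not> Y \<sigma> y \<le> z} y :: ennreal) \<in> borel_measurable \<mu>"
        unfolding Y_def by (intro measurable_\<mu>) measurable
      show "(\<integral>\<^sup>+y. (\<integral>\<^sup>+\<omega>. FI z (\<sigma>, y, Z \<omega>) \<partial>M) \<partial>\<mu>) = ?R \<sigma>"
        unfolding 1 by (simp add: nn_integral_multc nn_integral_cmult mult.assoc)
    qed
    also have "\<dots> = ennreal (pX z \<tau> - pX z 0)"
    proof (cases "z \<in> pos_orthant \<and> decay u *\<^sub>R x \<le> z")
      case True
      have "(\<integral>\<^sup>+\<sigma>. ?R \<sigma> \<partial>lborel)
        = (\<integral>\<^sup>+\<sigma>. ennreal (exp (- s \<sigma> * \<Lambda> z) * (exp (\<sigma> - u) * \<Lambda> z)) * indicator {0..\<tau>} \<sigma> \<partial>lborel)"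
      proof (rule nn_integral_cong)
        fix \<sigma> :: real
        have "decay (u - \<sigma>) powr \<alpha> = exp (\<sigma> - u)" using \<alpha> by (simp add: powr_def)
        then have "(\<integral>\<^sup>+y. indicator {y. \<not> Y \<sigma> y \<le> z} y \<partial>\<mu>) = ennreal (exp (\<sigma> - u) * \<Lambda> z)"
          unfolding Y_def using nn_integral_\<mu>_scale_not_le[of z "decay (u - \<sigma>)"] True by simp
        then show "?R \<sigma> =
          ennreal (exp (- s \<sigma> * \<Lambda> z) * (exp (\<sigma> - u) * \<Lambda> z)) * indicator {0..\<tau>} \<sigma>"
          using True probX[of \<sigma> z] by (auto simp: indicator_def ennreal_mult'[symmetric] \<Lambda>_nonneg mult.commute)
      qed
      \<comment> \<open>The derivative of the box probability in \<sigma> is that probability times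
        exp (\<sigma> - u) \<Lambda> z, the rate of jumps leaving the box, so the integral is a
        difference of endpoint values.\<close>
      also have "\<dots> = ennreal (exp (- s \<tau> * \<Lambda> z) - exp (- s 0 * \<Lambda> z))"
      proof (rule nn_integral_FTC_Icc[where F="\<lambda>\<sigma>. exp (- s \<sigma> * \<Lambda> z)"])
        show "(\<lambda>\<sigma>. exp (- s \<sigma> * \<Lambda> z) * (exp (\<sigma> - u) * \<Lambda> z)) \<in> borel_measurable borel"
          unfolding s_def by measurable
        show "((\<lambda>\<sigma>. exp (- s \<sigma> * \<Lambda> z)) has_real_derivative exp (- s \<sigma> * \<Lambda> z) * (exp (\<sigma> - u) * \<Lambda> z)) (at \<sigma>)" for \<sigma>
          unfolding s_def by (auto intro!: derivative_eq_intros)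
      qed (use \<tau> \<Lambda>_nonneg in auto)
      finally show ?thesis using True probX[of \<tau> z] probX[of 0 z] \<tau> by simp
    next
      case False
      have p0: "pX z \<sigma> = 0" if "\<sigma> \<le> \<tau>" for \<sigma>
        using probX[OF that, of z] unfolding if_not_P[OF False] .
      then have z0: "indicator {0..\<tau>} \<sigma> * (m * ennreal (pX z \<sigma>)) = 0" for \<sigma> m
        by (cases "\<sigma> \<in> {0..\<tau>}") auto
      show ?thesis unfolding z0 p0[OF order_refl] p0[OF \<tau>(1)] by simp
    qed
    finally have I: "?I = ennreal (pX z \<tau> - pX z 0)" .
    have mono: "pX z 0 \<le> pX z \<tau>"
      using probX[of \<tau> z] probX[of 0 z] \<tau> s_ge[of 0] by (auto simp: \<Lambda>_nonneg mult_right_mono)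
    have "ennreal (measure B {..z}) = ennreal (measure D {..z}) + ennreal (measure C {..z} - measure A {..z})"
      using BD unfolding I mA mC finite_measure.emeasure_eq_measure[OF fins(2)] finite_measure.emeasure_eq_measure[OF fins(4)] .
    then have "measure B {..z} = measure D {..z} + (measure C {..z} - measure A {..z})"
      using mono by (simp add: mA mC ennreal_plus[symmetric] del: ennreal_plus)
    then show ?thesis by simp
  qed
  have sum_eq: "(\<integral>v. h v \<partial>A) + (\<integral>v. h v \<partial>B) = (\<integral>v. h v \<partial>C) + (\<integral>v. h v \<partial>D)"
    by (rule integral_sum_eq_of_boxes[OF fins setss box h bd])
  have hA: "(\<integral>v. h v \<partial>A) = P u h x"
    unfolding A_def by (subst integral_distr) (auto simp: max_stable_semigroup_def X_def s_def)
  have hC: "(\<integral>v. h v \<partial>C) = P (u - \<tau>) h (decay \<tau> *\<^sub>R x)"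
    unfolding C_def
    by (subst integral_distr) (auto simp: max_stable_semigroup_def X_def s_def mult_exp_exp diff_divide_distrib)
  let ?g = "\<lambda>q. indicator {0..\<tau>} (fst (fst q)) * (h (F4 (T q)) - h (F2 (T q)))"
  have intV: "integrable ?Q (\<lambda>q. indicator V (T q) :: real)"
    using fin by (intro integrableI_nonneg) (auto simp: ennreal_indicator)
  have boundV: "integrable ?Q (\<lambda>q. indicator V (T q) * h (F (T q)))"
    if [measurable]: "F \<in> borel_measurable ?BB" for F
    by (rule lintegrable_bound[OF integrable_mult_right[OF intV, of K]])
      (use bd in \<open>auto simp: abs_mult indicator_def intro!: AE_I2 intro: order_trans[OF _ abs_ge_self]\<close>)
  have hF: "(\<integral>v. h v \<partial>distr QV borel (\<lambda>q. F (T q))) = (\<integral>q. indicator V (T q) * h (F (T q)) \<partial>?Q)"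
    if [measurable]: "F \<in> borel_measurable ?BB" for F
    unfolding QV_def by (subst integral_distr) (auto simp: integral_density)
  have gV: "indicator V (T q) * h (F4 (T q)) - indicator V (T q) * h (F2 (T q)) = ?g q" for q
    by (cases q) (auto simp: T_def V_def F2_def F4_def indicator_def sup.absorb1)
  have intg: "integrable ?Q ?g"
    using lintegrable_diff[OF boundV[OF F4] boundV[OF F2]] unfolding gV .
  have "P u h x - P (u - \<tau>) h (decay \<tau> *\<^sub>R x) = (\<integral>q. ?g q \<partial>?Q)"
    using sum_eq lintegral_diff[OF boundV[OF F4] boundV[OF F2]]
    unfolding hA hC B_def D_def hF[OF F2] hF[OF F4] gV by linarith
  also have "\<dots> = (\<integral>p. (\<integral>\<omega>. ?g (p, \<omega>) \<partial>M) \<partial>\<rho>)"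
    by (rule W.integral_fst'[OF intg, symmetric])
  also have "\<dots> = (\<integral>p. indicator {0..\<tau>} (fst p) * jump h (u - fst p) (decay (fst p) *\<^sub>R x) (snd p) \<partial>\<rho>)"
  proof (intro lintegral_cong refl)
    fix p :: "real \<times> (real^'n)"
    obtain \<sigma> y where p: "p = (\<sigma>, y)" by (cases p)
    have int: "integrable M (\<lambda>\<omega>. h (f \<omega>))" if [measurable]: "f \<in> borel_measurable M" for f
      by (rule integrable_const_bound[of _ K]) (use bd in auto)
    \<comment> \<open>Decay distributes over the maximum, so starting from the state after the jump
      just joins Y to X.\<close>
    have 4: "P (u - \<sigma>) h (sup (decay \<sigma> *\<^sub>R x) y) = (\<integral>\<omega>. h (sup (X \<sigma> (Z \<omega>)) (Y \<sigma> y)) \<partial>M)"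
      unfolding max_stable_semigroup_def X_def Y_def s_def
      by (simp add: scaleR_sup_vec mult_exp_exp diff_divide_distrib sup_assoc sup_commute[of "_ *\<^sub>R y"] sup_left_commute[of "_ *\<^sub>R y"])
    have 2: "P (u - \<sigma>) h (decay \<sigma> *\<^sub>R x) = (\<integral>\<omega>. h (X \<sigma> (Z \<omega>)) \<partial>M)"
      unfolding max_stable_semigroup_def X_def s_def
      by (simp add: mult_exp_exp diff_divide_distrib)
    show "(\<integral>\<omega>. ?g (p, \<omega>) \<partial>M) = indicator {0..\<tau>} (fst p) * jump h (u - fst p) (decay (fst p) *\<^sub>R x) (snd p)"
      unfolding jump_def p fst_conv snd_conv 2 4 T_def F2_def F4_def
      by (simp add: int)
  qed
  finally show ?thesis .
qed

lemma lipschitz_abs_le: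
  assumes "lip_l1 h"
  shows "\<bar>h x - h y\<bar> \<le> dist1 x y"
  using assms by (auto simp: lip_l1_def)

lemma integrable_lipschitz_sup:
  fixes x :: "real^'n"
  assumes h: "lip_l1 h" and \<alpha>1: "\<alpha> > 1" and b: "0 \<le> b"
  shows "integrable M (\<lambda>\<omega>. h (sup x (b *\<^sub>R Z \<omega>)))"
proof -
  have [measurable]: "h \<in> borel_measurable borel" by (rule lip_l1_measurable[OF h])
  have "integrable M (\<lambda>\<omega>. \<bar>h 0\<bar> + (\<Sum>j\<in>UNIV. \<bar>x $ j\<bar> + b * Z \<omega> $ j))"
    by (intro Bochner_Integration.integrable_add lintegrable_sum integrable_mult_right integrable_Z_nth[OF \<alpha>1]) auto
  then show ?thesis
  proof (rule lintegrable_bound)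
    show "AE \<omega> in M. norm (h (sup x (b *\<^sub>R Z \<omega>))) \<le> norm (\<bar>h 0\<bar> + (\<Sum>j\<in>UNIV. \<bar>x $ j\<bar> + b * Z \<omega> $ j))"
    proof (rule AE_I2)
      fix \<omega> assume \<omega>: "\<omega> \<in> space M"
      have "\<bar>h (sup x (b *\<^sub>R Z \<omega>)) - h 0\<bar> \<le> (\<Sum>j\<in>UNIV. \<bar>sup x (b *\<^sub>R Z \<omega>) $ j - 0 $ j\<bar>)"
        by (rule lipschitz_abs_le[OF h])
      also have "\<dots> \<le> (\<Sum>j\<in>UNIV. \<bar>x $ j\<bar> + b * Z \<omega> $ j)"
      proof (rule sum_mono)
        fix j
        have "0 \<le> b * Z \<omega> $ j" using b Z_pos[OF \<omega>, of j] by simp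
        then show "\<bar>sup x (b *\<^sub>R Z \<omega>) $ j - 0 $ j\<bar> \<le> \<bar>x $ j\<bar> + b * Z \<omega> $ j" by (simp add: max_def abs_if)
      qed
      finally show "norm (h (sup x (b *\<^sub>R Z \<omega>))) \<le> norm (\<bar>h 0\<bar> + (\<Sum>j\<in>UNIV. \<bar>x $ j\<bar> + b * Z \<omega> $ j))"
        by simp
    qed
  qed measurable
qed

lemma integrable_lipschitz_Z:
  assumes h: "lip_l1 h" and \<alpha>1: "\<alpha> > 1"
  shows "integrable M (\<lambda>\<omega>. h (Z \<omega>))"
proof -
  have "sup 0 (1 *\<^sub>R Z \<omega>) = Z \<omega>" if "\<omega> \<in> space M" for \<omega>
    using Z_pos[OF that] by (simp add: vec_eq_iff less_imp_le max_def)
  then show ?thesis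
    using integrable_lipschitz_sup[OF h \<alpha>1, of 1 0]
    by (simp cong: Bochner_Integration.integrable_cong)
qed

lemma jump_bound:
  assumes h: "lip_l1 h" and \<alpha>1: "\<alpha> > 1" and x: "0 \<le> x" and y: "0 \<le> y" and v: "v > 0"
  shows "\<bar>jump h v x y\<bar> \<le> maj v y"
proof -
  have eq: "jump h v x y = (\<integral>\<omega>. h (path v (sup x y) \<omega>) - h (path v x \<omega>) \<partial>M)"
    unfolding jump_def max_stable_semigroup_def
    by (rule lintegral_diff[symmetric]) (auto intro!: integrable_lipschitz_sup h \<alpha>1)
  show ?thesis unfolding eq
    by (rule order_trans[OF integral_abs_bound semigroup_increment_bound(2)[OF h x y v]])
qed

text \<open>Treats c = 1 and c = -1 together: the majorant is integrated in u at fixed \<sigma> for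
  Fubini, and in \<sigma> at fixed u for dominated convergence.\<close>

lemma nn_integral_maj_affine:
  assumes c: "\<bar>c\<bar> = 1"
  shows "(\<integral>\<^sup>+u. ennreal (indicator {0<..} (c * (u - t)) * maj (c * (u - t)) y) \<partial>lborel) \<le> dom_total y"
proof -
  have cc: "c * c = 1" using c by (auto simp: abs_if split: if_splits)
  have "(\<integral>\<^sup>+u. ennreal (indicator {0<..} (c * (u - t)) * maj (c * (u - t)) y) \<partial>lborel)
      = (\<integral>\<^sup>+v. ennreal (indicator {0<..} (c * (t + c * v - t)) * maj (c * (t + c * v - t)) y) \<partial>lborel)"
    by (subst nn_integral_real_affine[where c=c and t=t]) (use c in auto)
  also have "\<dots> \<le> dom_total y"
    by (rule nn_integral_mono) (auto simp: indicator_def mult.assoc[symmetric] cc)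
  finally show ?thesis .
qed

lemma nn_integral_maj_shift:
  "(\<integral>\<^sup>+u. ennreal (indicator {\<sigma><..} u * maj (u - \<sigma>) y) \<partial>lborel) \<le> dom_total y"
  using nn_integral_maj_affine[of 1 \<sigma> y] by (simp add: indicator_def)

lemma nn_integral_maj_reflect:
  "(\<integral>\<^sup>+\<sigma>. ennreal (indicator {..<u} \<sigma> * maj (u - \<sigma>) y) \<partial>lborel) \<le> dom_total y"
  using nn_integral_maj_affine[of "- 1" u y] by (simp add: indicator_def)

lemma pair_measurable:
  "(\<lambda>p. (fst p, snd p)) \<in> measurable \<rho> (borel \<Otimes>\<^sub>M borel)"
  by (intro measurable_Pair measurable_compose[OF measurable_snd measurable_\<mu>]) (use measurable_fst[of lborel \<mu>] in auto)

lemma pair_measurable_fst [measurable (raw)]: "fst \<in> borel_measurable \<rho>"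
  and pair_measurable_snd [measurable (raw)]: "snd \<in> borel_measurable \<rho>"
  using measurable_compose[OF pair_measurable measurable_fst] measurable_compose[OF pair_measurable measurable_snd]
  by auto

lemma pair_space_nonneg: "p \<in> space \<rho> \<Longrightarrow> 0 \<le> snd p"
  by (auto simp: space_pair_measure nonneg_space_\<mu>)

lemma integrable_maj_reflect:
  assumes \<alpha>1: "\<alpha> > 1"
  shows "integrable \<rho> (\<lambda>p. indicator {..<u} (fst p) * maj (u - fst p) (snd p))"
proof (rule integrableI_nonneg)
  let ?f = "\<lambda>p. indicator {..<u} (fst p) * maj (u - fst p) (snd p)"
  show meas: "?f \<in> borel_measurable \<rho>"
    by measurable
  show "AE p in \<rho>. 0 \<le> ?f p"
    by (rule AE_I2) (auto intro!: mult_nonneg_nonneg maj_nonneg pair_space_nonneg)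
  have "(\<integral>\<^sup>+p. ennreal (?f p) \<partial>\<rho>)
      = (\<integral>\<^sup>+y. (\<integral>\<^sup>+\<sigma>. ennreal (indicator {..<u} \<sigma> * maj (u - \<sigma>) y) \<partial>lborel) \<partial>\<mu>)"
    using meas by (subst SY.nn_integral_snd[symmetric]) auto
  also have "\<dots> \<le> (\<integral>\<^sup>+y. dom_total y \<partial>\<mu>)"
    by (intro nn_integral_mono nn_integral_maj_reflect)
  also have "\<dots> < \<infinity>" by (rule nn_integral_maj_finite[OF \<alpha>1])
  finally show "(\<integral>\<^sup>+p. ennreal (?f p) \<partial>\<rho>) < \<infinity>" .
qed

section \<open>Truncation, and the flow identity for Lipschitz functions\<close>

definition clamp :: "(real^'n \<Rightarrow> real) \<Rightarrow> nat \<Rightarrow> real^'n \<Rightarrow> real" where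
  "clamp h n x = max (- real n) (min (real n) (h x))"

text \<open>Truncation does not increase the Lipschitz constant, so a single majorant serves every
  n.\<close>

lemma clamp_lipschitz: "lip_l1 h \<Longrightarrow> lip_l1 (clamp h n)"
  unfolding lip_l1_def clamp_def
proof (intro allI)
  fix x y assume *: "\<forall>x y. \<bar>h x - h y\<bar> \<le> dist1 x y"
  have "\<bar>max (- real n) (min (real n) (h x)) - max (- real n) (min (real n) (h y))\<bar> \<le> \<bar>h x - h y\<bar>" by linarith
  also have "\<dots> \<le> dist1 x y" using * by blast
  finally show "\<bar>max (- real n) (min (real n) (h x)) - max (- real n) (min (real n) (h y))\<bar> \<le> dist1 x y" .
qed

lemma clamp_bound: "\<bar>clamp h n x\<bar> \<le> real n" "\<bar>clamp h n x\<bar> \<le> \<bar>h x\<bar>"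
  by (auto simp: clamp_def)

lemma clamp_tendsto: "(\<lambda>n. clamp h n x) \<longlonglongrightarrow> h x"
proof (rule tendsto_eventually)
  obtain m where m: "\<bar>h x\<bar> \<le> real m" using real_arch_simple by blast
  show "\<forall>\<^sub>F n in sequentially. clamp h n x = h x"
    using eventually_ge_at_top[of m] by eventually_elim (use m in \<open>auto simp: clamp_def\<close>)
qed

lemma P_clamp_tendsto:
  assumes h: "lip_l1 h" and \<alpha>1: "\<alpha> > 1"
  shows "(\<lambda>n. P t (clamp h n) x) \<longlonglongrightarrow> P t h x"
  unfolding max_stable_semigroup_def
proof (rule integral_dominated_convergence)
  have [measurable]: "h \<in> borel_measurable borel" "clamp h n \<in> borel_measurable borel" for n
    by (intro lip_l1_measurable h clamp_lipschitz)+
  show "integrable M (\<lambda>\<omega>. \<bar>h (path t x \<omega>)\<bar>)"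
    by (intro integrable_abs integrable_lipschitz_sup h \<alpha>1) simp
qed (auto simp: clamp_tendsto clamp_bound intro!: measurable_compose[OF _ lip_l1_measurable] h clamp_lipschitz)

text \<open>The same \<open>Z\<close> drives the semigroup and the stationary value, so the
  difference is small pathwise and not only in expectation.\<close>

definition transient :: "(real^'n \<Rightarrow> real) \<Rightarrow> real^'n \<Rightarrow> 'a \<Rightarrow> real \<Rightarrow> real" where
  "transient h x \<omega> t = h (path t x \<omega>) - h (Z \<omega>)"

text \<open>\<open>enn2real\<close> sends an infinite total to 0, so bounds by this function are
  stated almost everywhere.\<close>

definition total_bound :: "real^'n \<Rightarrow> real" where
  "total_bound y = enn2real (dom_total y)"

definition jump_part :: "(real^'n \<Rightarrow> real) \<Rightarrow> real^'n \<Rightarrow> real" where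
  "jump_part h x = (\<integral>y. (sol h (sup x y) - sol h x) \<partial>\<mu>)"

text \<open>On [0,1] a power with exponent 1/\<alpha> \<le> 1 is at least its base.\<close>

lemma one_minus_weight_le:
  assumes "\<alpha> > 1" "0 \<le> t"
  shows "1 - weight t \<le> exp (- t)" "0 \<le> 1 - weight t"
proof -
  have "1 - exp (- t) \<le> weight t"
  proof (cases "t = 0")
    case False
    then have "(1 - exp (- t)) powr 1 \<le> weight t"
      using assms by (intro powr_mono') auto
    then show ?thesis using assms by simp
  qed simp
  then show "1 - weight t \<le> exp (- t)" by simp
  have "weight t \<le> 1 powr (1 / \<alpha>)" using assms by (intro powr_mono2) auto
  then show "0 \<le> 1 - weight t" by simp
qed

lemma integrable_decay: "integrable lborel (\<lambda>t. indicator {0..} t * decay t)"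
  using integrable_exp_tail[of "1 / \<alpha>"] \<alpha> by simp

lemma integrable_pair_mult:
  fixes f :: "'a \<Rightarrow> real" and g :: "real \<Rightarrow> real"
  assumes f: "integrable M f" and g: "integrable lborel g"
  shows "integrable (M \<Otimes>\<^sub>M lborel) (\<lambda>p. f (fst p) * g (snd p))"
proof -
  interpret Q: pair_sigma_finite M lborel ..
  have [measurable]: "f \<in> borel_measurable M" "g \<in> borel_measurable lborel" using f g by auto
  show ?thesis
    by (rule Q.Fubini_integrable) (use f g in \<open>auto simp: abs_mult\<close>)
qed

lemma integrable_decay_pair: "integrable (M \<Otimes>\<^sub>M lborel) (\<lambda>p. indicator {0..} (snd p) * decay (snd p))"
  using integrable_pair_mult[OF _ integrable_decay, of "\<lambda>_. 1"] by simp

abbreviation tr :: "(real^'n \<Rightarrow> real) \<Rightarrow> real^'n \<Rightarrow> 'a \<times> real \<Rightarrow> real" where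
  "tr h x p \<equiv> indicator {0..} (snd p) * transient h x (fst p) (snd p)"

lemma transient_measurable [measurable (raw)]:
  assumes [measurable]: "h \<in> borel_measurable borel" "f \<in> measurable K M" "g \<in> borel_measurable K"
  shows "(\<lambda>p. transient h x (f p) (g p)) \<in> borel_measurable K"
  unfolding transient_def by measurable

lemma lipschitz_sup_increment:
  assumes h: "lip_l1 h"
  shows "\<bar>h (sup (decay t *\<^sub>R x) w) - h (sup (decay t *\<^sub>R y) w)\<bar> \<le> decay t * dist1 x y"
proof -
  have "\<bar>h (sup (decay t *\<^sub>R x) w) - h (sup (decay t *\<^sub>R y) w)\<bar> \<le> (\<Sum>j\<in>UNIV. \<bar>sup (decay t *\<^sub>R x) w $ j - sup (decay t *\<^sub>R y) w $ j\<bar>)"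
    by (rule lipschitz_abs_le[OF h])
  also have "\<dots> \<le> (\<Sum>j\<in>UNIV. decay t * \<bar>x $ j - y $ j\<bar>)"
  proof (rule sum_mono)
    fix j
    have "\<bar>max (decay t * x $ j) q - max (decay t * y $ j) q\<bar> \<le> \<bar>decay t * x $ j - decay t * y $ j\<bar>" for q
      by linarith
    also have "\<dots> = decay t * \<bar>x $ j - y $ j\<bar>"
      by (simp add: right_diff_distrib[symmetric] abs_mult)
    finally show "\<bar>sup (decay t *\<^sub>R x) w $ j - sup (decay t *\<^sub>R y) w $ j\<bar> \<le> decay t * \<bar>x $ j - y $ j\<bar>"
      by simp
  qed
  finally show ?thesis by (simp add: sum_distrib_left)
qed

lemma total_bound_measurable: "total_bound \<in> borel_measurable \<mu>"
  unfolding total_bound_def by (rule measurable_\<mu>) measurable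

lemma maj_finite_AE:
  assumes \<alpha>1: "\<alpha> > 1"
  shows "AE y in \<mu>. dom_total y \<noteq> \<infinity>"
  by (rule nn_integral_PInf_AE) (use nn_integral_maj_finite[OF \<alpha>1] in \<open>auto intro!: measurable_\<mu>\<close>)

lemma integrable_total_bound:
  assumes \<alpha>1: "\<alpha> > 1"
  shows "integrable \<mu> total_bound"
proof (rule integrableI_nonneg[OF total_bound_measurable])
  show "AE y in \<mu>. 0 \<le> total_bound y" by (simp add: total_bound_def)
  have "(\<integral>\<^sup>+y. ennreal (total_bound y) \<partial>\<mu>) = (\<integral>\<^sup>+y. dom_total y \<partial>\<mu>)"
    by (rule nn_integral_cong_AE) (use maj_finite_AE[OF \<alpha>1] in eventually_elim, simp add: total_bound_def less_top)
  then show "(\<integral>\<^sup>+y. ennreal (total_bound y) \<partial>\<mu>) < \<infinity>" using nn_integral_maj_finite[OF \<alpha>1] by simp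
qed

lemma decay_nonneg: "0 \<le> x \<Longrightarrow> 0 \<le> decay \<sigma> *\<^sub>R x" for x :: "real^'n"
  by (auto simp: less_eq_vec_def)

lemma triple_measurable:
  "(\<lambda>q. (fst q, fst (snd q), snd (snd q)))
     \<in> measurable (lborel \<Otimes>\<^sub>M \<rho>) (borel \<Otimes>\<^sub>M (borel \<Otimes>\<^sub>M borel))"
proof (intro measurable_Pair)
  show "fst \<in> borel_measurable (lborel \<Otimes>\<^sub>M \<rho>)"
    using measurable_fst[of lborel \<rho>] by simp
  show "(\<lambda>q. fst (snd q)) \<in> borel_measurable (lborel \<Otimes>\<^sub>M \<rho>)"
    by (rule measurable_compose[OF measurable_snd pair_measurable_fst])
  show "(\<lambda>q. snd (snd q)) \<in> borel_measurable (lborel \<Otimes>\<^sub>M \<rho>)"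
    by (rule measurable_compose[OF measurable_snd pair_measurable_snd])
qed

text \<open>Strictly below u because \<open>jump_bound\<close> asks for a positive remaining time.
  The set is {0..\<tau>} if \<tau> < u and {0..<u} otherwise, so that one kernel can be integrated
  over all u.\<close>

definition flow_time :: "real \<Rightarrow> real \<Rightarrow> real set" where
  "flow_time \<tau> u = {\<sigma>. 0 \<le> \<sigma> \<and> \<sigma> \<le> \<tau> \<and> \<sigma> < u}"

lemma P_0:
  assumes "0 \<le> x"
  shows "P 0 h x = h x"
proof -
  have "sup x 0 = x" using assms by (simp add: sup.absorb1)
  then show ?thesis by (simp add: max_stable_semigroup_def prob_space)
qed

lemma flow_jump_bound:
  assumes "lip_l1 h" "\<alpha> > 1" "0 \<le> x" and A: "A \<subseteq> {..<u}"
  shows "AE p in \<rho>. norm (indicator A (fst p) * jump h (u - fst p) (decay (fst p) *\<^sub>R x) (snd p))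
    \<le> indicator {..<u} (fst p) * maj (u - fst p) (snd p)"
proof (rule AE_I2)
  fix p :: "real \<times> (real^'n)" assume p: "p \<in> space \<rho>"
  note y = pair_space_nonneg[OF p]
  show "norm (indicator A (fst p) * jump h (u - fst p) (decay (fst p) *\<^sub>R x) (snd p))
    \<le> indicator {..<u} (fst p) * maj (u - fst p) (snd p)"
    using jump_bound[OF assms(1,2) decay_nonneg[OF assms(3)] y, of "u - fst p" "fst p"] maj_nonneg[OF y] A
    by (auto simp: indicator_def)
qed

context
  fixes h :: "real^'n \<Rightarrow> real"
  assumes h: "lip_l1 h" and \<alpha>1: "\<alpha> > 1"
begin

lemma h_measurable [measurable]: "h \<in> borel_measurable borel"
  by (rule lip_l1_measurable[OF h])

lemma semigroup_flow_strict:
  assumes x: "0 \<le> x" and \<tau>: "0 \<le> \<tau>" "\<tau> < u"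
  shows "P u h x - P (u - \<tau>) h (decay \<tau> *\<^sub>R x) =
    (\<integral>p. indicator {0..\<tau>} (fst p) * jump h (u - fst p) (decay (fst p) *\<^sub>R x) (snd p) \<partial>\<rho>)"
proof (rule LIMSEQ_unique)
  have [measurable]: "clamp h n \<in> borel_measurable borel" for n
    by (intro lip_l1_measurable h clamp_lipschitz)
  let ?J = "\<lambda>h (p :: real \<times> (real^'n)). indicator {0..\<tau>} (fst p) * jump h (u - fst p) (decay (fst p) *\<^sub>R x) (snd p)"
  show "(\<lambda>n. P u (clamp h n) x - P (u - \<tau>) (clamp h n) (decay \<tau> *\<^sub>R x)) \<longlonglongrightarrow> P u h x - P (u - \<tau>) h (decay \<tau> *\<^sub>R x)"
    by (intro tendsto_diff P_clamp_tendsto h \<alpha>1)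
  have eq: "P u (clamp h n) x - P (u - \<tau>) (clamp h n) (decay \<tau> *\<^sub>R x) = (\<integral>p. ?J (clamp h n) p \<partial>\<rho>)" for n
    by (rule semigroup_flow_bounded[OF _ clamp_bound(1) x \<tau>]) measurable
  show "(\<lambda>n. P u (clamp h n) x - P (u - \<tau>) (clamp h n) (decay \<tau> *\<^sub>R x)) \<longlonglongrightarrow> (\<integral>p. ?J h p \<partial>\<rho>)"
    unfolding eq
  proof (rule integral_dominated_convergence[OF _ _ integrable_maj_reflect[OF \<alpha>1, of u]])
    show "AE p in \<rho>. (\<lambda>n. ?J (clamp h n) p) \<longlonglongrightarrow> ?J h p"
      unfolding jump_def by (intro AE_I2 tendsto_intros P_clamp_tendsto h \<alpha>1)
    show "AE p in \<rho>. norm (?J (clamp h n) p) \<le> indicator {..<u} (fst p) * maj (u - fst p) (snd p)" for n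
      by (rule flow_jump_bound[OF clamp_lipschitz[OF h] \<alpha>1 x]) (use \<tau> in auto)
  qed measurable
qed

text \<open>Joining b Z moves a nonnegative point by at most b Z_j in coordinate j. This is the
  short-time estimate behind the limit in \<open>semigroup_flow_total\<close>.\<close>

lemma expected_lipschitz_sup:
  assumes x: "0 \<le> x" and b: "0 \<le> b"
  shows "\<bar>(\<integral>\<omega>. h (sup x (b *\<^sub>R Z \<omega>)) \<partial>M) - h x\<bar> \<le> b * (\<Sum>j\<in>UNIV. \<integral>\<omega>. Z \<omega> $ j \<partial>M)"
proof -
  have int: "integrable M (\<lambda>\<omega>. h (sup x (b *\<^sub>R Z \<omega>)) - h x)"
    by (rule lintegrable_diff[OF integrable_lipschitz_sup[OF h \<alpha>1 b]]) simp
  have "(\<integral>\<omega>. h (sup x (b *\<^sub>R Z \<omega>)) \<partial>M) - h x = (\<integral>\<omega>. h (sup x (b *\<^sub>R Z \<omega>)) - h x \<partial>M)"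
    by (subst lintegral_diff[OF integrable_lipschitz_sup[OF h \<alpha>1 b]]) (auto simp: prob_space)
  also have "\<bar>\<dots>\<bar> \<le> (\<integral>\<omega>. \<bar>h (sup x (b *\<^sub>R Z \<omega>)) - h x\<bar> \<partial>M)" by (rule integral_abs_bound)
  also have "\<dots> \<le> (\<integral>\<omega>. (\<Sum>j\<in>UNIV. b * Z \<omega> $ j) \<partial>M)"
  proof (rule integral_mono)
    show "integrable M (\<lambda>\<omega>. \<Sum>j\<in>UNIV. b * Z \<omega> $ j)"
      by (intro lintegrable_sum integrable_mult_right integrable_Z_nth \<alpha>1)
    fix \<omega> assume \<omega>: "\<omega> \<in> space M"
    have "\<bar>h (sup x (b *\<^sub>R Z \<omega>)) - h x\<bar> \<le> (\<Sum>j\<in>UNIV. \<bar>sup x (b *\<^sub>R Z \<omega>) $ j - x $ j\<bar>)"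
      by (rule lipschitz_abs_le[OF h])
    also have "\<dots> \<le> (\<Sum>j\<in>UNIV. b * Z \<omega> $ j)"
    proof (rule sum_mono)
      fix j
      have "0 \<le> b * Z \<omega> $ j" using b Z_pos[OF \<omega>, of j] by simp
      moreover have "0 \<le> x $ j" using x by (simp add: less_eq_vec_def)
      ultimately show "\<bar>sup x (b *\<^sub>R Z \<omega>) $ j - x $ j\<bar> \<le> b * Z \<omega> $ j" by (simp add: max_def)
    qed
    finally show "\<bar>h (sup x (b *\<^sub>R Z \<omega>)) - h x\<bar> \<le> (\<Sum>j\<in>UNIV. b * Z \<omega> $ j)" .
  qed (use int in auto)
  also have "\<dots> = b * (\<Sum>j\<in>UNIV. \<integral>\<omega>. Z \<omega> $ j \<partial>M)"
    by (subst Bochner_Integration.integral_sum) (auto intro!: integrable_mult_right integrable_Z_nth \<alpha>1 simp: sum_distrib_left)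
  finally show ?thesis .
qed

text \<open>At \<tau> = u the scale that bounded the mass of effective jumps is 0, so this case is a
  limit of \<tau> = u - v with v -> 0; the semigroup over the short time v converges by the first
  moment of Z.\<close>

lemma semigroup_flow_total:
  assumes x: "0 \<le> x" and u: "0 < u"
  shows "P u h x - h (decay u *\<^sub>R x) =
    (\<integral>p. indicator {0..<u} (fst p) * jump h (u - fst p) (decay (fst p) *\<^sub>R x) (snd p) \<partial>\<rho>)"
proof (rule LIMSEQ_unique)
  let ?J = "\<lambda>p :: real \<times> (real^'n). jump h (u - fst p) (decay (fst p) *\<^sub>R x) (snd p)"
  \<comment> \<open>The index shift gives 0 < v k \<le> u, so that u - v k is an admissible time
    below u.\<close>
  define v where "v k = u / real (Suc k)" for k
  have v: "0 < v k" "v k \<le> u" for k using u by (auto simp: v_def field_simps)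
  have v0: "v \<longlonglongrightarrow> 0" unfolding v_def using LIMSEQ_Suc[OF lim_const_over_n[of u]] by simp
  have Pv: "P (v k) h (decay (u - v k) *\<^sub>R x) = (\<integral>\<omega>. h (sup (decay u *\<^sub>R x) (weight (v k) *\<^sub>R Z \<omega>)) \<partial>M)" for k
    unfolding max_stable_semigroup_def by (simp add: mult_exp_exp diff_divide_distrib)
  have w0: "(\<lambda>k. weight (v k)) \<longlonglongrightarrow> 0"
  proof (rule tendsto_zero_powrI[OF _ tendsto_const])
    have "(\<lambda>k. 1 - exp (- v k)) \<longlonglongrightarrow> 1 - exp (- 0)" by (intro tendsto_intros v0)
    then show "(\<lambda>k. 1 - exp (- v k)) \<longlonglongrightarrow> 0" by simp
  qed (use v \<alpha> in \<open>auto intro!: always_eventually less_imp_le\<close>)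
  have "(\<lambda>k. P (v k) h (decay (u - v k) *\<^sub>R x)) \<longlonglongrightarrow> h (decay u *\<^sub>R x)"
  proof (rule LIM_zero_cancel, rule Lim_null_comparison)
    have "0 \<le> decay u *\<^sub>R x" using x by (auto simp: less_eq_vec_def)
    then show "\<forall>\<^sub>F k in sequentially. norm (P (v k) h (decay (u - v k) *\<^sub>R x) - h (decay u *\<^sub>R x))
        \<le> weight (v k) * (\<Sum>j\<in>UNIV. \<integral>\<omega>. Z \<omega> $ j \<partial>M)"
      unfolding Pv by (intro always_eventually allI) (auto intro: expected_lipschitz_sup)
    show "(\<lambda>k. weight (v k) * (\<Sum>j\<in>UNIV. \<integral>\<omega>. Z \<omega> $ j \<partial>M)) \<longlonglongrightarrow> 0"
      using tendsto_mult_right[OF w0] by simp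
  qed
  then show "(\<lambda>k. P u h x - P (v k) h (decay (u - v k) *\<^sub>R x)) \<longlonglongrightarrow> P u h x - h (decay u *\<^sub>R x)"
    by (intro tendsto_intros)
  have eq: "P u h x - P (v k) h (decay (u - v k) *\<^sub>R x) =
      (\<integral>p. indicator {0..u - v k} (fst p) * ?J p \<partial>\<rho>)" for k
    using semigroup_flow_strict[OF x, of "u - v k" u] v[of k] by simp
  show "(\<lambda>k. P u h x - P (v k) h (decay (u - v k) *\<^sub>R x)) \<longlonglongrightarrow> (\<integral>p. indicator {0..<u} (fst p) * ?J p \<partial>\<rho>)"
    unfolding eq
  proof (rule integral_dominated_convergence[OF _ _ integrable_maj_reflect[OF \<alpha>1, of u]])
    have "(\<lambda>k. indicator {0..u - v k} \<sigma> :: real) \<longlonglongrightarrow> indicator {0..<u} \<sigma>" for \<sigma>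
    proof (rule tendsto_eventually)
      show "\<forall>\<^sub>F k in sequentially. indicator {0..u - v k} \<sigma> = (indicator {0..<u} \<sigma> :: real)"
      proof (cases "\<sigma> < u")
        case True
        then have "\<forall>\<^sub>F k in sequentially. v k < u - \<sigma>" by (intro order_tendstoD(2)[OF v0]) simp
        then show ?thesis by eventually_elim (use True in \<open>auto simp: indicator_def\<close>)
      next
        case False
        then have "indicator {0..u - v k} \<sigma> = (indicator {0..<u} \<sigma> :: real)" for k
          using v(1)[of k] by (auto simp: indicator_def)
        then show ?thesis by simp
      qed
    qed
    then show "AE p in \<rho>. (\<lambda>k. indicator {0..u - v k} (fst p) * ?J p) \<longlonglongrightarrow> indicator {0..<u} (fst p) * ?J p"
      by (intro AE_I2 tendsto_mult tendsto_const)
    show "AE p in \<rho>. norm (indicator {0..u - v k} (fst p) * ?J p) \<le> indicator {..<u} (fst p) * maj (u - fst p) (snd p)" for k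
      by (rule flow_jump_bound[OF h \<alpha>1 x]) (use v[of k] in auto)
  qed measurable
qed

text \<open>For u \<le> \<tau> the time u is used up first and only P_0 h remains, hence the
  minimum.\<close>

lemma semigroup_flow:
  assumes x: "0 \<le> x" and \<tau>: "0 \<le> \<tau>" and u: "0 < u"
  shows "P u h x - P (u - min u \<tau>) h (decay (min u \<tau>) *\<^sub>R x) =
    (\<integral>p. indicator (flow_time \<tau> u) (fst p) * jump h (u - fst p) (decay (fst p) *\<^sub>R x) (snd p) \<partial>\<rho>)"
proof (cases "\<tau> < u")
  case True
  then have "flow_time \<tau> u = {0..\<tau>}" by (auto simp: flow_time_def)
  then show ?thesis using semigroup_flow_strict[OF x \<tau> True] True by simp
next
  case False
  then have "flow_time \<tau> u = {0..<u}" by (auto simp: flow_time_def)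
  moreover have "0 \<le> decay u *\<^sub>R x" using x by (auto simp: less_eq_vec_def)
  ultimately show ?thesis using semigroup_flow_total[OF x u] False by (simp add: P_0)
qed

section \<open>The Stein solution of a Lipschitz function\<close>

text \<open>The starting point enters with decay exp (-t/\<alpha>), the missing weight of Z with exp
  (-t). Both are integrable in t and Z has a first moment, which gives joint integrability.\<close>

lemma transient_bound:
  assumes x: "0 \<le> x" and t: "0 \<le> t" and \<omega>: "\<omega> \<in> space M"
  shows "\<bar>transient h x \<omega> t\<bar> \<le> (\<Sum>j\<in>UNIV. decay t * x $ j + exp (- t) * Z \<omega> $ j)"
proof -
  have "\<bar>transient h x \<omega> t\<bar> \<le> (\<Sum>j\<in>UNIV. \<bar>(path t x \<omega>) $ j - Z \<omega> $ j\<bar>)"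
    unfolding transient_def by (rule lipschitz_abs_le[OF h])
  also have "\<dots> \<le> (\<Sum>j\<in>UNIV. decay t * x $ j + exp (- t) * Z \<omega> $ j)"
  proof (rule sum_mono)
    fix j
    have a: "0 \<le> decay t * x $ j" using x by (simp add: less_eq_vec_def)
    have "(1 - weight t) * Z \<omega> $ j \<le> exp (- t) * Z \<omega> $ j" "0 \<le> (1 - weight t) * Z \<omega> $ j"
      using one_minus_weight_le[OF \<alpha>1 t] Z_pos[OF \<omega>, of j] by (auto intro: mult_right_mono)
    then have b: "Z \<omega> $ j - weight t * Z \<omega> $ j \<le> exp (- t) * Z \<omega> $ j" "0 \<le> Z \<omega> $ j - weight t * Z \<omega> $ j"
      by (auto simp: algebra_simps)
    have *: "\<bar>max p q - r\<bar> \<le> p + e" if "0 \<le> p" "r - q \<le> e" "0 \<le> r - q" "0 \<le> r" for p q r e :: real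
      using that by (auto simp: max_def abs_if)
    show "\<bar>(path t x \<omega>) $ j - Z \<omega> $ j\<bar> \<le> decay t * x $ j + exp (- t) * Z \<omega> $ j"
      using *[OF a b less_imp_le[OF Z_pos[OF \<omega>]]] by simp
  qed
  finally show ?thesis .
qed

lemma integral_transient:
  shows "integrable M (\<lambda>\<omega>. transient h x \<omega> t)"
    and "(\<integral>\<omega>. transient h x \<omega> t \<partial>M) = integrand h x t"
  unfolding transient_def stein_integrand_def max_stable_semigroup_def
  by (rule lintegrable_diff lintegral_diff integrable_lipschitz_sup h \<alpha>1
      integrable_lipschitz_Z | simp)+

lemma integrable_transient_pair:
  assumes x: "0 \<le> x"
  shows "integrable (M \<Otimes>\<^sub>M lborel) (tr h x)"
proof -
  let ?B = "\<lambda>p::'a \<times> real. \<Sum>j\<in>UNIV. indicator {0..} (snd p) * decay (snd p) * x $ j + Z (fst p) $ j * (indicator {0..} (snd p) * exp (- snd p))"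
  have "integrable (M \<Otimes>\<^sub>M lborel) ?B"
  proof (intro lintegrable_sum Bochner_Integration.integrable_add integrable_mult_left)
    show "integrable (M \<Otimes>\<^sub>M lborel) (\<lambda>p. indicator {0..} (snd p) * decay (snd p))"
      by (rule integrable_decay_pair)
    show "integrable (M \<Otimes>\<^sub>M lborel) (\<lambda>p. Z (fst p) $ j * (indicator {0..} (snd p) * exp (- snd p)))" for j
      using integrable_pair_mult[OF integrable_Z_nth[OF \<alpha>1] integrable_exp_neg] .
  qed
  then show ?thesis
  proof (rule lintegrable_bound)
    show "AE p in M \<Otimes>\<^sub>M lborel. norm (tr h x p) \<le> norm (?B p)"
    proof (rule AE_I2)
      fix p :: "'a \<times> real" assume "p \<in> space (M \<Otimes>\<^sub>M lborel)"
      then have "fst p \<in> space M" by (auto simp: space_pair_measure)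
      then show "norm (tr h x p) \<le> norm (?B p)"
        using transient_bound[OF x, of "snd p" "fst p"]
        by (auto simp: indicator_def mult.commute[of "Z _ $ _"] intro: order_trans[OF _ abs_ge_self])
    qed
  qed measurable
qed

text \<open>As a single integral over outcomes and time, the solution can later be differentiated
  pathwise.\<close>

lemma sol_transient:
  assumes x: "0 \<le> x"
  shows "set_integrable lborel {0..} (integrand h x)"
    and "sol h x = - (\<integral>p. tr h x p \<partial>(M \<Otimes>\<^sub>M lborel))"
proof -
  interpret Q: pair_sigma_finite M lborel ..
  note int = integrable_transient_pair[OF assms]
  have eq: "(\<integral>\<omega>. indicator {0..} t * transient h x \<omega> t \<partial>M) = indicator {0..} t *\<^sub>R integrand h x t" for t
    using integral_transient[of x t] by simp
  have int': "integrable (M \<Otimes>\<^sub>M lborel) (\<lambda>(\<omega>, t). indicator {0..} t * transient h x \<omega> t)"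
    using int by (simp add: case_prod_unfold)
  show "set_integrable lborel {0..} (integrand h x)"
    using Q.integrable_snd[OF int'] unfolding set_integrable_def eq .
  show "sol h x = - (\<integral>p. tr h x p \<partial>(M \<Otimes>\<^sub>M lborel))"
    using Q.integral_snd[OF int'] unfolding stein_sol_def set_lebesgue_integral_def eq by (simp add: case_prod_unfold)
qed

lemma P_lipschitz:
  shows "\<bar>P t h x - P t h y\<bar> \<le> decay t * dist1 x y"
proof -
  let ?f = "\<lambda>x \<omega>. h (path t x \<omega>)"
  have int: "integrable M (?f x)" for x by (rule integrable_lipschitz_sup[OF h \<alpha>1]) simp
  have eq: "P t h x - P t h y = (\<integral>\<omega>. ?f x \<omega> - ?f y \<omega> \<partial>M)"
    unfolding max_stable_semigroup_def by (rule lintegral_diff[symmetric, OF int int])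
  have "(\<integral>\<omega>. \<bar>?f x \<omega> - ?f y \<omega>\<bar> \<partial>M) \<le> (\<integral>\<omega>. decay t * dist1 x y \<partial>M)"
  proof (rule integral_mono)
    fix \<omega>
    show "\<bar>?f x \<omega> - ?f y \<omega>\<bar> \<le> decay t * dist1 x y"
      by (rule lipschitz_sup_increment[OF h])
  qed (use int in auto)
  also have "\<dots> = decay t * dist1 x y" by (simp add: prob_space)
  finally show ?thesis unfolding eq by (rule order_trans[OF integral_abs_bound])
qed

lemma sol_diff:
  assumes x: "0 \<le> x" and y: "0 \<le> y"
  shows "integrable lborel (\<lambda>t. indicator {0..} t * (P t h x - P t h y))"
    and "sol h x - sol h y = - (\<integral>t. indicator {0..} t * (P t h x - P t h y) \<partial>lborel)"
proof -
  note ix = sol_transient(1)[OF x, unfolded set_integrable_def]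
  note iy = sol_transient(1)[OF y, unfolded set_integrable_def]
  have eq: "indicator {0..} t *\<^sub>R integrand h x t - indicator {0..} t *\<^sub>R integrand h y t
      = indicator {0..} t * (P t h x - P t h y)" for t
    by (simp add: stein_integrand_def right_diff_distrib)
  show "integrable lborel (\<lambda>t. indicator {0..} t * (P t h x - P t h y))"
    using lintegrable_diff[OF ix iy] unfolding eq .
  show "sol h x - sol h y = - (\<integral>t. indicator {0..} t * (P t h x - P t h y) \<partial>lborel)"
    using lintegral_diff[OF ix iy] unfolding eq stein_sol_def set_lebesgue_integral_def by simp
qed

text \<open>The integral in the bound evaluates to \<alpha>; it is left unevaluated.\<close>

lemma sol_lipschitz:
  assumes x: "0 \<le> x" and y: "0 \<le> y"
  shows "\<bar>sol h x - sol h y\<bar> \<le>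
    (\<integral>t. indicator {0..} t * decay t \<partial>lborel) * dist1 x y"
proof -
  note d = sol_diff[OF assms]
  have "\<bar>sol h x - sol h y\<bar> \<le> (\<integral>t. \<bar>indicator {0..} t * (P t h x - P t h y)\<bar> \<partial>lborel)"
    unfolding d(2) abs_minus_cancel by (rule integral_abs_bound)
  also have "\<dots> \<le> (\<integral>t. indicator {0..} t * decay t * dist1 x y \<partial>lborel)"
  proof (rule integral_mono)
    fix t :: real
    show "\<bar>indicator {0..} t * (P t h x - P t h y)\<bar> \<le> indicator {0..} t * decay t * dist1 x y"
      using P_lipschitz[of t x y] by (auto simp: indicator_def)
  qed (use d(1) integrable_decay in auto)
  finally show ?thesis by simp
qed

lemma sol_tendsto:
  assumes x: "0 \<le> x" and xn: "\<And>n. 0 \<le> X n" and lim: "X \<longlonglongrightarrow> x"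
  shows "(\<lambda>n. sol h (X n)) \<longlonglongrightarrow> sol h x"
proof (rule LIM_zero_cancel, rule Lim_null_comparison)
  let ?C = "\<integral>t. indicator {0..} t * decay t \<partial>lborel"
  show "\<forall>\<^sub>F n in sequentially. norm (sol h (X n) - sol h x) \<le> ?C * dist1 (X n) x"
    using sol_lipschitz[OF xn x] by simp
  have "(\<lambda>n. ?C * dist1 (X n) x) \<longlonglongrightarrow> ?C * (\<Sum>j\<in>UNIV. \<bar>x $ j - x $ j\<bar>)"
    by (intro tendsto_intros lim)
  then show "(\<lambda>n. ?C * dist1 (X n) x) \<longlonglongrightarrow> 0" by simp
qed

section \<open>The jump integral of the Stein solution and its continuity\<close>

lemma sol_jump:
  assumes x: "0 \<le> x" and y: "0 \<le> y"
  shows "sol h (sup x y) - sol h x = - (\<integral>t. indicator {0..} t * jump h t x y \<partial>lborel)"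
proof -
  have "0 \<le> sup x y" using x by (rule order_trans) simp
  from sol_diff(2)[OF this x] show ?thesis by (simp add: jump_def)
qed

text \<open>The quantifier over x stands inside the almost-everywhere statement: the exceptional y
  are those with infinite \<open>dom_total y\<close>, whatever x is. Dominated convergence along
  moving starting points relies on this single bound.\<close>

lemma sol_jump_bound:
  shows "AE y in \<mu>. \<forall>x\<ge>0. \<bar>sol h (sup x y) - sol h x\<bar> \<le> total_bound y"
  using maj_finite_AE[OF \<alpha>1] AE_space
proof eventually_elim
  case (elim y)
  have y: "0 \<le> y" using elim(2) by (rule nonneg_space_\<mu>)
  show ?case
  proof (intro allI impI)
    fix x :: "real^'n" assume x: "0 \<le> x"
    have "0 \<le> sup x y" using x by (rule order_trans) simp
    note int = sol_diff(1)[OF this x]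
    have "ennreal \<bar>sol h (sup x y) - sol h x\<bar> = ennreal (norm (\<integral>t. indicator {0..} t * jump h t x y \<partial>lborel))"
      unfolding sol_jump[OF x y] by simp
    also have "\<dots> \<le> (\<integral>\<^sup>+t. ennreal (norm (indicator {0..} t * jump h t x y)) \<partial>lborel)"
      using int unfolding jump_def by (rule integral_norm_bound_ennreal)
    also have "\<dots> \<le> dom_total y"
    proof (rule nn_integral_mono_AE)
      show "AE v in lborel. ennreal (norm (indicator {0..} v * jump h v x y)) \<le> ennreal (maj v y) * indicator {0..} v"
        using AE_lborel_singleton[of 0]
        by eventually_elim (use jump_bound[OF h \<alpha>1 x y] in \<open>auto simp: indicator_def intro!: ennreal_leI\<close>)
    qed
    also have "\<dots> = ennreal (total_bound y)" using elim(1) by (simp add: total_bound_def less_top)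
    finally show "\<bar>sol h (sup x y) - sol h x\<bar> \<le> total_bound y"
      by (simp add: total_bound_def)
  qed
qed

lemma sol_jump_measurable:
  assumes x: "0 \<le> x"
  shows "(\<lambda>y. sol h (sup x y) - sol h x) \<in> borel_measurable \<mu>"
proof -
  have "(\<lambda>y. - (\<integral>t. indicator {0..} t * jump h t x y \<partial>lborel)) \<in> borel_measurable \<mu>"
    by (rule measurable_\<mu>) measurable
  then show ?thesis
    by (rule measurable_cong[THEN iffD1, rotated]) (simp add: sol_jump[OF x nonneg_space_\<mu>])
qed

lemma integrable_sol_jump:
  assumes x: "0 \<le> x"
  shows "integrable \<mu> (\<lambda>y. sol h (sup x y) - sol h x)"
proof (rule lintegrable_bound[OF integrable_total_bound[OF \<alpha>1] sol_jump_measurable[OF assms]])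
  show "AE y in \<mu>. norm (sol h (sup x y) - sol h x) \<le> norm (total_bound y)"
    using sol_jump_bound by eventually_elim (use x in \<open>auto intro: order_trans[OF _ abs_ge_self]\<close>)
qed

lemma jump_part_tendsto:
  assumes x: "0 \<le> x" and xn: "\<And>n. 0 \<le> X n" and lim: "X \<longlonglongrightarrow> x"
  shows "(\<lambda>n. jump_part h (X n)) \<longlonglongrightarrow> jump_part h x"
  unfolding jump_part_def
proof (rule integral_dominated_convergence[OF _ _ integrable_total_bound[OF \<alpha>1]])
  have sup0: "0 \<le> z \<Longrightarrow> 0 \<le> sup z y" for z y :: "real^'n" by (rule le_supI1)
  show "AE y in \<mu>. (\<lambda>n. sol h (sup (X n) y) - sol h (X n)) \<longlonglongrightarrow> sol h (sup x y) - sol h x"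
    by (intro AE_I2 tendsto_diff sol_tendsto sup0 x xn lim tendsto_sup tendsto_const)
  show "AE y in \<mu>. norm (sol h (sup (X n) y) - sol h (X n)) \<le> total_bound y" for n
    using sol_jump_bound by eventually_elim (use xn in auto)
qed (intro sol_jump_measurable h \<alpha>1 x xn)+

text \<open>Continuity in \<sigma> is what turns the integrated identity into a pointwise
  derivative.\<close>

lemma flow_continuous:
  assumes x: "0 \<le> x"
  shows "continuous_on S (\<lambda>\<sigma>. h (decay \<sigma> *\<^sub>R x))"
    and "continuous_on S (\<lambda>\<sigma>. jump_part h (decay \<sigma> *\<^sub>R x))"
proof -
  have "continuous_on S (\<lambda>\<sigma>. decay \<sigma> *\<^sub>R x)" using \<alpha> by (intro continuous_intros) auto
  from continuous_on_compose2[OF lip_l1_continuous[OF h] this] show "continuous_on S (\<lambda>\<sigma>. h (decay \<sigma> *\<^sub>R x))"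
    by simp
  have "isCont (\<lambda>\<sigma>. jump_part h (decay \<sigma> *\<^sub>R x)) \<sigma>" for \<sigma>
    unfolding continuous_at_sequentially o_def
  proof (intro allI impI jump_part_tendsto decay_nonneg x)
    fix X assume "X \<longlonglongrightarrow> \<sigma>"
    then show "(\<lambda>n. decay (X n) *\<^sub>R x) \<longlonglongrightarrow> decay \<sigma> *\<^sub>R x"
      using \<alpha> by (intro tendsto_intros) auto
  qed
  then show "continuous_on S (\<lambda>\<sigma>. jump_part h (decay \<sigma> *\<^sub>R x))"
    by (simp add: continuous_at_imp_continuous_on)
qed

text \<open>The kernel K in (u, \<sigma>, y) is integrated in both orders. Integrating over u first
  produces jumps of g; integrating over \<sigma> and y first produces the semigroup increments of
  the flow identity.\<close>

lemma sol_flow: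
  assumes x: "0 \<le> x" and \<tau>: "0 \<le> \<tau>"
  shows "sol h (decay \<tau> *\<^sub>R x) - sol h x =
    (\<integral>\<sigma>. indicator {0..\<tau>} \<sigma> * (h (decay \<sigma> *\<^sub>R x) - expectation (\<lambda>\<omega>. h (Z \<omega>)) - jump_part h (decay \<sigma> *\<^sub>R x)) \<partial>lborel)"
proof -
  let ?x = "\<lambda>\<sigma>. decay \<sigma> *\<^sub>R x"
  interpret W: pair_sigma_finite lborel \<rho> ..
  define c where "c = expectation (\<lambda>\<omega>. h (Z \<omega>))"
  define g where "g = sol h"
  define K where "K u p = indicator (flow_time \<tau> u) (fst p) * jump h (u - fst p) (?x (fst p)) (snd p)"
    for u and p :: "real \<times> (real^'n)"
  have Km: "(\<lambda>(u, p). K u p) \<in> borel_measurable (lborel \<Otimes>\<^sub>M \<rho>)"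
  proof -
    have "(\<lambda>q. K (fst q) (snd q)) \<in> borel_measurable (borel \<Otimes>\<^sub>M (borel \<Otimes>\<^sub>M borel))"
      unfolding K_def flow_time_def indicator_def mem_Collect_eq by measurable
    from measurable_compose[OF triple_measurable this] show ?thesis by (simp add: case_prod_unfold)
  qed
  have Kb: "\<bar>K u p\<bar> \<le> indicator {0..\<tau>} (fst p) * (indicator {fst p<..} u * maj (u - fst p) (snd p))"
    if "p \<in> space \<rho>" for u and p :: "real \<times> (real^'n)"
    using jump_bound[OF h \<alpha>1 decay_nonneg[OF x] pair_space_nonneg[OF that], of "u - fst p" "fst p"]
      maj_nonneg[OF pair_space_nonneg[OF that]]
    by (auto simp: K_def flow_time_def indicator_def)
  \<comment> \<open>The majorant involves u and \<sigma> only through u - \<sigma>, so the total is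
    at most \<tau> times the \<mu>-integral of \<open>dom_total\<close>.\<close>
  have intK: "integrable (lborel \<Otimes>\<^sub>M \<rho>) (\<lambda>(u, p). K u p)"
  proof (rule integrableI_bounded[OF Km])
    have Bm: "dom_total \<in> borel_measurable borel" by measurable
    have "(\<integral>\<^sup>+q. ennreal (norm (case q of (u, p) \<Rightarrow> K u p)) \<partial>(lborel \<Otimes>\<^sub>M \<rho>))
        = (\<integral>\<^sup>+p. (\<integral>\<^sup>+u. ennreal \<bar>K u p\<bar> \<partial>lborel) \<partial>\<rho>)"
      using Km by (subst W.nn_integral_snd[symmetric]) (auto simp: case_prod_unfold)
    also have "\<dots> \<le> (\<integral>\<^sup>+p. indicator {0..\<tau>} (fst p) * dom_total (snd p) \<partial>\<rho>)"
    proof (rule nn_integral_mono)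
      fix p :: "real \<times> (real^'n)" assume p: "p \<in> space \<rho>"
      have "(\<integral>\<^sup>+u. ennreal \<bar>K u p\<bar> \<partial>lborel) \<le> (\<integral>\<^sup>+u. indicator {0..\<tau>} (fst p) * ennreal (indicator {fst p<..} u * maj (u - fst p) (snd p)) \<partial>lborel)"
        by (rule nn_integral_mono) (use Kb[OF p] in \<open>auto simp: indicator_def[of "{0..\<tau>}"] intro!: ennreal_leI split: if_splits\<close>)
      also have "\<dots> = indicator {0..\<tau>} (fst p) * (\<integral>\<^sup>+u. ennreal (indicator {fst p<..} u * maj (u - fst p) (snd p)) \<partial>lborel)"
        by (rule nn_integral_cmult) measurable
      also have "\<dots> \<le> indicator {0..\<tau>} (fst p) * dom_total (snd p)"
        by (intro mult_left_mono nn_integral_maj_shift) simp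
      finally show "(\<integral>\<^sup>+u. ennreal \<bar>K u p\<bar> \<partial>lborel) \<le> indicator {0..\<tau>} (fst p) * dom_total (snd p)" .
    qed
    also have "\<dots> = (\<integral>\<^sup>+\<sigma>. (\<integral>\<^sup>+y. indicator {0..\<tau>} \<sigma> * dom_total y \<partial>\<mu>) \<partial>lborel)"
      by (subst S.nn_integral_fst[symmetric])
        (auto intro!: borel_measurable_times_ennreal measurable_compose[OF pair_measurable_snd Bm] measurable_compose[OF pair_measurable_fst])
    also have "\<dots> = (\<integral>\<^sup>+\<sigma>. indicator {0..\<tau>} \<sigma> * (\<integral>\<^sup>+y. dom_total y \<partial>\<mu>) \<partial>lborel)"
      by (intro nn_integral_cong nn_integral_cmult measurable_\<mu> Bm)
    also have "\<dots> = ennreal \<tau> * (\<integral>\<^sup>+y. dom_total y \<partial>\<mu>)"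
      using \<tau> by (subst nn_integral_multc) auto
    also have "\<dots> < \<infinity>"
      using nn_integral_maj_finite[OF \<alpha>1] by (simp add: ennreal_mult_less_top)
    finally show "(\<integral>\<^sup>+q. ennreal (norm (case q of (u, p) \<Rightarrow> K u p)) \<partial>(lborel \<Otimes>\<^sub>M \<rho>)) < \<infinity>" .
  qed
  \<comment> \<open>Under v = u - \<sigma> the remaining time runs over the whole half-line, which
    recovers the full Stein integral; the minus sign is the one in \<open>stein_sol\<close>.\<close>
  have K_u: "(\<integral>u. K u (\<sigma>, y) \<partial>lborel) = - (indicator {0..\<tau>} \<sigma> * (g (sup (?x \<sigma>) y) - g (?x \<sigma>)))"
    if y: "0 \<le> y" for \<sigma> y
  proof -
    have "(\<integral>u. K u (\<sigma>, y) \<partial>lborel) = \<bar>1\<bar> *\<^sub>R (\<integral>v. K (\<sigma> + 1 * v) (\<sigma>, y) \<partial>lborel)"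
      by (rule lborel_integral_real_affine) simp
    also have "\<dots> = (\<integral>v. indicator {0..\<tau>} \<sigma> * (indicator {0..} v * jump h v (?x \<sigma>) y) \<partial>lborel)"
    proof -
      have "(\<integral>v. K (\<sigma> + 1 * v) (\<sigma>, y) \<partial>lborel) = (\<integral>v. indicator {0..\<tau>} \<sigma> * (indicator {0..} v * jump h v (?x \<sigma>) y) \<partial>lborel)"
      proof (rule integral_cong_AE)
        show "AE v in lborel. K (\<sigma> + 1 * v) (\<sigma>, y) = indicator {0..\<tau>} \<sigma> * (indicator {0..} v * jump h v (?x \<sigma>) y)"
          using AE_lborel_singleton[of 0] by eventually_elim (auto simp: K_def flow_time_def indicator_def)
        show "(\<lambda>v. K (\<sigma> + 1 * v) (\<sigma>, y)) \<in> borel_measurable lborel"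
          unfolding K_def flow_time_def indicator_def mem_Collect_eq fst_conv snd_conv by measurable
      qed measurable
      then show ?thesis by simp
    qed
    also have "\<dots> = indicator {0..\<tau>} \<sigma> * (\<integral>v. indicator {0..} v * jump h v (?x \<sigma>) y \<partial>lborel)" by simp
    also have "(\<integral>v. indicator {0..} v * jump h v (?x \<sigma>) y \<partial>lborel) = - (g (sup (?x \<sigma>) y) - g (?x \<sigma>))"
      unfolding g_def by (subst sol_jump[OF decay_nonneg[OF x] y]) simp
    finally show ?thesis by (simp only: mult_minus_right)
  qed
  have "(\<integral>p. (\<integral>u. K u p \<partial>lborel) \<partial>\<rho>) = (\<integral>\<sigma>. (\<integral>y. (\<integral>u. K u (\<sigma>, y) \<partial>lborel) \<partial>\<mu>) \<partial>lborel)"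
    by (rule SY.integral_fst'[symmetric]) (rule W.integrable_snd[OF intK])
  also have "\<dots> = (\<integral>\<sigma>. - (indicator {0..\<tau>} \<sigma> * jump_part h (?x \<sigma>)) \<partial>lborel)"
  proof (intro lintegral_cong refl)
    fix \<sigma> :: real
    have "(\<integral>y. (\<integral>u. K u (\<sigma>, y) \<partial>lborel) \<partial>\<mu>) = (\<integral>y. - (indicator {0..\<tau>} \<sigma> * (g (sup (?x \<sigma>) y) - g (?x \<sigma>))) \<partial>\<mu>)"
      by (intro lintegral_cong refl K_u nonneg_space_\<mu>)
    then show "(\<integral>y. (\<integral>u. K u (\<sigma>, y) \<partial>lborel) \<partial>\<mu>) = - (indicator {0..\<tau>} \<sigma> * jump_part h (?x \<sigma>))"
      by (simp add: jump_part_def g_def)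
  qed
  finally have right: "(\<integral>p. (\<integral>u. K u p \<partial>lborel) \<partial>\<rho>) = - (\<integral>\<sigma>. indicator {0..\<tau>} \<sigma> * jump_part h (?x \<sigma>) \<partial>lborel)"
    by simp
  let ?f = "\<lambda>z u. indicator {0..} u * integrand h z u"
  have int_f: "integrable lborel (?f z)" and g_f: "g z = - (\<integral>u. ?f z u \<partial>lborel)" if "0 \<le> z" for z
    using sol_transient(1)[OF that]
    by (auto simp: set_integrable_def g_def stein_sol_def set_lebesgue_integral_def)
  let ?z = "?x \<tau>"
  have int_shift: "integrable lborel (\<lambda>u. ?f ?z (u - \<tau>))"
    using lborel_integrable_real_affine[OF int_f[OF decay_nonneg[OF x]], of 1 "- \<tau>" \<tau>] by simp
  have shift: "(\<integral>u. ?f ?z (u - \<tau>) \<partial>lborel) = (\<integral>u. ?f ?z u \<partial>lborel)"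
    using lborel_integral_real_affine[of 1 "?f ?z" "- \<tau>"] by simp
  have int_on: "integrable lborel (\<lambda>\<sigma>. indicator {0..\<tau>} \<sigma> * f \<sigma>)" if "continuous_on {0..\<tau>} f" for f :: "real \<Rightarrow> real"
    using borel_integrable_atLeastAtMost'[OF that] by (simp add: set_integrable_def)
  have int_h: "integrable lborel (\<lambda>\<sigma>. indicator {0..\<tau>} \<sigma> * (h (?x \<sigma>) - c))"
    by (intro int_on continuous_intros flow_continuous(1)[OF x])
  have int_j: "integrable lborel (\<lambda>\<sigma>. indicator {0..\<tau>} \<sigma> * jump_part h (?x \<sigma>))"
    by (intro int_on flow_continuous(2)[OF x])
  \<comment> \<open>For 0 < u < \<tau> the last term is 0 and P_0 h gives h on the flow; for u >
    \<tau> the middle term is 0. At u = \<tau> both terms would be present, so this point and u = 0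
    are set aside as null.\<close>
  have K_p: "(\<integral>p. K u p \<partial>\<rho>) = ?f x u - indicator {0..\<tau>} u * (h (?x u) - c) - ?f ?z (u - \<tau>)"
    if "u \<noteq> 0" "u \<noteq> \<tau>" for u
  proof (cases "0 < u")
    case True
    have "(\<integral>p. K u p \<partial>\<rho>) = P u h x - P (u - min u \<tau>) h (decay (min u \<tau>) *\<^sub>R x)"
      unfolding K_def by (rule semigroup_flow[OF x \<tau> True, symmetric])
    then show ?thesis
      using True that P_0[OF decay_nonneg[OF x], of h u]
      by (cases "u < \<tau>") (auto simp: stein_integrand_def c_def min_def)
  next
    case False
    then have "flow_time \<tau> u = {}" by (auto simp: flow_time_def)
    then show ?thesis using False that \<tau> by (simp add: K_def)
  qed
  have "(\<integral>u. (\<integral>p. K u p \<partial>\<rho>) \<partial>lborel) =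
      (\<integral>u. ?f x u - indicator {0..\<tau>} u * (h (?x u) - c) - ?f ?z (u - \<tau>) \<partial>lborel)"
  proof (rule integral_cong_AE)
    show "AE u in lborel. (\<integral>p. K u p \<partial>\<rho>) = ?f x u - indicator {0..\<tau>} u * (h (?x u) - c) - ?f ?z (u - \<tau>)"
      using AE_lborel_singleton[of 0] AE_lborel_singleton[of \<tau>] by eventually_elim (rule K_p)
    show "(\<lambda>u. \<integral>p. K u p \<partial>\<rho>) \<in> borel_measurable lborel"
      using W.integrable_fst[OF intK] by (rule borel_measurable_integrable)
    show "(\<lambda>u. ?f x u - indicator {0..\<tau>} u * (h (?x u) - c) - ?f ?z (u - \<tau>)) \<in> borel_measurable lborel"
      by (intro borel_measurable_integrable lintegrable_diff int_f[OF x] int_h int_shift)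
  qed
  also have "\<dots> = - g x - (\<integral>\<sigma>. indicator {0..\<tau>} \<sigma> * (h (?x \<sigma>) - c) \<partial>lborel) + g ?z"
    unfolding lintegral_diff[OF lintegrable_diff[OF int_f[OF x] int_h] int_shift]
      lintegral_diff[OF int_f[OF x] int_h] shift g_f[OF x] g_f[OF decay_nonneg[OF x]]
    by simp
  finally have left: "(\<integral>u. (\<integral>p. K u p \<partial>\<rho>) \<partial>lborel) =
      - g x - (\<integral>\<sigma>. indicator {0..\<tau>} \<sigma> * (h (?x \<sigma>) - c) \<partial>lborel) + g ?z" .
  have "g ?z - g x = (\<integral>\<sigma>. indicator {0..\<tau>} \<sigma> * (h (?x \<sigma>) - c) \<partial>lborel) - (\<integral>\<sigma>. indicator {0..\<tau>} \<sigma> * jump_part h (?x \<sigma>) \<partial>lborel)"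
    using W.Fubini_integral[OF intK] left right by linarith
  also have "\<dots> = (\<integral>\<sigma>. indicator {0..\<tau>} \<sigma> * (h (?x \<sigma>) - c) - indicator {0..\<tau>} \<sigma> * jump_part h (?x \<sigma>) \<partial>lborel)"
    by (rule lintegral_diff[OF int_h int_j, symmetric])
  finally show ?thesis unfolding g_def c_def by (simp add: right_diff_distrib)
qed

text \<open>The flow only contracts, so starting at x would give a one-sided derivative. Starting at
  z = exp (1/\<alpha>) x puts x at time 1, inside [0,2]; then s x is reached at time 1 - \<alpha> ln
  s, whose derivative at 1 is the factor -\<alpha>.\<close>

lemma sol_radial_derivative:
  assumes x: "0 \<le> x"
  shows "((\<lambda>s. sol h (s *\<^sub>R x)) has_real_derivative
    - \<alpha> * (h x - expectation (\<lambda>\<omega>. h (Z \<omega>)) - jump_part h x)) (at 1)"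
proof -
  define c where "c = expectation (\<lambda>\<omega>. h (Z \<omega>))"
  define z where "z = decay (- 1) *\<^sub>R x"
  define \<psi> where "\<psi> \<sigma> = h (decay \<sigma> *\<^sub>R z) - c - jump_part h (decay \<sigma> *\<^sub>R z)" for \<sigma>
  define D where "D \<tau> = sol h (decay \<tau> *\<^sub>R z)" for \<tau>
  have z: "0 \<le> z" unfolding z_def by (rule decay_nonneg[OF x])
  have cont: "continuous_on S \<psi>" for S
    unfolding \<psi>_def by (intro continuous_intros flow_continuous h \<alpha>1 z)
  have D_eq: "D \<tau> = D 0 + integral {0..\<tau>} \<psi>" if "\<tau> \<in> {0..2}" for \<tau>
  proof -
    have "set_integrable lborel {0..\<tau>} \<psi>" by (rule borel_integrable_atLeastAtMost'[OF cont])
    from set_borel_integral_eq_integral(2)[OF this]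
    have "integral {0..\<tau>} \<psi> = (\<integral>\<sigma>. indicator {0..\<tau>} \<sigma> * \<psi> \<sigma> \<partial>lborel)"
      by (simp add: set_lebesgue_integral_def)
    also have "\<dots> = D \<tau> - D 0"
      using sol_flow[OF z, of \<tau>] that unfolding \<psi>_def D_def c_def by simp
    finally show ?thesis by simp
  qed
  have "((\<lambda>\<tau>. D 0 + integral {0..\<tau>} \<psi>) has_real_derivative 0 + \<psi> 1) (at 1 within {0..2})"
    by (intro DERIV_add DERIV_const integral_has_real_derivative cont) auto
  then have "(D has_real_derivative 0 + \<psi> 1) (at 1 within {0..2})"
    by (rule has_field_derivative_transform_within[OF _ zero_less_one]) (simp, rule D_eq[symmetric])
  moreover have "at (1::real) within {0..2} = at 1" by (rule at_within_interior) simp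
  ultimately have D': "(D has_real_derivative \<psi> 1) (at (1 - \<alpha> * ln 1))" by simp
  have "((\<lambda>s. 1 - \<alpha> * ln s) has_real_derivative - \<alpha>) (at 1)"
    by (auto intro!: derivative_eq_intros)
  from DERIV_chain2[OF D' this] have "((\<lambda>s. D (1 - \<alpha> * ln s)) has_real_derivative \<psi> 1 * - \<alpha>) (at 1)" .
  moreover have "D (1 - \<alpha> * ln s) = sol h (s *\<^sub>R x)" if "0 < s" for s
  proof -
    have "decay (1 - \<alpha> * ln s) * decay (- 1) = exp (ln s)"
      unfolding mult_exp_exp using \<alpha> by (intro arg_cong[where f=exp]) (simp add: field_simps)
    then show ?thesis using that by (simp add: D_def z_def)
  qed
  moreover note eventually_pos_nhds_1
  ultimately have "((\<lambda>s. sol h (s *\<^sub>R x)) has_real_derivative \<psi> 1 * - \<alpha>) (at 1)"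
    by (subst DERIV_cong_ev[OF refl _ refl, where g="\<lambda>s. D (1 - \<alpha> * ln s)"]) (auto elim: eventually_mono)
  moreover have "decay 1 *\<^sub>R z = x"
    unfolding z_def by (simp add: mult_exp_exp)
  ultimately show ?thesis by (simp add: \<psi>_def c_def mult.commute)
qed

text \<open>The factor -1/\<alpha> cancels -\<alpha>, and the jump part of the radial derivative
  cancels that of the generator.\<close>

lemma generator_sol_lipschitz:
  assumes x: "0 \<le> x"
  shows "generator_defined \<alpha> \<nu> (sol h) x"
    and "generator \<alpha> \<nu> (sol h) x = h x - (\<integral>\<omega>. h (Z \<omega>) \<partial>M)"
proof -
  note D = sol_radial_derivative[OF assms]
  show "generator_defined \<alpha> \<nu> (sol h) x"
    unfolding generator_defined_def
    using D integrable_sol_jump[OF assms] by (auto simp: real_differentiable_def)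
  show "generator \<alpha> \<nu> (sol h) x = h x - (\<integral>\<omega>. h (Z \<omega>) \<partial>M)"
    unfolding generator_def radial_deriv_def DERIV_imp_deriv[OF D] jump_part_def using \<alpha> by simp
qed

end

end

section \<open>Differentiability of the Stein solution relative to the orthant\<close>

lemma has_derivative_within_orthant_bound:
  fixes h :: "real^'n \<Rightarrow> real"
  assumes h: "lip_l1 h" and y: "0 \<le> y"
    and D: "(h has_derivative (\<lambda>v. G \<bullet> v)) (at y within {0..})"
  shows "\<bar>G $ j\<bar> \<le> 1"
proof (rule field_le_epsilon)
  fix e :: real assume "0 < e"
  with D obtain d where d: "0 < d"
    and bd: "\<And>z. 0 \<le> z \<Longrightarrow> norm (z - y) < d \<Longrightarrow> norm (h z - h y - G \<bullet> (z - y)) \<le> e * norm (z - y)"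
    unfolding has_derivative_within_alt by fastforce
  \<comment> \<open>The direction +e_j never leaves the orthant, even from a boundary point; half of
    d keeps z within the radius.\<close>
  define z where "z = y + (d / 2) *\<^sub>R axis j 1"
  have nz: "norm (z - y) = d / 2" using d by (simp add: z_def)
  have "0 \<le> z" using y d by (auto simp: z_def less_eq_vec_def axis_def)
  from bd[OF this] nz d have 1: "\<bar>h z - h y - G \<bullet> (z - y)\<bar> \<le> e * (d / 2)" by simp
  have 2: "G \<bullet> (z - y) = d / 2 * G $ j" by (simp add: z_def inner_axis)
  have "\<bar>h z - h y\<bar> \<le> (\<Sum>i\<in>UNIV. \<bar>z $ i - y $ i\<bar>)" using h by (auto simp: lip_l1_def)
  also have "\<dots> = (\<Sum>i\<in>UNIV. if i = j then d / 2 else 0)"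
    using d by (intro sum.cong) (auto simp: z_def axis_def)
  finally have "\<bar>h z - h y\<bar> \<le> d / 2" by simp
  with 1 have "\<bar>d / 2 * G $ j\<bar> \<le> d / 2 + e * (d / 2)" unfolding 2 by linarith
  then have "d / 2 * \<bar>G $ j\<bar> \<le> d / 2 * (1 + e)" using d by (simp add: abs_mult algebra_simps)
  then show "\<bar>G $ j\<bar> \<le> 1 + e" using d by simp
qed

context max_stable_law
begin

lemma weight_strict_mono: "0 \<le> s \<Longrightarrow> s < t \<Longrightarrow> weight s < weight t"
  using \<alpha> by (intro powr_less_mono2) auto

text \<open>For fixed \<omega> and j the left side increases strictly in t and the right side does
  not increase, so at most one time is a tie; Fubini then makes the exceptional pairs null.\<close>

lemma no_ties_AE:
  assumes x: "0 \<le> x"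
  shows "AE p in M \<Otimes>\<^sub>M lborel. 0 \<le> snd p \<longrightarrow> (\<forall>j. weight (snd p) * Z (fst p) $ j \<noteq> decay (snd p) * x $ j)"
proof -
  interpret Q: pair_sigma_finite M lborel ..
  have "AE t in lborel. 0 \<le> t \<longrightarrow> (\<forall>j. weight t * Z \<omega> $ j \<noteq> decay t * x $ j)" if \<omega>: "\<omega> \<in> space M" for \<omega>
  proof -
    have "AE t in lborel. 0 \<le> t \<longrightarrow> weight t * Z \<omega> $ j \<noteq> decay t * x $ j" for j
    proof (cases "\<exists>s\<ge>0. weight s * Z \<omega> $ j = decay s * x $ j")
      case True
      then obtain s where s: "0 \<le> s" "weight s * Z \<omega> $ j = decay s * x $ j" by auto
      have less: False if "0 \<le> a" "a < b" "weight a * Z \<omega> $ j = decay a * x $ j" "weight b * Z \<omega> $ j = decay b * x $ j" for a b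
      proof -
        have "weight a * Z \<omega> $ j < weight b * Z \<omega> $ j"
          using weight_strict_mono[OF that(1,2)] Z_pos[OF \<omega>, of j] by (rule mult_strict_right_mono)
        moreover have "decay b * x $ j \<le> decay a * x $ j"
          using that x \<alpha> by (intro mult_right_mono) (auto simp: divide_right_mono less_eq_vec_def)
        ultimately show False using that by simp
      qed
      show ?thesis using AE_lborel_singleton[of s]
      proof eventually_elim
        case (elim t)
        show ?case
        proof (intro impI notI)
          assume t: "0 \<le> t" "weight t * Z \<omega> $ j = decay t * x $ j"
          show False using less[of s t] less[of t s] s t elim by (cases "s < t") auto
        qed
      qed
    qed auto
    then have "AE t in lborel. \<forall>j. 0 \<le> t \<longrightarrow> weight t * Z \<omega> $ j \<noteq> decay t * x $ j"
      by (subst AE_all_countable) auto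
    then show ?thesis by eventually_elim auto
  qed
  then have "AE \<omega> in M. AE t in lborel. 0 \<le> snd (\<omega>, t) \<longrightarrow> (\<forall>j. weight (snd (\<omega>, t)) * Z (fst (\<omega>, t)) $ j \<noteq> decay (snd (\<omega>, t)) * x $ j)"
    unfolding fst_conv snd_conv by (rule AE_I2)
  then show ?thesis
    by (rule Q.AE_pair_measure[rotated]) measurable
qed

text \<open>The pathwise gradient in the starting point: only coordinates where the decayed x beats
  the scaled Z respond, each with factor \<open>decay t\<close>.\<close>

definition active_gradient :: "(real^'n \<Rightarrow> real^'n) \<Rightarrow> real^'n \<Rightarrow> 'a \<Rightarrow> real \<Rightarrow> real^'n" where
  "active_gradient G x \<omega> t = (\<chi> j. if weight t * Z \<omega> $ j < decay t * x $ j
     then decay t * G (path t x \<omega>) $ j else 0)"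

text \<open>Away from ties the set of coordinates won by x is locally constant, so the path is
  locally the affine map y -> k + A y. It maps the orthant into itself, as the chain rule within the
  orthant demands.\<close>

lemma transient_has_derivative:
  assumes D: "\<And>y. 0 \<le> y \<Longrightarrow> (h has_derivative (\<lambda>v. G y \<bullet> v)) (at y within {0..})"
    and x: "0 \<le> x" and \<omega>: "\<omega> \<in> space M"
    and ne: "\<And>j. weight t * Z \<omega> $ j \<noteq> decay t * x $ j"
  shows "((\<lambda>y. transient h y \<omega> t) has_derivative (\<lambda>v. active_gradient G x \<omega> t \<bullet> v)) (at x within {0..})"
proof -
  let ?act = "\<lambda>j. weight t * Z \<omega> $ j < decay t * x $ j"
  let ?\<xi> = "path t x \<omega>"
  define A where "A v = (\<chi> j. if ?act j then decay t * v $ j else 0)" for v :: "real^'n"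
  define k where "k = (\<chi> j. if ?act j then 0 else weight t * Z \<omega> $ j)"
  have "linear A" by (rule linearI) (auto simp: A_def vec_eq_iff algebra_simps)
  then have A: "bounded_linear A" by (simp add: linear_conv_bounded_linear)
  have l: "((\<lambda>y. k + A y) has_derivative A) (at x within {0..})"
    using has_derivative_add[OF has_derivative_const bounded_linear_imp_has_derivative[OF A], of k "at x within {0..}"] by simp
  have lx: "k + A x = ?\<xi>" by (auto simp: k_def A_def vec_eq_iff)
  have "(\<lambda>y. k + A y) ` {0..} \<subseteq> {0..}"
    using Z_pos[OF \<omega>] by (auto simp: k_def A_def less_eq_vec_def less_imp_le)
  moreover have "0 \<le> ?\<xi>" by (rule le_supI1) (use x in \<open>auto simp: less_eq_vec_def\<close>)
  ultimately have "(h has_derivative (\<lambda>v. G ?\<xi> \<bullet> v)) (at (k + A x) within (\<lambda>y. k + A y) ` {0..})"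
    unfolding lx by (intro has_derivative_subset[OF D])
  from diff_chain_within[OF l this]
  have "((\<lambda>y. h (k + A y)) has_derivative (\<lambda>v. G ?\<xi> \<bullet> A v)) (at x within {0..})" by (simp add: o_def)
  moreover have "G ?\<xi> \<bullet> A v = active_gradient G x \<omega> t \<bullet> v" for v
    unfolding inner_vec_def by (intro sum.cong) (auto simp: A_def active_gradient_def)
  ultimately have "((\<lambda>y. h (k + A y)) has_derivative (\<lambda>v. active_gradient G x \<omega> t \<bullet> v)) (at x within {0..})" by simp
  then have 1: "((\<lambda>y. h (k + A y) - h (Z \<omega>)) has_derivative (\<lambda>v. active_gradient G x \<omega> t \<bullet> v)) (at x within {0..})"
    using has_derivative_diff[OF _ has_derivative_const[of "h (Z \<omega>)"]] by fastforce
  have lim: "((\<lambda>y. decay t * y $ j) \<longlongrightarrow> decay t * x $ j) (at x within {0..})" for j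
    by (intro tendsto_intros)
  have "\<forall>\<^sub>F y in at x within {0..}. \<forall>j. (k + A y) $ j = (path t y \<omega>) $ j"
  proof (rule eventually_all_finite)
    fix j
    show "\<forall>\<^sub>F y in at x within {0..}. (k + A y) $ j = (path t y \<omega>) $ j"
    proof (cases "?act j")
      case True
      from order_tendstoD(1)[OF lim True] show ?thesis
        by eventually_elim (use True in \<open>simp add: k_def A_def\<close>)
    next
      case False
      then have "decay t * x $ j < weight t * Z \<omega> $ j" using ne[of j] by simp
      from order_tendstoD(2)[OF lim this] show ?thesis
        by eventually_elim (use False in \<open>simp add: k_def A_def\<close>)
    qed
  qed
  then have "\<forall>\<^sub>F y in at x within {0..}. h (k + A y) - h (Z \<omega>) = transient h y \<omega> t"
  proof eventually_elim
    case (elim y)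
    then have "k + A y = path t y \<omega>" by (rule vec_eq_iff[THEN iffD2])
    then show ?case by (simp only: transient_def)
  qed
  from has_derivative_transform_eventually[OF 1 this] show ?thesis
    using x by (simp add: transient_def lx)
qed

lemma sol_differentiable:
  assumes h: "lip_l1 h" and \<alpha>1: "\<alpha> > 1" and x: "0 \<le> x"
    and G: "continuous_on {0..} G"
    and D: "\<And>y. 0 \<le> y \<Longrightarrow> (h has_derivative (\<lambda>v. G y \<bullet> v)) (at y within {0..})"
  shows "sol h differentiable (at x within {0..})"
proof -
  let ?Q = "M \<Otimes>\<^sub>M (lborel :: real measure)"
  have [measurable]: "h \<in> borel_measurable borel" by (rule lip_l1_measurable[OF h])
  \<comment> \<open>G is controlled on the orthant only; its extension by 0 is Borel and has all
    coordinates bounded by 1 everywhere.\<close>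
  define G' where "G' y = indicator {0..} y *\<^sub>R G y" for y
  have "{0::real^'n..} = {y. 0 \<le> y}" by auto
  also have "\<dots> \<in> sets borel" by measurable
  finally have [measurable]: "G' \<in> borel_measurable borel"
    unfolding G'_def using G by (intro borel_measurable_continuous_on_indicator)
  have D': "(h has_derivative (\<lambda>v. G' y \<bullet> v)) (at y within {0..})" if "0 \<le> y" for y
    using D[OF that] that by (simp add: G'_def)
  have G'b: "\<bar>G' y $ j\<bar> \<le> 1" for y j
    using has_derivative_within_orthant_bound[OF h _ D'] by (cases "0 \<le> y") (auto simp: G'_def)
  define V where "V p = indicator {0..} (snd p) *\<^sub>R active_gradient G' x (fst p) (snd p)" for p
  define T where "T y p = tr h y p" for y p
  have Vm [measurable]: "V \<in> borel_measurable ?Q"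
    unfolding V_def active_gradient_def by measurable
  let ?d = "real CARD('n)"
  let ?B = "\<lambda>p. indicator {0..} (snd p) * decay (snd p)"
  have normV: "norm (V p) \<le> ?d * ?B p" for p
  proof -
    have "norm (V p) \<le> (\<Sum>j\<in>UNIV. \<bar>V p $ j\<bar>)" by (rule norm_le_l1_cart)
    also have "\<dots> \<le> (\<Sum>j\<in>(UNIV::'n set). ?B p)"
    proof (rule sum_mono)
      fix j
      show "\<bar>V p $ j\<bar> \<le> ?B p"
        using mult_left_mono[OF G'b, of "decay (snd p)"] by (auto simp: V_def active_gradient_def abs_mult indicator_def)
    qed
    finally show ?thesis by simp
  qed
  have intB: "integrable ?Q (\<lambda>p. ?d * ?B p)" by (intro integrable_mult_right integrable_decay_pair)
  have intV: "integrable ?Q V"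
    by (rule lintegrable_bound[OF intB Vm]) (use normV in \<open>auto intro!: AE_I2 intro: order_trans[OF _ abs_ge_self]\<close>)
  have intT: "integrable ?Q (T y)" and gT: "sol h y = - (\<integral>p. T y p \<partial>?Q)" if "0 \<le> y" for y
    using integrable_transient_pair[OF h \<alpha>1 that] sol_transient(2)[OF h \<alpha>1 that] by (auto simp: T_def[abs_def])
  define L where "L = - (\<integral>p. V p \<partial>?Q)"
  have "(sol h has_derivative (\<lambda>v. L \<bullet> v)) (at x within {0..})"
    unfolding has_derivative_at_within tendsto_at_iff_sequentially
  proof (intro conjI allI impI bounded_linear_inner_right)
    fix X :: "nat \<Rightarrow> real^'n"
    assume X: "\<forall>i. X i \<in> {0..} - {x}" and lim: "X \<longlonglongrightarrow> x"
    have Xn: "0 \<le> X i" "X i \<noteq> x" for i using X by auto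
    \<comment> \<open>The pathwise remainder quotient. The 2 in its bound has one share from the
      Lipschitz increment of the path and one from the gradient V.\<close>
    define q where "q i p = ((T (X i) p - T x p) - V p \<bullet> (X i - x)) /\<^sub>R norm (X i - x)" for i p
    have "(\<lambda>i. \<integral>p. q i p \<partial>?Q) \<longlonglongrightarrow> (\<integral>p. 0 \<partial>?Q)"
    proof (rule integral_dominated_convergence)
      show "integrable ?Q (\<lambda>p. 2 * (?d * ?B p))" by (rule integrable_mult_right[OF intB])
      show "AE p in ?Q. norm (q i p) \<le> 2 * (?d * ?B p)" for i
      proof (rule AE_I2)
        fix p
        have "\<bar>transient h (X i) (fst p) (snd p) - transient h x (fst p) (snd p)\<bar> \<le> decay (snd p) * dist1 (X i) x"
          using lipschitz_sup_increment[OF h] by (simp add: transient_def)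
        also have "\<dots> \<le> decay (snd p) * (?d * norm (X i - x))"
        proof (rule mult_left_mono)
          have "dist1 (X i) x \<le> (\<Sum>j\<in>(UNIV::'n set). norm (X i - x))"
            using component_le_norm_cart[of "X i - x"] by (intro sum_mono) simp
          then show "dist1 (X i) x \<le> ?d * norm (X i - x)" by simp
        qed simp
        finally have 1: "\<bar>T (X i) p - T x p\<bar> \<le> ?d * ?B p * norm (X i - x)"
          by (auto simp: T_def indicator_def mult_ac)
        have "\<bar>V p \<bullet> (X i - x)\<bar> \<le> norm (V p) * norm (X i - x)" by (rule Cauchy_Schwarz_ineq2)
        also have "\<dots> \<le> ?d * ?B p * norm (X i - x)" by (intro mult_right_mono normV) simp
        finally have "\<bar>T (X i) p - T x p - V p \<bullet> (X i - x)\<bar> \<le> 2 * (?d * ?B p) * norm (X i - x)"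
          using 1 by (simp add: algebra_simps)
        then show "norm (q i p) \<le> 2 * (?d * ?B p)"
          using Xn(2)[of i] by (simp add: q_def abs_mult divide_simps mult.commute)
      qed
      show "AE p in ?Q. (\<lambda>i. q i p) \<longlonglongrightarrow> 0"
        using no_ties_AE[OF x] AE_space
      proof eventually_elim
        case (elim p)
        then have \<omega>: "fst p \<in> space M" by (auto simp: space_pair_measure)
        show ?case
        proof (cases "0 \<le> snd p")
          case True
          with elim have "((\<lambda>y. transient h y (fst p) (snd p)) has_derivative (\<lambda>v. active_gradient G' x (fst p) (snd p) \<bullet> v)) (at x within {0..})"
            by (intro transient_has_derivative D' x \<omega>) auto
          then have "((\<lambda>y. (transient h y (fst p) (snd p) - transient h x (fst p) (snd p) - active_gradient G' x (fst p) (snd p) \<bullet> (y - x)) /\<^sub>R norm (y - x)) \<circ> X) \<longlonglongrightarrow> 0"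
            using X lim unfolding has_derivative_at_within tendsto_at_iff_sequentially by blast
          then show ?thesis using True by (simp add: q_def T_def V_def o_def)
        next
          case False
          then show ?thesis by (simp add: q_def T_def V_def)
        qed
      qed
    qed (simp_all add: q_def T_def)
    moreover have "(\<integral>p. q i p \<partial>?Q) = - (((sol h (X i) - sol h x) - L \<bullet> (X i - x)) /\<^sub>R norm (X i - x))" for i
    proof -
      have i1: "integrable ?Q (\<lambda>p. T (X i) p - T x p)" by (intro lintegrable_diff intT Xn x)
      have i2: "integrable ?Q (\<lambda>p. V p \<bullet> (X i - x))" by (intro integrable_inner_left intV)
      have "(\<integral>p. (T (X i) p - T x p) - V p \<bullet> (X i - x) \<partial>?Q) = (\<integral>p. T (X i) p \<partial>?Q) - (\<integral>p. T x p \<partial>?Q) - (\<integral>p. V p \<partial>?Q) \<bullet> (X i - x)"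
        unfolding lintegral_diff[OF i1 i2] lintegral_diff[OF intT[OF Xn(1)] intT[OF x]]
        using intV by simp
      also have "\<dots> = - ((sol h (X i) - sol h x) - L \<bullet> (X i - x))"
        by (simp add: gT[OF Xn(1)] gT[OF x] L_def)
      finally show ?thesis unfolding q_def integral_scaleR_right by (simp only: scaleR_minus_right)
    qed
    ultimately have "(\<lambda>i. - (((sol h (X i) - sol h x) - L \<bullet> (X i - x)) /\<^sub>R norm (X i - x))) \<longlonglongrightarrow> 0" by simp
    from tendsto_minus[OF this]
    show "((\<lambda>y. ((sol h y - sol h x) - L \<bullet> (y - x)) /\<^sub>R norm (y - x)) \<circ> X) \<longlonglongrightarrow> 0"
      by (simp add: o_def)
  qed
  then show ?thesis by (auto simp: differentiable_def)
qed

section \<open>Reduction from functions on the orthant to functions on the whole space\<close>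

lemma sol_extend:
  assumes "0 \<le> x"
  shows "sol (\<lambda>y. h (sup y 0)) x = sol h x"
    and "integrand (\<lambda>y. h (sup y 0)) x t = integrand h x t"
    and "(\<integral>\<omega>. h (sup (Z \<omega>) 0) \<partial>M) = (\<integral>\<omega>. h (Z \<omega>) \<partial>M)"
proof -
  have s: "sup (sup (decay t *\<^sub>R x) w) 0 = sup (decay t *\<^sub>R x) w" for t w
    using decay_nonneg[OF assms] by (intro sup.absorb1 le_supI1)
  have Z: "sup (Z \<omega>) 0 = Z \<omega>" if "\<omega> \<in> space M" for \<omega>
    using Z_pos[OF that] by (intro sup.absorb1) (auto simp: less_eq_vec_def less_imp_le)
  show E: "(\<integral>\<omega>. h (sup (Z \<omega>) 0) \<partial>M) = (\<integral>\<omega>. h (Z \<omega>) \<partial>M)"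
    by (intro lintegral_cong refl) (simp add: Z)
  show I: "integrand (\<lambda>y. h (sup y 0)) x t = integrand h x t" for t
    unfolding stein_integrand_def max_stable_semigroup_def by (simp only: s E)
  show "sol (\<lambda>y. h (sup y 0)) x = sol h x"
    unfolding stein_sol_def by (simp only: ext[OF I])
qed

text \<open>At x in the orthant the generator sees orthant values only: s x for s near 1, and
  \<open>sup x y\<close>, which lies above x.\<close>

lemma generator_cong:
  assumes fg: "\<And>y. 0 \<le> y \<Longrightarrow> f y = g y" and x: "0 \<le> x"
  shows "generator \<alpha> \<nu> f x = generator \<alpha> \<nu> g x"
    and "generator_defined \<alpha> \<nu> f x = generator_defined \<alpha> \<nu> g x"
proof -
  from eventually_pos_nhds_1 have ev: "\<forall>\<^sub>F s in nhds 1. f (s *\<^sub>R x) = g (s *\<^sub>R x)"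
    by eventually_elim (use x in \<open>auto intro!: fg simp: less_eq_vec_def\<close>)
  have jump: "f (sup x y) - f x = g (sup x y) - g x" for y
    using x by (simp add: fg le_supI1)
  have "((\<lambda>s. f (s *\<^sub>R x)) has_real_derivative D) (at 1) \<longleftrightarrow> ((\<lambda>s. g (s *\<^sub>R x)) has_real_derivative D) (at 1)" for D
    by (rule DERIV_cong_ev[OF refl ev refl])
  then show "generator_defined \<alpha> \<nu> f x = generator_defined \<alpha> \<nu> g x"
    unfolding generator_defined_def jump real_differentiable_def by simp
  have "radial_deriv f x = radial_deriv g x"
    unfolding radial_deriv_def by (rule deriv_cong_ev[OF ev refl])
  then show "generator \<alpha> \<nu> f x = generator \<alpha> \<nu> g x"
    unfolding generator_def jump by simp
qed

text \<open>h is controlled on the orthant only, so it is replaced by k, its composition with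
  \<open>sup y 0\<close>. This k is globally Lipschitz and agrees with h on the orthant, and
  derivatives within the orthant carry over with the same G.\<close>

lemma stein_equation_smooth:
  assumes C1: "C1_orthant h" and lip: "lip1 h" and \<alpha>1: "\<alpha> > 1" and x: "0 \<le> x"
  shows "set_integrable lborel {0..} (integrand h x)"
    and "sol h differentiable (at x within {0..})"
    and "generator_defined \<alpha> \<nu> (sol h) x"
    and "generator \<alpha> \<nu> (sol h) x = h x - (\<integral>\<omega>. h (Z \<omega>) \<partial>M)"
proof -
  define k where "k = (\<lambda>y. h (sup y 0))"
  have k_eq: "k y = h y" if "0 \<le> y" for y using that by (simp add: k_def sup.absorb1)
  have k: "lip_l1 k"
    unfolding lip_l1_def
  proof (intro allI)
    fix y z :: "real^'n"
    have "\<bar>k y - k z\<bar> \<le> (\<Sum>j\<in>UNIV. \<bar>sup y 0 $ j - sup z 0 $ j\<bar>)"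
      unfolding k_def using lip unfolding lip1_def by (metis sup_ge2)
    also have "\<dots> \<le> (\<Sum>j\<in>UNIV. \<bar>y $ j - z $ j\<bar>)" by (rule sum_mono) (simp add: max_def abs_if)
    finally show "\<bar>k y - k z\<bar> \<le> (\<Sum>j\<in>UNIV. \<bar>y $ j - z $ j\<bar>)" .
  qed
  obtain G where G: "continuous_on {0..} G"
    and D: "\<And>y. 0 \<le> y \<Longrightarrow> (h has_derivative (\<lambda>v. G y \<bullet> v)) (at y within {0..})"
    using C1 by (auto simp: C1_orthant_def)
  have Dk: "(k has_derivative (\<lambda>v. G y \<bullet> v)) (at y within {0..})" if "0 \<le> y" for y
    by (rule has_derivative_transform[OF _ _ D[OF that]]) (use that k_eq in auto)
  have sol: "sol h y = sol k y" if "0 \<le> y" for y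
    using sol_extend(1)[OF that, of h] by (simp add: k_def)
  have "set_integrable lborel {0..} (integrand k x)"
    by (rule sol_transient(1)[OF k \<alpha>1 x])
  then show "set_integrable lborel {0..} (integrand h x)"
    unfolding k_def set_integrable_def sol_extend(2)[OF x] .
  from sol_differentiable[OF k \<alpha>1 x G Dk] obtain D' where
    "(sol k has_derivative D') (at x within {0..})" by (auto simp: differentiable_def)
  then have "(sol h has_derivative D') (at x within {0..})"
    by (rule has_derivative_transform[rotated 2]) (use x sol in auto)
  then show "sol h differentiable (at x within {0..})" by (auto simp: differentiable_def)
  show "generator_defined \<alpha> \<nu> (sol h) x"
    using generator_sol_lipschitz(1)[OF k \<alpha>1 x] generator_cong(2)[OF sol x] by simp
  show "generator \<alpha> \<nu> (sol h) x = h x - (\<integral>\<omega>. h (Z \<omega>) \<partial>M)"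
    using generator_sol_lipschitz(2)[OF k \<alpha>1 x] generator_cong(1)[OF sol x] k_eq[OF x] sol_extend(3)[OF x, of h]
    by (simp add: k_def)
qed

end

text \<open>\<open>deriv\<close> and the Bochner integral return a value even where nothing is
  defined, so convergence of the Stein integral and \<open>generator_defined\<close> accompany each
  equation. Differentiability within the orthant lets the drift be read, through
  \<open>radial_deriv_eq\<close>, as an inner product with a gradient.\<close>

theorem theorem4:
  fixes N :: "real^'n \<Rightarrow> real" and \<nu> :: "(real^'n) measure" and \<alpha> :: real
    and M :: "'a measure" and Z :: "'a \<Rightarrow> real^'n"
  assumes "is_norm N" and "pos_sphere N \<subseteq> {0..1}"
    and "\<alpha> > 0" and "angular_measure N \<nu>" and "max_stable M Z \<alpha> \<nu>"
  shows
    "(\<alpha> > 1 \<longrightarrow>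
       (\<forall>h. C1_orthant h \<and> lip1 h \<longrightarrow>
         (\<forall>x\<ge>0.
           set_integrable lborel {0..} (stein_integrand \<alpha> M Z h x) \<and>
           stein_sol \<alpha> M Z h differentiable (at x within {0..}) \<and>
           generator_defined \<alpha> \<nu> (stein_sol \<alpha> M Z h) x \<and>
           generator \<alpha> \<nu> (stein_sol \<alpha> M Z h) x = h x - (\<integral>\<omega>. h (Z \<omega>) \<partial>M))))
     \<and>
     (\<forall>z \<in> pos_orthant.
       (\<forall>x\<ge>0. set_integrable lborel {0..} (stein_integrand \<alpha> M Z (indicator {0..z}) x)) \<and>
       (\<forall>x\<ge>0. (\<forall>j. x $ j \<noteq> z $ j) \<longrightarrow>
         ((x \<le> z \<or> (\<exists>j. \<forall>i. i \<noteq> j \<longrightarrow> x $ i / z $ i < x $ j / z $ j)) \<longrightarrow>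
            stein_sol \<alpha> M Z (indicator {0..z}) differentiable (at x within {0..})) \<and>
         generator_defined \<alpha> \<nu> (stein_sol \<alpha> M Z (indicator {0..z})) x \<and>
         generator \<alpha> \<nu> (stein_sol \<alpha> M Z (indicator {0..z})) x
           = indicator {0..z} x - cdf_vec M Z z))"
proof -
  interpret max_stable_law N \<nu> \<alpha> M Z using assms by unfold_locales
  show ?thesis
  proof (intro conjI impI allI ballI)
    fix h :: "real^'n \<Rightarrow> real" and x :: "real^'n" assume "1 < \<alpha>" "C1_orthant h \<and> lip1 h" "0 \<le> x"
    then show "set_integrable lborel {0..} (stein_integrand \<alpha> M Z h x)"
      and "stein_sol \<alpha> M Z h differentiable (at x within {0..})"
      and "generator_defined \<alpha> \<nu> (stein_sol \<alpha> M Z h) x"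
      and "generator \<alpha> \<nu> (stein_sol \<alpha> M Z h) x = h x - (\<integral>\<omega>. h (Z \<omega>) \<partial>M)"
      using stein_equation_smooth by auto
  next
    fix z x :: "real^'n" assume z: "z \<in> pos_orthant" and x: "0 \<le> x"
    show "set_integrable lborel {0..} (stein_integrand \<alpha> M Z (indicator {0..z}) x)"
      by (rule integrand_indicator_integrable[OF z x])
    assume ne: "\<forall>j. x $ j \<noteq> z $ j"
    then show "generator_defined \<alpha> \<nu> (stein_sol \<alpha> M Z (indicator {0..z})) x"
      and "generator \<alpha> \<nu> (stein_sol \<alpha> M Z (indicator {0..z})) x = indicator {0..z} x - cdf_vec M Z z"
      using generator_sol_indicator[OF z x] by auto
    show "stein_sol \<alpha> M Z (indicator {0..z}) differentiable (at x within {0..})"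
      if "x \<le> z \<or> (\<exists>j. \<forall>i. i \<noteq> j \<longrightarrow> x $ i / z $ i < x $ j / z $ j)"
      using sol_indicator_differentiable[OF z x _ that] ne by auto
  qed
qed

end
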